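(* Let $n\ge1$, $\alpha>0$, $\lambda\in\mathbb C$ with $s=\operatorname{Re}\lambda>0$. There is a constant $c_{n,\alpha,\lambda}>0$ such that for all $f\in L^2(\mathbb R^n)$ and all $a>0$, with $\phi_a=\mathcal P_\lambda f(\cdot,a)$ (holomorphically extended to $\mathcal T_a$), $$\int_{\mathcal T_a}|\phi_a(z)|^2\,{\bf w}^\alpha_{\lambda,a}(z)\,dz=c_{n,\alpha,\lambda}\,a^{-2s+2n}\int_{\mathbb R^n}|\widehat f(\xi)|^2\,w^\alpha_\lambda(a\xi)\,d\xi,$$ where $w^\alpha_\lambda(\xi)=|\xi|^{2s}\,|K_\lambda(|\xi|)|^2\,\dfrac{I_{\alpha+n/2-1}(2|\xi|)}{(2|\xi|)^{\alpha+n/2-1}}$.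
   Context: Real hyperbolic space is modelled as $\mathbb R^n\times\mathbb R_{>0}$ ($N=\mathbb R^n$, $A=\mathbb R_{>0}$). $|\cdot|$ is the Euclidean norm. The normalized Poisson transform is $\mathcal P_\lambda f(x,a)=\int_{\mathbb R^n}f(u)p_\lambda(x-u,a)\,du$ with $p_\lambda(x,a)=\pi^{-n/2}\frac{\Gamma(\lambda+n/2)}{\Gamma(2\lambda)}a^{\lambda+n/2}(a^2+|x|^2)^{-(\lambda+n/2)}$. For $a>0$, $\mathcal T_a=\{x+iy\in\mathbb C^n:|y|<a\}$; $x\mapsto\mathcal P_\lambda f(x,a)$ extends holomorphically to $\mathcal T_a$ by replacing $|x-u|^2$ with $(z-u)^2=\sum_j(z_j-u_j)^2$ (principal branch). $dz$ is Lebesgue measure on $\mathbb C^n$. ${\bf w}^\alpha_{\lambda,a}(x+iy)=(2\pi)^{-n/2}\Gamma(\alpha)^{-1}(1-|y|^2/a^2)^{\alpha-1}$ on $\mathcal T_a$. $\widehat f(\xi)=(2\pi)^{-n/2}\int f(x)e^{-ix\cdot\xi}dx$. $K_\nu$ is the Macdonald (modified Bessel of second kind) function and $I_\beta$ the modified Bessel function of first kind. *)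

theory Defs
  imports "HOL-Analysis.Analysis"
begin

definition L2 :: "(real^'n \<Rightarrow> complex) \<Rightarrow> bool" where
  "L2 f \<longleftrightarrow> f \<in> borel_measurable lebesgue \<and> integrable lebesgue (\<lambda>x. (cmod (f x))\<^sup>2)"

definition fourier_trunc :: "real \<Rightarrow> (real^'n::finite \<Rightarrow> complex) \<Rightarrow> real^'n \<Rightarrow> complex" where
  "fourier_trunc R f \<xi> =
     complex_of_real ((2 * pi) powr (- real CARD('n) / 2)) *
     (LINT x : cball 0 R | lebesgue. f x * exp (- \<i> * complex_of_real (x \<bullet> \<xi>)))"

definition fourier_L2 :: "(real^'n::finite \<Rightarrow> complex) \<Rightarrow> (real^'n \<Rightarrow> complex) \<Rightarrow> bool" where
  "fourier_L2 f g \<longleftrightarrow> g \<in> borel_measurable lebesgue \<and>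
     ((\<lambda>R. \<integral>\<^sup>+ \<xi>. ennreal ((cmod (g \<xi> - fourier_trunc R f \<xi>))\<^sup>2) \<partial>lebesgue) \<longlongrightarrow> 0) at_top"

definition csq :: "complex^'n::finite \<Rightarrow> real^'n \<Rightarrow> complex" where
  "csq z u = (\<Sum>j\<in>UNIV. (z$j - complex_of_real (u$j))\<^sup>2)"

text \<open>Holomorphically extended normalized Poisson kernel \<open>p_\<lambda>(z-u,a)\<close> (principal branch powers).\<close>
definition poisson_ext :: "complex \<Rightarrow> complex^'n::finite \<Rightarrow> real^'n \<Rightarrow> real \<Rightarrow> complex" where
  "poisson_ext lam z u a =
     (let m = complex_of_real (real CARD('n) / 2) in
      complex_of_real (pi powr (- real CARD('n) / 2)) * Gamma (lam + m) / Gamma (2 * lam) *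
      complex_of_real a powr (lam + m) *
      (complex_of_real (a\<^sup>2) + csq z u) powr (- (lam + m)))"

definition poisson_transform :: "complex \<Rightarrow> (real^'n::finite \<Rightarrow> complex) \<Rightarrow> complex^'n \<Rightarrow> real \<Rightarrow> complex" where
  "poisson_transform lam f z a = (LINT u | lebesgue. f u * poisson_ext lam z u a)"

definition im_part :: "complex^'n::finite \<Rightarrow> real^'n" where
  "im_part z = (\<chi> j. Im (z$j))"

definition tube :: "real \<Rightarrow> (complex^'n::finite) set" where
  "tube a = {z. norm (im_part z) < a}"

definition tube_weight :: "real \<Rightarrow> real \<Rightarrow> complex^'n::finite \<Rightarrow> real" where
  "tube_weight alpha a z =
     (2 * pi) powr (- real CARD('n) / 2) / Gamma alpha *
     (1 - (norm (im_part z))\<^sup>2 / a\<^sup>2) powr (alpha - 1)"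

definition besselK :: "complex \<Rightarrow> real \<Rightarrow> complex" where
  "besselK nu x = (LINT t : {0<..} | lborel. complex_of_real (exp (- x * cosh t)) * cosh (nu * complex_of_real t))"

definition besselI :: "real \<Rightarrow> real \<Rightarrow> real" where
  "besselI beta x = (\<Sum>k. (x / 2) powr (2 * real k + beta) / (fact k * Gamma (real k + beta + 1)))"

definition freq_weight :: "real \<Rightarrow> complex \<Rightarrow> real^'n::finite \<Rightarrow> real" where
  "freq_weight alpha lam \<xi> =
     (let beta = alpha + real CARD('n) / 2 - 1; r = norm \<xi> in
      r powr (2 * Re lam) * (cmod (besselK lam r))\<^sup>2 * besselI beta (2 * r) / (2 * r) powr beta)"

end

theory Submission
  imports Defs "HOL-Probability.Characteristic_Functions" "HOL-Probability.Distributions"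
    "HOL-Complex_Analysis.Cauchy_Integral_Formula"
begin

text \<open>
  Subordination writes \<open>(a\<^sup>2 + (z - u)\<^sup>2) powr - (\<lambda> + n/2)\<close> as a superposition of Gaussians in
  \<open>z - u\<close>; each of these is an explicit Fourier integral, also for complex \<open>z\<close>. So for integrable \<open>f\<close>
  the slice \<open>x \<mapsto> \<phi>\<^sub>a(x + iy)\<close> is the inverse Fourier integral of the bounded continuous integrable function
  \<open>exp (- y \<bullet> \<xi>) q(|\<xi>|) f^(\<xi>)\<close>, where the substitution \<open>t = |\<xi>| / (2a) exp v\<close> in the subordination integral
  identifies \<open>q\<close> with \<open>|\<xi>|\<^sup>\<lambda> K\<^sub>\<lambda>(a|\<xi>|)\<close> up to a constant. Plancherel for such functions follows by
  Gaussian regularisation, and the slice identity passes to \<open>f\<close> in \<open>L\<^sup>2\<close> by truncation and Fatou's lemma,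
  since \<open>exp (|y||\<xi>|) q(|\<xi>|)\<close> is bounded for \<open>|y| < a\<close>. By Tonelli it remains to integrate
  \<open>exp (- 2 y \<bullet> \<xi>) (1 - |y|\<^sup>2/a\<^sup>2)\<^sup>\<alpha>\<^sup>-\<^sup>1\<close> over the ball, which is done term by term in the power
  series and yields the series of the Bessel function \<open>I\<close>.
\<close>

section \<open>Gaussian integrals\<close>

text \<open>The identity is one between extended nonnegative integrals, since both sides may be
  infinite: the growth of the Bessel function I just compensates the decay of |K|^2, and what is
  left of the frequency weight grows like a power of the frequency when \<open>Re lam\<close> is
  large. It is carried out at one height y with |y| < a, where the multiplier is bounded, and y is
  integrated only afterwards. The condition |y| < a is what makes the subordination integral
  converge: the Gaussian with parameter t contributes exp (t |y|^2) against exp (- t a^2). The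
  moments over the ball are found without polar coordinates: Gaussian moments come from comparing
  power series, and a Laplace transform in the squared radius carries them over to the ball. The
  power of a in the result is the sum of 2 Re lam + n from the squared kernel constant, - 4 Re lam
  from writing |subord|^2 as a function of a |\<xi>|, and n from rescaling the ball of radius
  a.\<close>

lemma std_gaussian_fourier:
  "has_bochner_integral lborel (\<lambda>x. exp (- (complex_of_real x)\<^sup>2 / 2) * exp (\<i> * of_real (t * x)))
     (of_real (sqrt (2 * pi)) * exp (- (of_real t)\<^sup>2 / 2))"
proof -
  have int: "integrable lborel (\<lambda>x. std_normal_density x *\<^sub>R exp (\<i> * of_real (t * x)))"
    by (rule Bochner_Integration.integrable_bound[OF integrable_normal_density[of 1 0]]) auto
  have eq: "(LINT x|lborel. std_normal_density x *\<^sub>R exp (\<i> * of_real (t * x))) = exp (- (of_real t)\<^sup>2 / 2)"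
  proof -
    have "char std_normal_distribution t = (LINT x|lborel. std_normal_density x *\<^sub>R exp (\<i> * of_real (t * x)))"
      unfolding char_def std_normal_density_def
      by (subst integral_density) (auto simp: normal_density_nonneg)
    then show ?thesis
      by (simp add: char_std_normal_distribution exp_of_real[symmetric])
  qed
  have "has_bochner_integral lborel (\<lambda>x. of_real (sqrt (2 * pi)) * (std_normal_density x *\<^sub>R exp (\<i> * of_real (t * x))))
     (of_real (sqrt (2 * pi)) * exp (- (of_real t)\<^sup>2 / 2))"
    using int eq by (intro has_bochner_integral_mult_right) (auto simp: has_bochner_integral_iff)
  moreover have "of_real (sqrt (2 * pi)) * (std_normal_density x *\<^sub>R exp (\<i> * of_real (t * x))) =
      exp (- (complex_of_real x)\<^sup>2 / 2) * exp (\<i> * of_real (t * x))" for x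
    by (simp add: std_normal_density_def scaleR_conv_of_real exp_of_real[symmetric])
  ultimately show ?thesis by simp
qed

text \<open>The real part of \<open>w\<close> is absorbed by completing the square, a real shift by
  \<open>p / (2 * c)\<close>, and the imaginary part becomes the frequency \<open>q / r\<close> of a
  standard Gaussian. A complex \<open>w\<close> thus costs no contour shift.\<close>

lemma gaussian_integral_1:
  fixes w :: complex
  assumes c: "c > 0"
  shows "has_bochner_integral lborel (\<lambda>x. exp (w * of_real x - of_real (c * x\<^sup>2)))
     (of_real (sqrt (pi / c)) * exp (w\<^sup>2 / of_real (4 * c)))"
proof -
  define p q where "p = Re w" and "q = Im w"
  define r where "r = sqrt (2 * c)"
  have r: "r > 0" "r\<^sup>2 = 2 * c" using c by (auto simp: r_def)
  have w: "w = of_real p + \<i> * of_real q" by (simp add: p_def q_def complex_eq)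
  let ?A = "exp ((of_real (p\<^sup>2) + 2 * \<i> * of_real (p*q)) / of_real (4 * c)) :: complex"
  have *: "exp (w * of_real (p / (2*c) + (1/r) * v) - of_real (c * (p / (2*c) + (1/r) * v)\<^sup>2)) =
     ?A * (exp (- (complex_of_real v)\<^sup>2 / 2) * exp (\<i> * of_real ((q / r) * v)))" for v
  proof -
    have cr: "c = r\<^sup>2 / 2" using r by simp
    show ?thesis
      unfolding exp_add[symmetric] w
      by (rule arg_cong[where f=exp]) (use r(1) in \<open>simp add: cr field_simps power2_eq_square\<close>)
  qed
  have "has_bochner_integral lborel (\<lambda>x. exp (w * of_real x - of_real (c * x\<^sup>2)))
     (inverse r *\<^sub>R (?A * (of_real (sqrt (2 * pi)) * exp (- (of_real (q / r))\<^sup>2 / 2))))"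
  proof (subst lborel_has_bochner_integral_real_affine_iff[where c="1/r" and t="p/(2*c)"])
    show "1 / r \<noteq> 0" using r by simp
  qed (unfold *, use has_bochner_integral_mult_right[OF std_gaussian_fourier[of "q/r"], of ?A] r in \<open>simp add: divide_simps\<close>)
  also have "(inverse r *\<^sub>R (?A * (of_real (sqrt (2 * pi)) * exp (- (of_real (q / r))\<^sup>2 / 2)))) =
     of_real (sqrt (2 * pi) / r) * (?A * exp (- (of_real (q / r))\<^sup>2 / 2))"
    by (simp add: scaleR_conv_of_real field_simps)
  also have "sqrt (2 * pi) / r = sqrt (pi / c)"
    by (simp add: r_def real_sqrt_divide real_sqrt_mult)
  also have "?A * exp (- (of_real (q / r))\<^sup>2 / 2) = exp (w\<^sup>2 / of_real (4 * c))"
  proof -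
    have cr: "c = r\<^sup>2 / 2" using r by simp
    show ?thesis
      unfolding exp_add[symmetric] w
      by (rule arg_cong[where f=exp]) (use r(1) in \<open>simp add: cr field_simps power2_eq_square\<close>)
  qed
  finally show ?thesis .
qed

text \<open>Lebesgue measure on \<open>real^'n\<close> is available as the image of a product
  measure indexed by \<open>Basis\<close>, not by \<open>'n\<close>; the factors are therefore
  carried over along the bijection from i to \<open>axis i 1\<close>.\<close>

lemma has_bochner_integral_vec_prod:
  fixes f :: "'n::finite \<Rightarrow> real \<Rightarrow> complex"
  assumes f: "\<And>i. has_bochner_integral lborel (f i) (v i)"
  shows "has_bochner_integral lborel (\<lambda>x::real^'n. \<Prod>i\<in>UNIV. f i (x$i)) (\<Prod>i\<in>UNIV. v i)"
proof -
  define e where "e = (\<lambda>i::'n. axis i (1::real))"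
  have inj: "inj e" by (auto simp: e_def inj_def axis_eq_axis)
  have B: "(Basis :: (real^'n) set) = range e" by (auto simp: Basis_vec_def e_def)
  define g where "g = (\<lambda>b. f (inv e b))"
  have ge: "g (e i) = f i" for i using inj by (simp add: g_def)
  interpret product_sigma_finite "\<lambda>b::real^'n. lborel :: real measure"
    by standard
  have fi: "integrable lborel (f i)" "integral\<^sup>L lborel (f i) = v i" for i
    using f[of i] by (auto simp: has_bochner_integral_iff)
  have [measurable]: "f i \<in> borel_measurable borel" for i
    using borel_measurable_integrable[OF fi(1)] by simp
  have comp: "(\<Sum>b\<in>Basis. y b *\<^sub>R b) $ i = y (e i)" for y :: "real^'n \<Rightarrow> real" and i
  proof -
    have "(\<Sum>b\<in>Basis. y b *\<^sub>R b) \<bullet> e i = y (e i)"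
      by (subst inner_sum_left_Basis) (auto simp: B)
    then show ?thesis by (simp add: e_def inner_axis)
  qed
  have P: "(\<Prod>i\<in>UNIV. f i ((\<Sum>b\<in>Basis. y b *\<^sub>R b) $ i)) = (\<Prod>b\<in>Basis. g b (y b))" for y :: "real^'n \<Rightarrow> real"
    unfolding B by (subst prod.reindex) (simp_all only: inj ge comp[unfolded B] o_def)
  have gi: "integrable lborel (g b)" for b by (simp add: g_def fi)
  have "integrable (\<Pi>\<^sub>M b\<in>(Basis::(real^'n) set). lborel) (\<lambda>y. \<Prod>b\<in>Basis. g b (y b))"
    by (rule product_integrable_prod) (auto simp: gi)
  moreover have "integral\<^sup>L (\<Pi>\<^sub>M b\<in>(Basis::(real^'n) set). lborel) (\<lambda>y. \<Prod>b\<in>Basis. g b (y b)) = (\<Prod>b\<in>Basis. integral\<^sup>L lborel (g b))"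
    by (rule product_integral_prod) (auto simp: gi)
  moreover have "(\<Prod>b\<in>(Basis::(real^'n) set). integral\<^sup>L lborel (g b)) = (\<Prod>i\<in>UNIV. v i)"
    unfolding B by (subst prod.reindex) (auto simp: inj ge fi)
  ultimately have "has_bochner_integral (\<Pi>\<^sub>M b\<in>(Basis::(real^'n) set). lborel)
      (\<lambda>y. \<Prod>i\<in>UNIV. f i ((\<Sum>b\<in>Basis. y b *\<^sub>R b) $ i)) (\<Prod>i\<in>UNIV. v i)"
    unfolding P has_bochner_integral_iff by simp
  then have "has_bochner_integral (distr (\<Pi>\<^sub>M b\<in>(Basis::(real^'n) set). lborel) borel (\<lambda>y. \<Sum>b\<in>Basis. y b *\<^sub>R b))
      (\<lambda>x::real^'n. \<Prod>i\<in>UNIV. f i (x$i)) (\<Prod>i\<in>UNIV. v i)"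
    unfolding has_bochner_integral_iff by (subst integrable_distr_eq integral_distr; simp)+
  then show ?thesis
    by (subst lborel_eq)
qed

lemma gaussian_integral:
  fixes w :: "'n::finite \<Rightarrow> complex"
  assumes c: "c > 0"
  shows "has_bochner_integral lborel (\<lambda>x::real^'n. exp ((\<Sum>i\<in>UNIV. w i * of_real (x$i)) - of_real (c * (norm x)\<^sup>2)))
     (of_real ((pi / c) powr (real CARD('n) / 2)) * exp ((\<Sum>i\<in>UNIV. (w i)\<^sup>2) / of_real (4 * c)))"
proof -
  have "(\<Prod>i\<in>(UNIV::'n set). exp (w i * of_real (x$i) - of_real (c * (x$i)\<^sup>2))) =
     exp ((\<Sum>i\<in>UNIV. w i * of_real (x$i)) - of_real (c * (norm x)\<^sup>2))" for x :: "real^'n"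
    by (simp add: exp_sum[symmetric] sum_subtractf norm_vec_def L2_set_def sum_nonneg sum_distrib_left)
  moreover have "(\<Prod>i\<in>(UNIV::'n set). of_real (sqrt (pi / c)) * exp ((w i)\<^sup>2 / of_real (4 * c))) =
     of_real ((pi / c) powr (real CARD('n) / 2)) * exp ((\<Sum>i\<in>UNIV. (w i)\<^sup>2) / of_real (4 * c))"
  proof -
    have "sqrt (pi / c) ^ CARD('n) = (pi / c) powr (real CARD('n) / 2)"
      using c by (simp add: powr_half_sqrt[symmetric] powr_powr powr_realpow[symmetric] del: powr_realpow)
    then show ?thesis
      by (simp add: prod.distrib exp_sum[symmetric] sum_divide_distrib flip: of_real_power)
  qed
  ultimately show ?thesis
    using has_bochner_integral_vec_prod[OF gaussian_integral_1[OF c], of w] by simp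
qed

section \<open>Powers as Laplace transforms\<close>

lemma Gamma_has_bochner_integral:
  assumes "Re z > 0"
  shows "has_bochner_integral lborel
    (\<lambda>t. indicator {0<..} t *\<^sub>R (complex_of_real t powr (z - 1) * exp (- complex_of_real t))) (Gamma z)"
proof -
  let ?f = "\<lambda>t. complex_of_real t powr (z - 1) * exp (- complex_of_real t)"
  have eq: "?f = (\<lambda>t. complex_of_real t powr (z - 1) / of_real (exp t))"
    by (auto simp: exp_minus divide_inverse exp_of_real[symmetric])
  have a: "set_integrable lebesgue {0<..} ?f"
    using absolutely_integrable_Gamma_integral'[OF assms] unfolding eq .
  have i: "set_lebesgue_integral lebesgue {0<..} ?f = Gamma z"
    using Gamma_integral_complex'[OF assms] set_lebesgue_integral_eq_integral(2)[OF a]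
    unfolding eq by (simp add: has_integral_iff)
  \<comment> \<open>Borel measurability is what allows the passage from the completed measure to
    \<open>lborel\<close>. For positive t the complex power is \<open>exp\<close> of a multiple of a
    real logarithm.\<close>
  have m: "(\<lambda>t. indicator {0<..} t *\<^sub>R ?f t) \<in> borel_measurable lborel"
  proof -
    have "(\<lambda>t. indicator {0<..} t *\<^sub>R ?f t) = (\<lambda>t. indicator {0<..} t *\<^sub>R (exp ((z - 1) * of_real (ln t)) * exp (- complex_of_real t)))"
      by (auto simp: indicator_def powr_def Ln_of_real fun_eq_iff)
    then show ?thesis by simp
  qed
  show ?thesis
    using a i m unfolding has_bochner_integral_iff set_integrable_def set_lebesgue_integral_def
    by (simp add: integrable_completion integral_completion)
qed

lemma Gamma_has_bochner_integral_real:
  fixes z :: real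
  assumes "z > 0"
  shows "has_bochner_integral lborel (\<lambda>t. indicator {0<..} t *\<^sub>R (t powr (z - 1) * exp (- t))) (Gamma z)"
proof -
  have "has_bochner_integral lborel (\<lambda>t. indicator {0<..} t *\<^sub>R (complex_of_real t powr (of_real z - 1) * exp (- complex_of_real t))) (of_real (Gamma z))"
    using Gamma_has_bochner_integral[of "of_real z"] assms by (simp add: Gamma_complex_of_real)
  also have "(\<lambda>t. indicator {0<..} t *\<^sub>R (complex_of_real t powr (of_real z - 1) * exp (- complex_of_real t))) =
     (\<lambda>t. complex_of_real (indicator {0<..} t *\<^sub>R (t powr (z - 1) * exp (- t))))"
    by (auto simp: fun_eq_iff indicator_def exp_of_real powr_of_real[symmetric] exp_minus)
  finally show ?thesis
    using has_bochner_integral_bounded_linear[OF bounded_linear_Re] by fastforce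
qed

text \<open>The factor \<open>exp (t * (1 - w))\<close> is expanded into its power series; integrating termwise
  gives the binomial series of \<open>(1 - (1 - w)) powr (- z)\<close>.\<close>
lemma Gamma_integral_disc:
  fixes z w :: complex
  assumes z: "Re z > 0" and w: "cmod (1 - w) < 1"
  shows "has_bochner_integral lborel
    (\<lambda>t. indicator {0<..} t *\<^sub>R (complex_of_real t powr (z - 1) * exp (- (complex_of_real t * w))))
    (Gamma z * w powr (- z))"
proof -
  define r where "r = cmod (1 - w)"
  have r: "0 \<le> r" "r < 1" using w by (auto simp: r_def)
  define f where "f k t = ((1 - w) ^ k / fact k) *
     (indicator {0<..} t *\<^sub>R (complex_of_real t powr (z + of_nat k - 1) * exp (- complex_of_real t)))" for k t
  have hb: "has_bochner_integral lborel (f k) ((1 - w) ^ k / fact k * Gamma (z + of_nat k))" for k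
    unfolding f_def using z by (intro has_bochner_integral_mult_right Gamma_has_bochner_integral) auto
  have int: "integrable lborel (f k)" "integral\<^sup>L lborel (f k) = (1 - w) ^ k / fact k * Gamma (z + of_nat k)" for k
    using hb[of k] by (auto simp: has_bochner_integral_iff)
  have fe: "f k t = indicator {0<..} t *\<^sub>R (complex_of_real t powr (z - 1) * exp (- complex_of_real t)) *
      ((of_real t * (1 - w)) ^ k /\<^sub>R fact k)" for k t
  proof (cases "t > 0")
    case True
    have "complex_of_real t powr (z + of_nat k - 1) = complex_of_real t powr (z - 1) * of_real t ^ k"
    proof -
      have "complex_of_real t powr (z + of_nat k - 1) = complex_of_real t powr ((z - 1) + of_nat k)"
        by (simp add: algebra_simps)
      also have "\<dots> = complex_of_real t powr (z - 1) * of_real t powr (of_nat k)"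
        by (rule powr_add)
      also have "of_real t powr (of_nat k) = complex_of_real t ^ k"
        using True by (simp add: powr_nat')
      finally show ?thesis .
    qed
    then show ?thesis using True by (simp add: f_def scaleR_conv_of_real divide_inverse power_mult_distrib mult_ac)
  qed (auto simp: f_def)
  have sums: "(\<lambda>k. f k t) sums (indicator {0<..} t *\<^sub>R (complex_of_real t powr (z - 1) * exp (- complex_of_real t)) * exp (of_real t * (1 - w)))" for t
    unfolding fe by (intro sums_mult exp_converges)
  have nf: "norm (f k t) = (r ^ k / fact k) * (indicator {0<..} t *\<^sub>R (t powr (Re z + k - 1) * exp (- t)))" for k t
    by (auto simp: f_def norm_mult norm_divide norm_power r_def indicator_def norm_powr_real_powr)
  have "summable (\<lambda>k. norm (f k t))" for t
    unfolding fe norm_mult by (intro summable_mult summable_norm_exp)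
  \<comment> \<open>The L^1 norms add up to \<open>Gamma (Re z)\<close> times the binomial series of
    \<open>(1 - r) powr (- Re z)\<close>, which converges because r < 1.\<close>
  moreover have "summable (\<lambda>k. \<integral>t. norm (f k t) \<partial>lborel)"
  proof -
    have "(\<integral>t. norm (f k t) \<partial>lborel) = r ^ k / fact k * Gamma (Re z + k)" for k
      unfolding nf using has_bochner_integral_mult_right[OF Gamma_has_bochner_integral_real[of "Re z + k"], of "r^k / fact k"] z
      by (simp add: has_bochner_integral_iff)
    also have "\<dots> k = Gamma (Re z) * (((- Re z) gchoose k) * (- r) ^ k)" for k
    proof -
      have nz: "Re z \<notin> \<int>\<^sub>\<le>\<^sub>0" using z by (auto elim!: nonpos_Ints_cases)
      then have g: "Gamma (Re z + k) = Gamma (Re z) * pochhammer (Re z) k"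
        by (simp add: pochhammer_Gamma Gamma_eq_zero_iff)
      have "(- r) ^ k = (-1) ^ k * r ^ k"
        by (rule power_minus)
      moreover have "(- 1) ^ k * (- 1) ^ k = (1 :: real)"
        by (simp flip: power_mult_distrib)
      ultimately show ?thesis
        unfolding g gbinomial_pochhammer by simp
    qed
    finally have "(\<lambda>k. \<integral>t. norm (f k t) \<partial>lborel) = (\<lambda>k. Gamma (Re z) * (((- Re z) gchoose k) * (- r) ^ k))"
      by auto
    then show ?thesis
      using gen_binomial_real[of "-r" "- Re z"] r by (auto intro!: summable_mult dest: sums_summable)
  qed
  ultimately have i1: "integrable lborel (\<lambda>t. \<Sum>k. f k t)" and
      i2: "(\<lambda>k. integral\<^sup>L lborel (f k)) sums (\<integral>t. (\<Sum>k. f k t) \<partial>lborel)"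
    by (intro integrable_suminf sums_integral int; simp)+
  have "(\<lambda>k. integral\<^sup>L lborel (f k)) sums (Gamma z * w powr (- z))"
  proof -
    have nz: "z \<notin> \<int>\<^sub>\<le>\<^sub>0" using z by (auto elim!: nonpos_Ints_cases)
    have "integral\<^sup>L lborel (f k) = Gamma z * (((- z) gchoose k) * (w - 1) ^ k)" for k
    proof -
      have g: "Gamma (z + k) = Gamma z * pochhammer z k"
        using nz by (simp add: pochhammer_Gamma Gamma_eq_zero_iff)
      have "(w - 1) ^ k = (-1) ^ k * (1 - w) ^ k"
        by (simp flip: power_mult_distrib)
      moreover have "(- 1) ^ k * (- 1) ^ k = (1 :: complex)"
        by (simp flip: power_mult_distrib)
      ultimately show ?thesis
        unfolding int g gbinomial_pochhammer by simp
    qed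
    moreover have "(\<lambda>k. Gamma z * (((- z) gchoose k) * (w - 1) ^ k)) sums (Gamma z * (1 + (w - 1)) powr (- z))"
      using w by (intro sums_mult gen_binomial_complex) (simp add: norm_minus_commute)
    ultimately show ?thesis by simp
  qed
  with i2 have v: "(\<integral>t. (\<Sum>k. f k t) \<partial>lborel) = Gamma z * w powr (- z)"
    using sums_unique2 by blast
  have "(\<Sum>k. f k t) = indicator {0<..} t *\<^sub>R (complex_of_real t powr (z - 1) * exp (- (complex_of_real t * w)))" for t
    using sums_unique[OF sums[of t], symmetric]
    by (simp add: exp_add[symmetric] algebra_simps scaleR_conv_of_real)
  with i1 v show ?thesis by (simp add: has_bochner_integral_iff)
qed

text \<open>The disc around 1 handled by \<open>Gamma_integral_disc\<close>, dilated by all X > 0,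
  covers the right half plane. For \<open>X = |w|^2 / Re w\<close> one has
  \<open>|X - w|^2 = X^2 - X * Re w < X^2\<close>, so \<open>w / X\<close> lies in that disc;
  rescaling t by X undoes the dilation.\<close>

lemma Gamma_powr_integral:
  fixes z w :: complex
  assumes z: "Re z > 0" and w: "Re w > 0"
  shows "has_bochner_integral lborel
    (\<lambda>t. indicator {0<..} t *\<^sub>R (complex_of_real t powr (z - 1) * exp (- (complex_of_real t * w))))
    (Gamma z * w powr (- z))"
proof -
  define X where "X = (cmod w)\<^sup>2 / Re w"
  have "w \<noteq> 0" using w by auto
  then have X: "X > 0" using w by (auto simp: X_def intro!: divide_pos_pos)
  define v where "v = w / of_real X"
  have wv: "w = of_real X * v" using X by (simp add: v_def)
  have Rv: "Re v > 0" using w X by (simp add: v_def)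
  have "cmod (1 - v) < 1"
  proof -
    have "(cmod (of_real X - w))\<^sup>2 = X\<^sup>2 - 2 * X * Re w + (cmod w)\<^sup>2"
      by (simp add: cmod_power2) (simp add: power2_eq_square algebra_simps)
    also have "\<dots> = X\<^sup>2 - X * Re w" using w by (simp add: X_def)
    also have "\<dots> < X\<^sup>2" using X w by simp
    finally have "cmod (of_real X - w) < X" using X power2_less_imp_less[of _ X] by fastforce
    moreover have "1 - v = (of_real X - w) / of_real X" using X by (simp add: v_def field_simps)
    ultimately show ?thesis using X by (simp add: norm_divide)
  qed
  from Gamma_integral_disc[OF z this]
  have *: "has_bochner_integral lborel
    (\<lambda>t. indicator {0<..} t *\<^sub>R (complex_of_real t powr (z - 1) * exp (- (complex_of_real t * v))))
    (Gamma z * v powr (- z))" .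
  let ?g = "\<lambda>t. indicator {0<..} t *\<^sub>R (complex_of_real t powr (z - 1) * exp (- (complex_of_real t * v)))"
  have "has_bochner_integral lborel (\<lambda>t. ?g (0 + X * t)) ((Gamma z * v powr (- z)) /\<^sub>R \<bar>X\<bar>)"
    using * X by (subst (asm) lborel_has_bochner_integral_real_affine_iff[where c=X and t=0]) auto
  then have "has_bochner_integral lborel (\<lambda>t. of_real X powr (1 - z) * ?g (0 + X * t))
      (of_real X powr (1 - z) * ((Gamma z * v powr (- z)) /\<^sub>R \<bar>X\<bar>))"
    by (rule has_bochner_integral_mult_right)
  also have "(\<lambda>t. of_real X powr (1 - z) * ?g (0 + X * t)) =
     (\<lambda>t. indicator {0<..} t *\<^sub>R (complex_of_real t powr (z - 1) * exp (- (complex_of_real t * w))))"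
  proof
    fix t
    show "of_real X powr (1 - z) * ?g (0 + X * t) = indicator {0<..} t *\<^sub>R (complex_of_real t powr (z - 1) * exp (- (complex_of_real t * w)))"
    proof (cases "t > 0")
      case True
      have "of_real X powr (1 - z) * complex_of_real (X * t) powr (z - 1) = complex_of_real t powr (z - 1)"
        using True X by (simp add: powr_def Ln_of_real ln_mult flip: exp_add of_real_mult) (simp add: algebra_simps)
      moreover have "complex_of_real (X * t) * v = of_real t * w" by (simp add: wv)
      moreover have "X * t > 0" using True X by simp
      ultimately show ?thesis using True by (simp only: indicator_simps greaterThan_iff add_0 scaleR_one mult.assoc[symmetric])
    qed (use X in \<open>auto simp: zero_less_mult_iff\<close>)
  qed
  also have "of_real X powr (1 - z) * ((Gamma z * v powr (- z)) /\<^sub>R \<bar>X\<bar>) = Gamma z * w powr (- z)"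
  proof -
    have "v \<noteq> 0" using Rv by auto
    \<comment> \<open>A positive factor does not change the argument, so the principal branch is
      respected.\<close>
    have "Ln w = of_real (ln X) + Ln v"
      unfolding wv using X \<open>v \<noteq> 0\<close> by (simp add: Ln_times_of_real Ln_of_real)
    then have "w powr (- z) = of_real X powr (- z) * v powr (- z)"
      using X \<open>v \<noteq> 0\<close> wv by (simp add: powr_def Ln_of_real flip: exp_add)
        (rule arg_cong[where f=exp], simp add: algebra_simps)
    moreover have "of_real X powr (1 - z) = of_real X * complex_of_real X powr (- z)"
      using X by (simp add: powr_diff powr_minus divide_inverse)
    ultimately show ?thesis using X by (simp add: scaleR_conv_of_real)
  qed
  finally show ?thesis .
qed

section \<open>Subordination\<close>

lemma Gamma_powr_integral_real:
  fixes z w :: real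
  assumes z: "z > 0" and w: "w > 0"
  shows "has_bochner_integral lborel (\<lambda>t. indicator {0<..} t *\<^sub>R (t powr (z - 1) * exp (- (t * w))))
     (Gamma z * w powr (- z))"
proof -
  have "has_bochner_integral lborel
    (\<lambda>t. indicator {0<..} t *\<^sub>R (complex_of_real t powr (of_real z - 1) * exp (- (complex_of_real t * of_real w))))
    (Gamma (of_real z) * of_real w powr (- of_real z))"
    by (rule Gamma_powr_integral) (use assms in auto)
  also have "(\<lambda>t. indicator {0<..} t *\<^sub>R (complex_of_real t powr (of_real z - 1) * exp (- (complex_of_real t * of_real w)))) =
     (\<lambda>t. complex_of_real (indicator {0<..} t *\<^sub>R (t powr (z - 1) * exp (- (t * w)))))"
    by (auto simp: fun_eq_iff indicator_def powr_of_real[symmetric] exp_of_real[symmetric])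
  also have "Gamma (of_real z) * complex_of_real w powr (- of_real z) = of_real (Gamma z * w powr (- z))"
    using w by (simp add: Gamma_complex_of_real powr_of_real flip: of_real_minus)
  finally show ?thesis
    using has_bochner_integral_bounded_linear[OF bounded_linear_Re] by fastforce
qed

text \<open>\<open>subord\<close> is \<open>2 (r / (2a))\<^sup>\<lambda> K\<^sub>\<lambda>(a r)\<close> for \<open>r > 0\<close>; the integral form stays continuous at \<open>r = 0\<close>.\<close>
definition subord_integrand :: "complex \<Rightarrow> real \<Rightarrow> real \<Rightarrow> real \<Rightarrow> complex" where
  "subord_integrand lam a r t =
     indicator {0<..} t *\<^sub>R (of_real t powr (lam - 1) * of_real (exp (- (t * a\<^sup>2) - r\<^sup>2 / (4 * t))))"

definition subord :: "complex \<Rightarrow> real \<Rightarrow> real \<Rightarrow> complex" where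
  "subord lam a r = (\<integral>t. subord_integrand lam a r t \<partial>lborel)"

lemma subord_integrand_eq:
  "subord_integrand lam a r t =
     indicator {0<..} t *\<^sub>R (exp ((lam - 1) * of_real (ln t)) * of_real (exp (- (t * a\<^sup>2) - r\<^sup>2 / (4 * t))))"
  by (auto simp: subord_integrand_def indicator_def powr_def Ln_of_real)

lemma subord_integrand_measurable [measurable (raw)]:
  assumes [measurable]: "f \<in> borel_measurable M" "g \<in> borel_measurable M"
  shows "(\<lambda>x. subord_integrand lam a (f x) (g x)) \<in> borel_measurable M"
  unfolding subord_integrand_eq by measurable

lemma norm_subord_integrand:
  "norm (subord_integrand lam a r t) =
     indicator {0<..} t *\<^sub>R (t powr (Re lam - 1) * exp (- (t * a\<^sup>2) - r\<^sup>2 / (4 * t)))"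
  by (auto simp: subord_integrand_def norm_mult norm_powr_real_powr indicator_def)

text \<open>The inequality behind this is \<open>b * r \<le> b^2 * t + r^2 / (4 * t)\<close>, read
  off from the square \<open>(b * t - r / 2)^2 / t\<close>. The growth \<open>exp (b * r)\<close>
  thus costs only the replacement of \<open>a^2\<close> by \<open>a^2 - b^2\<close>, which stays
  positive for b < a.\<close>

lemma norm_subord_integrand_exp_le:
  assumes "0 \<le> b"
  shows "norm (subord_integrand lam a r t) * exp (b * r) \<le>
     indicator {0<..} t *\<^sub>R (t powr (Re lam - 1) * exp (- (t * (a\<^sup>2 - b\<^sup>2))))"
proof (cases "t > 0")
  case True
  have "0 \<le> (b * t - r / 2)\<^sup>2 / t" using True by simp
  also have "(b * t - r / 2)\<^sup>2 / t = b\<^sup>2 * t - b * r + r\<^sup>2 / (4 * t)"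
    using True by (simp add: field_simps power2_eq_square)
  finally have "- (t * a\<^sup>2) - r\<^sup>2 / (4 * t) + b * r \<le> - (t * (a\<^sup>2 - b\<^sup>2))"
    by (simp add: algebra_simps)
  then have "exp (- (t * a\<^sup>2) - r\<^sup>2 / (4 * t)) * exp (b * r) \<le> exp (- (t * (a\<^sup>2 - b\<^sup>2)))"
    unfolding exp_add[symmetric] by simp
  then show ?thesis using True
    by (simp add: norm_subord_integrand mult.assoc mult_left_mono)
qed (auto simp: norm_subord_integrand)

lemma norm_subord_integrand_le:
  "norm (subord_integrand lam a r t) \<le>
     indicator {0<..} t *\<^sub>R (t powr (Re lam - 1) * exp (- (t * a\<^sup>2)))"
  using norm_subord_integrand_exp_le[of 0 lam a r t] by simp

lemma integrable_subord_integrand: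
  assumes "Re lam > 0" "a > 0"
  shows "integrable lborel (subord_integrand lam a r)"
proof (rule Bochner_Integration.integrable_bound)
  show "integrable lborel (\<lambda>t. indicator {0<..} t *\<^sub>R (t powr (Re lam - 1) * exp (- (t * a\<^sup>2))))"
    using Gamma_powr_integral_real[of "Re lam" "a\<^sup>2"] assms by (auto simp: has_bochner_integral_iff)
  show "AE t in lborel. norm (subord_integrand lam a r t)
      \<le> norm (indicator {0<..} t *\<^sub>R (t powr (Re lam - 1) * exp (- (t * a\<^sup>2))))"
    using norm_subord_integrand_le[of lam a r] by (intro AE_I2 order_trans[OF norm_subord_integrand_le]) auto
qed simp

text \<open>With b = |y| this bounds the Fourier multiplier of a slice uniformly in the frequency.
  The bound blows up as b tends to a, which is why L^2 limits are taken slice by slice.\<close>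

lemma norm_subord_exp_le:
  assumes "Re lam > 0" "0 \<le> b" "b < a"
  shows "norm (subord lam a r) * exp (b * r) \<le> Gamma (Re lam) * (a\<^sup>2 - b\<^sup>2) powr (- Re lam)"
proof -
  have ab: "a\<^sup>2 - b\<^sup>2 > 0" using assms by (simp add: power_strict_mono)
  note G = Gamma_powr_integral_real[OF assms(1) ab]
  have "norm (subord lam a r) \<le> (\<integral>t. norm (subord_integrand lam a r t) \<partial>lborel)"
    unfolding subord_def by (rule integral_norm_bound)
  then have "norm (subord lam a r) * exp (b * r) \<le> (\<integral>t. norm (subord_integrand lam a r t) * exp (b * r) \<partial>lborel)"
    by (simp add: mult_right_mono)
  also have "\<dots> \<le> (\<integral>t. indicator {0<..} t *\<^sub>R (t powr (Re lam - 1) * exp (- (t * (a\<^sup>2 - b\<^sup>2)))) \<partial>lborel)"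
    using G integrable_subord_integrand[of lam a r] assms
    by (intro integral_mono norm_subord_integrand_exp_le) (auto simp: has_bochner_integral_iff)
  also have "\<dots> = Gamma (Re lam) * (a\<^sup>2 - b\<^sup>2) powr (- Re lam)"
    using G by (simp add: has_bochner_integral_iff)
  finally show ?thesis .
qed

lemma continuous_subord:
  assumes "Re lam > 0" "a > 0"
  shows "continuous_on UNIV (subord lam a)"
  unfolding continuous_on_sequentially o_def
proof safe
  fix x :: "nat \<Rightarrow> real" and l
  assume x: "x \<longlonglongrightarrow> l"
  show "(\<lambda>n. subord lam a (x n)) \<longlonglongrightarrow> subord lam a l"
    unfolding subord_def
  proof (rule integral_dominated_convergence)
    show "integrable lborel (\<lambda>t. indicator {0<..} t *\<^sub>R (t powr (Re lam - 1) * exp (- (t * a\<^sup>2))))"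
      using Gamma_powr_integral_real[of "Re lam" "a\<^sup>2"] assms by (auto simp: has_bochner_integral_iff)
    show "AE t in lborel. (\<lambda>n. subord_integrand lam a (x n) t) \<longlonglongrightarrow> subord_integrand lam a l t"
      unfolding subord_integrand_def divide_inverse by (intro AE_I2 tendsto_intros x)
    show "AE t in lborel. norm (subord_integrand lam a (x n) t) \<le> 
       indicator {0<..} t *\<^sub>R (t powr (Re lam - 1) * exp (- (t * a\<^sup>2)))" for n
      by (intro AE_I2 norm_subord_integrand_le)
  qed auto
qed

lemma subord_measurable [measurable (raw)]:
  assumes "Re lam > 0" "a > 0" and [measurable]: "f \<in> borel_measurable M"
  shows "(\<lambda>x. subord lam a (f x)) \<in> borel_measurable M"
  using borel_measurable_continuous_onI[OF continuous_subord[OF assms(1,2)]] by measurable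

text \<open>Subordination: a complex power is a superposition of Gaussians, whose Fourier
  transforms are known for complex arguments; integrate first in \<open>\<xi>\<close>, then in \<open>t\<close>.\<close>
lemma subord_fourier:
  fixes w :: "'n::finite \<Rightarrow> complex"
  assumes lam: "Re lam > 0" and a: "a > 0" and w: "(\<Sum>j\<in>UNIV. (Im (w j))\<^sup>2) < a\<^sup>2"
  shows "has_bochner_integral lborel
     (\<lambda>\<xi>::real^'n. exp (\<i> * (\<Sum>j\<in>UNIV. w j * of_real (\<xi>$j))) * subord lam a (norm \<xi>))
     (of_real ((4 * pi) powr (real CARD('n) / 2)) * Gamma (lam + of_real (real CARD('n) / 2)) *
       (of_real (a\<^sup>2) + (\<Sum>j\<in>UNIV. (w j)\<^sup>2)) powr (- (lam + of_real (real CARD('n) / 2))))"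
proof -
  define m where "m = real CARD('n) / 2"
  define S where "S = (\<Sum>j\<in>UNIV. (w j)\<^sup>2)"
  define V where "V = (\<Sum>j\<in>UNIV. (Im (w j))\<^sup>2)"
  define E where "E \<xi> = exp (\<i> * (\<Sum>j\<in>UNIV. w j * of_real (\<xi>$j)))" for \<xi> :: "real^'n"
  define F where "F t \<xi> = E \<xi> * subord_integrand lam a (norm \<xi>) t" for t and \<xi> :: "real^'n"
  have E_meas [measurable]: "E \<in> borel_measurable borel"
    unfolding E_def by (intro borel_measurable_continuous_onI continuous_intros)
  have F_meas [measurable]: "case_prod F \<in> borel_measurable (lborel \<Otimes>\<^sub>M lborel)"
    unfolding F_def by measurable
  have m: "m \<ge> 0" by (simp add: m_def)
  \<comment> \<open>Together with \<open>V < a^2\<close> this gives \<open>Re (a^2 + S) > 0\<close>,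
    the half plane on which \<open>Gamma_powr_integral\<close> holds.\<close>
  have VS: "Re S \<ge> - V"
    unfolding S_def V_def by (auto simp: sum_negf[symmetric] power2_eq_square intro!: sum_mono)
  have inner: "has_bochner_integral lborel (F t) (of_real ((4 * pi) powr m) *
      (indicator {0<..} t *\<^sub>R (of_real t powr (lam + of_real m - 1) * exp (- (of_real t * (of_real (a\<^sup>2) + S))))))" for t
  proof (cases "t > 0")
    case True
    \<comment> \<open>For fixed t the frequency enters through a Gaussian with
      \<open>c = 1 / (4 * t)\<close>. Its constant \<open>(4 * pi * t) powr m\<close> raises the
      exponent \<open>lam - 1\<close> to \<open>lam + m - 1\<close>.\<close>
    have "has_bochner_integral lborel (\<lambda>x::real^'n. exp ((\<Sum>i\<in>UNIV. (\<i> * w i) * of_real (x$i)) - of_real (1/(4*t) * (norm x)\<^sup>2)))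
     (of_real ((pi / (1/(4*t))) powr m) * exp ((\<Sum>i\<in>UNIV. (\<i> * w i)\<^sup>2) / of_real (4 * (1/(4*t)))))"
      unfolding m_def by (rule gaussian_integral) (use True in simp)
    then have "has_bochner_integral lborel (\<lambda>x::real^'n. of_real t powr (lam - 1) * of_real (exp (- (t * a\<^sup>2))) * exp ((\<Sum>i\<in>UNIV. (\<i> * w i) * of_real (x$i)) - of_real (1/(4*t) * (norm x)\<^sup>2)))
     (of_real t powr (lam - 1) * of_real (exp (- (t * a\<^sup>2))) * (of_real ((pi / (1/(4*t))) powr m) * exp ((\<Sum>i\<in>UNIV. (\<i> * w i)\<^sup>2) / of_real (4 * (1/(4*t))))))"
      by (rule has_bochner_integral_mult_right)
    also have "(\<lambda>x::real^'n. of_real t powr (lam - 1) * of_real (exp (- (t * a\<^sup>2))) * exp ((\<Sum>i\<in>UNIV. (\<i> * w i) * of_real (x$i)) - of_real (1/(4*t) * (norm x)\<^sup>2))) = F t"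
      using True by (simp add: fun_eq_iff F_def E_def subord_integrand_def exp_diff exp_of_real sum_distrib_left mult_ac)
        (simp add: exp_of_real[symmetric])
    also have "(of_real t powr (lam - 1) * of_real (exp (- (t * a\<^sup>2))) * (of_real ((pi / (1/(4*t))) powr m) * exp ((\<Sum>i\<in>UNIV. (\<i> * w i)\<^sup>2) / of_real (4 * (1/(4*t)))))) =
       of_real ((4 * pi) powr m) * (indicator {0<..} t *\<^sub>R (of_real t powr (lam + of_real m - 1) * exp (- (of_real t * (of_real (a\<^sup>2) + S)))))"
    proof -
      have 1: "complex_of_real ((pi / (1/(4*t))) powr m) = of_real ((4 * pi) powr m) * of_real t powr (of_real m)"
        using True by (simp add: powr_mult powr_of_real mult_ac)
      have 2: "complex_of_real t powr (lam + of_real m - 1) = of_real t powr (lam - 1) * of_real t powr (of_real m)"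
        by (simp add: powr_add[symmetric] algebra_simps)
      have 3: "complex_of_real (exp (- (t * a\<^sup>2))) * exp ((\<Sum>i\<in>UNIV. (\<i> * w i)\<^sup>2) / of_real (4 * (1/(4*t)))) =
         exp (- (of_real t * (of_real (a\<^sup>2) + S)))"
        unfolding exp_of_real[symmetric] exp_add[symmetric]
        by (rule arg_cong[where f=exp]) (use True in \<open>simp add: S_def power_mult_distrib sum_negf algebra_simps\<close>)
      show ?thesis unfolding 1 2 3[symmetric] using True by simp
    qed
    finally show ?thesis .
  next
    case False
    then have "F t = (\<lambda>_. 0)" by (auto simp: F_def subord_integrand_def)
    then show ?thesis using False by (simp add: has_bochner_integral_zero)
  qed
  have nE: "norm (E \<xi>) = exp (\<Sum>j\<in>UNIV. - Im (w j) * \<xi>$j)" for \<xi>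
    by (simp add: E_def norm_exp_eq_Re sum_negf)
  \<comment> \<open>The absolute value is again a Gaussian, now with the real linear coefficients
    \<open>- Im (w j)\<close>. Its integral is therefore explicit, and \<open>V < a^2\<close> makes
    the result integrable in t.\<close>
  have ninner: "has_bochner_integral lborel (\<lambda>\<xi>. norm (F t \<xi>)) ((4 * pi) powr m *
      (indicator {0<..} t *\<^sub>R (t powr (Re lam + m - 1) * exp (- (t * (a\<^sup>2 - V))))))" for t
  proof (cases "t > 0")
    case True
    have "has_bochner_integral lborel (\<lambda>x::real^'n. exp ((\<Sum>i\<in>UNIV. complex_of_real (- Im (w i)) * of_real (x$i)) - of_real (1/(4*t) * (norm x)\<^sup>2)))
     (of_real ((pi / (1/(4*t))) powr m) * exp ((\<Sum>i\<in>UNIV. (complex_of_real (- Im (w i)))\<^sup>2) / of_real (4 * (1/(4*t)))))"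
      unfolding m_def by (rule gaussian_integral) (use True in simp)
    also have "(\<lambda>x::real^'n. exp ((\<Sum>i\<in>UNIV. complex_of_real (- Im (w i)) * of_real (x$i)) - of_real (1/(4*t) * (norm x)\<^sup>2))) =
        (\<lambda>x. complex_of_real (exp ((\<Sum>i\<in>UNIV. - Im (w i) * x$i) - 1/(4*t) * (norm x)\<^sup>2)))"
      unfolding exp_of_real[symmetric] by simp
    also have "(of_real ((pi / (1/(4*t))) powr m) * exp ((\<Sum>i\<in>UNIV. (complex_of_real (- Im (w i)))\<^sup>2) / of_real (4 * (1/(4*t))))) =
       complex_of_real ((4 * pi) powr m * t powr m * exp (V * t))"
      using True by (simp add: V_def powr_mult mult_ac exp_of_real[symmetric])
    finally have *: "has_bochner_integral lborel (\<lambda>x::real^'n. exp ((\<Sum>i\<in>UNIV. - Im (w i) * x$i) - 1/(4*t) * (norm x)\<^sup>2))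
       ((4 * pi) powr m * t powr m * exp (V * t))"
      using has_bochner_integral_bounded_linear[OF bounded_linear_Re] by fastforce
    have "has_bochner_integral lborel (\<lambda>x::real^'n. t powr (Re lam - 1) * exp (- (t * a\<^sup>2)) * exp ((\<Sum>i\<in>UNIV. - Im (w i) * x$i) - 1/(4*t) * (norm x)\<^sup>2))
       (t powr (Re lam - 1) * exp (- (t * a\<^sup>2)) * ((4 * pi) powr m * t powr m * exp (V * t)))"
      by (intro has_bochner_integral_mult_right *)
    also have "(\<lambda>x::real^'n. t powr (Re lam - 1) * exp (- (t * a\<^sup>2)) * exp ((\<Sum>i\<in>UNIV. - Im (w i) * x$i) - 1/(4*t) * (norm x)\<^sup>2)) =
       (\<lambda>\<xi>. norm (F t \<xi>))"
    proof
      fix x :: "real^'n"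
      have 1: "exp ((\<Sum>i\<in>UNIV. - Im (w i) * x$i) - 1/(4*t) * (norm x)\<^sup>2) = norm (E x) * exp (- ((norm x)\<^sup>2 / (4 * t)))"
        unfolding nE exp_add[symmetric] by simp
      have 2: "exp (- (t * a\<^sup>2) - (norm x)\<^sup>2 / (4 * t)) = exp (- (t * a\<^sup>2)) * exp (- ((norm x)\<^sup>2 / (4 * t)))"
        unfolding exp_add[symmetric] by simp
      show "t powr (Re lam - 1) * exp (- (t * a\<^sup>2)) * exp ((\<Sum>i\<in>UNIV. - Im (w i) * x$i) - 1/(4*t) * (norm x)\<^sup>2) = norm (F t x)"
        unfolding 1 F_def norm_mult norm_subord_integrand 2 using True by simp
    qed
    also have "(t powr (Re lam - 1) * exp (- (t * a\<^sup>2)) * ((4 * pi) powr m * t powr m * exp (V * t))) =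
       (4 * pi) powr m * (indicator {0<..} t *\<^sub>R (t powr (Re lam + m - 1) * exp (- (t * (a\<^sup>2 - V)))))"
    proof -
      have 2: "t powr (Re lam + m - 1) = t powr (Re lam - 1) * t powr m"
        by (simp add: powr_add[symmetric] algebra_simps)
      have 3: "exp (- (t * (a\<^sup>2 - V))) = exp (- (t * a\<^sup>2)) * exp (V * t)"
        by (simp add: exp_add[symmetric] algebra_simps)
      show ?thesis unfolding 2 3 using True by simp
    qed
    finally show ?thesis .
  next
    case False
    then have "F t = (\<lambda>_. 0)" by (auto simp: F_def subord_integrand_def)
    then show ?thesis using False by (simp add: has_bochner_integral_zero)
  qed
  have V: "a\<^sup>2 - V > 0" using w by (simp add: V_def)
  have intF: "integrable (lborel \<Otimes>\<^sub>M lborel) (case_prod F)"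
  proof (rule lborel_pair.Fubini_integrable[OF F_meas])
    have "has_bochner_integral lborel (\<lambda>t. (4 * pi) powr m * (indicator {0<..} t *\<^sub>R (t powr (Re lam + m - 1) * exp (- (t * (a\<^sup>2 - V)))))) 
         ((4 * pi) powr m * (Gamma (Re lam + m) * (a\<^sup>2 - V) powr (- (Re lam + m))))"
      using lam m V by (intro has_bochner_integral_mult_right Gamma_powr_integral_real) auto
    moreover have "(\<integral>\<xi>. norm (F t \<xi>) \<partial>lborel) = (4 * pi) powr m * (indicator {0<..} t *\<^sub>R (t powr (Re lam + m - 1) * exp (- (t * (a\<^sup>2 - V)))))" for t
      using ninner[of t] by (simp only: has_bochner_integral_iff)
    ultimately show "integrable lborel (\<lambda>x. \<integral>y. norm (case (x, y) of (x, y) \<Rightarrow> F x y) \<partial>lborel)"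
      by (simp add: has_bochner_integral_iff)
    show "AE x in lborel. integrable lborel (\<lambda>y. case (x, y) of (x, y) \<Rightarrow> F x y)"
      using inner by (auto simp: has_bochner_integral_iff)
  qed
  have Ft: "(\<integral>t. F t \<xi> \<partial>lborel) = E \<xi> * subord lam a (norm \<xi>)" for \<xi>
    by (simp add: F_def subord_def)
  have i1: "integrable lborel (\<lambda>\<xi>. E \<xi> * subord lam a (norm \<xi>))"
    using lborel_pair.integrable_snd[OF intF] by (simp add: Ft)
  have "(\<integral>\<xi>. E \<xi> * subord lam a (norm \<xi>) \<partial>lborel) = (\<integral>t. (\<integral>\<xi>. F t \<xi> \<partial>lborel) \<partial>lborel)"
    using lborel_pair.Fubini_integral[OF intF] by (simp add: Ft)
  also have "\<dots> = (\<integral>t. of_real ((4 * pi) powr m) *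
      (indicator {0<..} t *\<^sub>R (of_real t powr (lam + of_real m - 1) * exp (- (of_real t * (of_real (a\<^sup>2) + S))))) \<partial>lborel)"
    using inner by (simp only: has_bochner_integral_iff)
  also have "\<dots> = of_real ((4 * pi) powr m) * (Gamma (lam + of_real m) * (of_real (a\<^sup>2) + S) powr (- (lam + of_real m)))"
    using has_bochner_integral_mult_right[OF Gamma_powr_integral[of "lam + of_real m" "of_real (a\<^sup>2) + S"], of "of_real ((4 * pi) powr m)"] lam m V VS
    by (simp add: has_bochner_integral_iff)
  finally show ?thesis
    using i1 unfolding E_def m_def S_def has_bochner_integral_iff by (simp add: mult.assoc)
qed

section \<open>Plancherel for bounded continuous integrable functions\<close>

lemma lborel_integrable_affine_iff:
  fixes f :: "'a::euclidean_space \<Rightarrow> 'b::{banach, second_countable_topology}"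
  assumes c: "c \<noteq> 0" and [measurable]: "f \<in> borel_measurable borel"
  shows "integrable lborel (\<lambda>x. f (t + c *\<^sub>R x)) \<longleftrightarrow> integrable lborel f"
proof -
  have "integrable lborel f \<longleftrightarrow> integrable (density (distr lborel borel (\<lambda>x. t + c *\<^sub>R x)) (\<lambda>_. \<bar>c\<bar> ^ DIM('a))) f"
    using lborel_affine[OF c, of t] by simp
  also have "\<dots> \<longleftrightarrow> integrable lborel (\<lambda>x. \<bar>c\<bar> ^ DIM('a) *\<^sub>R f (t + c *\<^sub>R x))"
    by (subst integrable_density) (auto simp: integrable_distr_eq)
  also have "\<dots> \<longleftrightarrow> integrable lborel (\<lambda>x. f (t + c *\<^sub>R x))"
  proof
    assume "integrable lborel (\<lambda>x. \<bar>c\<bar> ^ DIM('a) *\<^sub>R f (t + c *\<^sub>R x))"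
    from integrable_scaleR_right[OF this, of "inverse (\<bar>c\<bar> ^ DIM('a))"] c
    show "integrable lborel (\<lambda>x. f (t + c *\<^sub>R x))" by simp
  qed auto
  finally show ?thesis ..
qed

lemma lborel_integral_affine:
  fixes f :: "'a::euclidean_space \<Rightarrow> 'b::{banach, second_countable_topology}"
  assumes c: "c \<noteq> 0" and [measurable]: "f \<in> borel_measurable borel"
  shows "integral\<^sup>L lborel f = \<bar>c\<bar> ^ DIM('a) *\<^sub>R (\<integral>x. f (t + c *\<^sub>R x) \<partial>lborel)"
proof -
  have "integral\<^sup>L lborel f = integral\<^sup>L (density (distr lborel borel (\<lambda>x. t + c *\<^sub>R x)) (\<lambda>_. \<bar>c\<bar> ^ DIM('a))) f"
    using lborel_affine[OF c, of t] by simp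
  also have "\<dots> = (\<integral>x. \<bar>c\<bar> ^ DIM('a) *\<^sub>R f (t + c *\<^sub>R x) \<partial>lborel)"
    by (subst integral_density) (auto simp: integral_distr)
  finally show ?thesis by simp
qed

lemma gaussian_fourier:
  fixes z :: "real^'n::finite"
  assumes d: "d > 0"
  shows "has_bochner_integral lborel (\<lambda>x::real^'n. exp (\<i> * of_real (x \<bullet> z)) * of_real (exp (- d * (norm x)\<^sup>2)))
     (of_real ((pi / d) powr (real CARD('n) / 2) * exp (- (norm z)\<^sup>2 / (4 * d))))"
proof -
  have "(\<Sum>i\<in>UNIV. \<i> * of_real (z$i) * of_real (x$i)) = \<i> * complex_of_real (x \<bullet> z)" for x :: "real^'n"
    by (simp add: inner_vec_def sum_distrib_left mult_ac)
  moreover have "(\<Sum>i\<in>UNIV. (\<i> * complex_of_real (z$i))\<^sup>2) = - of_real ((norm z)\<^sup>2)"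
    by (simp add: power_mult_distrib sum_negf norm_vec_def L2_set_def sum_nonneg)
  ultimately show ?thesis
    using gaussian_integral[OF d, of "\<lambda>i. \<i> * of_real (z$i)"]
    by (simp add: exp_of_real[symmetric] exp_add[symmetric])
qed

lemma gaussian_integral_real:
  assumes d: "d > 0"
  shows "has_bochner_integral lborel (\<lambda>x::real^'n::finite. exp (- d * (norm x)\<^sup>2)) ((pi / d) powr (real CARD('n) / 2))"
  using has_bochner_integral_bounded_linear[OF bounded_linear_Re gaussian_fourier[OF d, of 0]] by simp

lemma integrable_pair_mult:
  fixes f :: "'a::euclidean_space \<Rightarrow> real" and g :: "'b::euclidean_space \<Rightarrow> real"
  assumes f: "integrable lborel f" and g: "integrable lborel g"
  shows "integrable (lborel \<Otimes>\<^sub>M lborel) (\<lambda>(x, y). f x * g y)"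
proof -
  have [measurable]: "f \<in> borel_measurable borel" "g \<in> borel_measurable borel"
    using borel_measurable_integrable[OF f] borel_measurable_integrable[OF g] by auto
  show ?thesis
    by (rule lborel_pair.Fubini_integrable) (use f g in \<open>auto simp: norm_mult abs_mult\<close>)
qed

text \<open>Weighted by \<open>e d\<close>, the square |H|^2 can be integrated by Fubini and yields
  the integral of \<open>h\<close> against \<open>A d\<close>, a Gaussian mean of
  \<open>cnj h\<close>. As d decreases to 0 the weights increase to 1, so the left side converges
  monotonically, whether or not the limit is finite. On the right \<open>A d\<close> tends to a
  multiple of \<open>cnj h\<close> by continuity, and boundedness of \<open>h\<close> supplies the
  dominating functions.\<close>

lemma fourier_plancherel:
  fixes h :: "real^'n::finite \<Rightarrow> complex"
  assumes int: "integrable lborel h" and cont: "continuous_on UNIV h" and bdd: "\<And>x. norm (h x) \<le> B"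
  shows "(\<integral>\<^sup>+x. ennreal ((cmod (\<integral>\<xi>. exp (\<i> * of_real (x \<bullet> \<xi>)) * h \<xi> \<partial>lborel))\<^sup>2) \<partial>lborel) =
    ennreal ((2 * pi) ^ CARD('n)) * (\<integral>\<^sup>+\<xi>. ennreal ((cmod (h \<xi>))\<^sup>2) \<partial>lborel)"
proof -
  have [measurable]: "cnj \<in> borel_measurable borel"
    by (intro borel_measurable_continuous_onI continuous_intros)
  define H where "H x = (\<integral>\<xi>. exp (\<i> * of_real (x \<bullet> \<xi>)) * h \<xi> \<partial>lborel)" for x :: "real^'n"
  define M where "M = (\<integral>\<xi>. norm (h \<xi>) \<partial>lborel)"
  define m where "m = real CARD('n) / 2"
  define e where "e d x = exp (- d\<^sup>2 * (norm x)\<^sup>2)" for d and x :: "real^'n"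
  have [measurable]: "h \<in> borel_measurable borel" using borel_measurable_integrable[OF int] by simp
  have e_meas [measurable]: "e d \<in> borel_measurable borel" for d unfolding e_def by measurable
  have B: "B \<ge> 0" using norm_ge_zero[of "h 0"] bdd[of 0] by linarith
  have H_meas [measurable]: "H \<in> borel_measurable borel"
    unfolding H_def by measurable
  have HM: "norm (H x) \<le> M" for x
    unfolding H_def M_def by (rule order_trans[OF integral_norm_bound]) (simp add: norm_mult)
  have e_int: "integrable lborel (e d)" if "d > 0" for d
    unfolding e_def using gaussian_integral_real[of "d\<^sup>2"] that by (auto simp: has_bochner_integral_iff)
  have ih2: "integrable lborel (\<lambda>\<xi>. (norm (h \<xi>))\<^sup>2)"
    by (rule Bochner_Integration.integrable_bound[OF integrable_mult_right[OF integrable_norm[OF int], of B]])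
      (auto simp: power2_eq_square mult_right_mono bdd B)
  \<comment> \<open>Written after the substitution \<eta> = \<xi> + 2 d v: the Gaussian is then the
    fixed \<open>e 1\<close>, d occurs only in the argument of \<open>h\<close>, and the Jacobian
    \<open>(2 * d) ^ n\<close> cancels the power of d in \<open>(pi / d^2) powr m\<close>.\<close>
  define A where "A d \<xi> = of_real (2 ^ CARD('n) * pi powr m) * (\<integral>v. cnj (h (\<xi> + (2 * d) *\<^sub>R v)) * of_real (e 1 v) \<partial>lborel)" for d \<xi>
  have A_meas [measurable]: "A d \<in> borel_measurable borel" for d
    unfolding A_def by measurable
  have inner: "(\<integral>x. exp (\<i> * of_real (x \<bullet> \<xi>)) * of_real (e d x) * cnj (H x) \<partial>lborel) = A d \<xi>" if d: "d > 0" for d \<xi>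
  proof -
    let ?F = "\<lambda>x \<eta>. exp (\<i> * of_real (x \<bullet> (\<xi> - \<eta>))) * of_real (e d x) * cnj (h \<eta>)"
    have F: "integrable (lborel \<Otimes>\<^sub>M lborel) (case_prod ?F)"
      by (rule Bochner_Integration.integrable_bound[OF integrable_pair_mult[OF e_int[OF d] integrable_norm[OF int]]])
        (auto simp: norm_mult e_def)
    have "cnj (H x) = (\<integral>\<eta>. exp (- \<i> * of_real (x \<bullet> \<eta>)) * cnj (h \<eta>) \<partial>lborel)" for x
      unfolding H_def by (subst Bochner_Integration.integral_cnj[symmetric]) (simp add: exp_cnj)
    moreover have "?F x \<eta> = (exp (\<i> * of_real (x \<bullet> \<xi>)) * of_real (e d x)) * (exp (- \<i> * of_real (x \<bullet> \<eta>)) * cnj (h \<eta>))" for x \<eta>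
    proof -
      have "exp (\<i> * of_real (x \<bullet> (\<xi> - \<eta>))) = exp (\<i> * of_real (x \<bullet> \<xi>)) * exp (- \<i> * of_real (x \<bullet> \<eta>))"
        unfolding exp_add[symmetric] by (simp add: inner_diff_right ring_distribs)
      then show ?thesis by (simp only: mult_ac)
    qed
    ultimately have "(\<integral>x. exp (\<i> * of_real (x \<bullet> \<xi>)) * of_real (e d x) * cnj (H x) \<partial>lborel) =
       (\<integral>x. (\<integral>\<eta>. ?F x \<eta> \<partial>lborel) \<partial>lborel)"
      by (simp only: Bochner_Integration.integral_mult_right_zero)
    also have "\<dots> = (\<integral>\<eta>. (\<integral>x. ?F x \<eta> \<partial>lborel) \<partial>lborel)"
      by (rule lborel_pair.Fubini_integral[OF F, symmetric])
    also have "\<dots> = (\<integral>\<eta>. of_real ((pi / d\<^sup>2) powr m * exp (- (norm (\<xi> - \<eta>))\<^sup>2 / (4 * d\<^sup>2))) * cnj (h \<eta>) \<partial>lborel)"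
      using gaussian_fourier[of "d\<^sup>2", where 'n='n] d unfolding e_def m_def by (simp add: has_bochner_integral_iff)
    also have "\<dots> = \<bar>2 * d\<bar> ^ DIM(real^'n) *\<^sub>R (\<integral>v. of_real ((pi / d\<^sup>2) powr m * exp (- (norm (\<xi> - (\<xi> + (2 * d) *\<^sub>R v)))\<^sup>2 / (4 * d\<^sup>2))) * cnj (h (\<xi> + (2 * d) *\<^sub>R v)) \<partial>lborel)"
      using d by (intro lborel_integral_affine) auto
    also have "(\<integral>v. of_real ((pi / d\<^sup>2) powr m * exp (- (norm (\<xi> - (\<xi> + (2 * d) *\<^sub>R v)))\<^sup>2 / (4 * d\<^sup>2))) * cnj (h (\<xi> + (2 * d) *\<^sub>R v)) \<partial>lborel) =
       of_real ((pi / d\<^sup>2) powr m) * (\<integral>v. cnj (h (\<xi> + (2 * d) *\<^sub>R v)) * of_real (e 1 v) \<partial>lborel)"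
    proof -
      have "of_real ((pi / d\<^sup>2) powr m * exp (- (norm (\<xi> - (\<xi> + (2 * d) *\<^sub>R v)))\<^sup>2 / (4 * d\<^sup>2))) * cnj (h (\<xi> + (2 * d) *\<^sub>R v)) =
         of_real ((pi / d\<^sup>2) powr m) * (cnj (h (\<xi> + (2 * d) *\<^sub>R v)) * of_real (e 1 v))" for v
        using d by (simp add: e_def power_mult_distrib)
      then show ?thesis by (simp only: Bochner_Integration.integral_mult_right_zero)
    qed
    also have "\<bar>2 * d\<bar> ^ DIM(real^'n) *\<^sub>R (of_real ((pi / d\<^sup>2) powr m) * (\<integral>v. cnj (h (\<xi> + (2 * d) *\<^sub>R v)) * of_real (e 1 v) \<partial>lborel)) = A d \<xi>"
    proof -
      have "(d\<^sup>2) powr m = d ^ CARD('n)"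
      proof -
        have "(d\<^sup>2) powr m = (d powr 2) powr m" using d by simp
        also have "\<dots> = d powr (real CARD('n))" by (simp only: powr_powr m_def) simp
        finally show ?thesis using d by (simp add: powr_realpow)
      qed
      then have "(pi / d\<^sup>2) powr m = pi powr m / d ^ CARD('n)"
        by (simp add: powr_divide)
      then have "\<bar>2 * d\<bar> ^ CARD('n) * (pi / d\<^sup>2) powr m = 2 ^ CARD('n) * pi powr m"
        using d by (simp add: power_mult_distrib)
      moreover have "x *\<^sub>R (of_real y * z) = of_real (x * y) * z" for x y :: real and z :: complex
        by (simp add: scaleR_conv_of_real)
      moreover have "DIM(real^'n) = CARD('n)" by simp
      ultimately show ?thesis
        by (simp only: A_def)
    qed
    finally show ?thesis .
  qed
  have reg: "has_bochner_integral lborel (\<lambda>x. e d x * (cmod (H x))\<^sup>2) (Re (\<integral>\<xi>. h \<xi> * A d \<xi> \<partial>lborel))" if d: "d > 0" for d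
  proof -
    let ?F = "\<lambda>x \<xi>. exp (\<i> * of_real (x \<bullet> \<xi>)) * of_real (e d x) * cnj (H x) * h \<xi>"
    have F: "integrable (lborel \<Otimes>\<^sub>M lborel) (case_prod ?F)"
      by (rule Bochner_Integration.integrable_bound[OF integrable_pair_mult[OF integrable_mult_left[OF e_int[OF d], of M] integrable_norm[OF int]]])
        (auto simp: norm_mult e_def abs_mult intro!: AE_I2 mult_right_mono mult_left_mono order_trans[OF HM])
    have "integrable lborel (\<lambda>x. e d x * (cmod (H x))\<^sup>2)"
    proof (rule Bochner_Integration.integrable_bound[OF integrable_mult_left[OF e_int[OF d], of "M\<^sup>2"]])
      show "AE x in lborel. norm (e d x * (cmod (H x))\<^sup>2) \<le> norm (e d x * M\<^sup>2)"
        by (intro AE_I2) (auto simp: e_def abs_mult intro!: mult_left_mono power_mono HM)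
    qed measurable
    moreover have "complex_of_real (\<integral>x. e d x * (cmod (H x))\<^sup>2 \<partial>lborel) = (\<integral>\<xi>. h \<xi> * A d \<xi> \<partial>lborel)"
    proof -
      have "complex_of_real (\<integral>x. e d x * (cmod (H x))\<^sup>2 \<partial>lborel) = (\<integral>x. (\<integral>\<xi>. ?F x \<xi> \<partial>lborel) \<partial>lborel)"
      proof -
        have "(\<integral>\<xi>. ?F x \<xi> \<partial>lborel) = of_real (e d x * (cmod (H x))\<^sup>2)" for x
        proof -
          have "(\<integral>\<xi>. ?F x \<xi> \<partial>lborel) = of_real (e d x) * cnj (H x) * H x"
          proof -
            have "?F x \<xi> = (of_real (e d x) * cnj (H x)) * (exp (\<i> * of_real (x \<bullet> \<xi>)) * h \<xi>)" for \<xi>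
              by (simp only: mult_ac)
            then show ?thesis
              by (simp only: Bochner_Integration.integral_mult_right_zero H_def[symmetric])
          qed
          then show ?thesis using complex_norm_square[of "H x"] by (simp add: mult_ac)
        qed
        then show ?thesis by (simp only: integral_complex_of_real)
      qed
      also have "\<dots> = (\<integral>\<xi>. (\<integral>x. ?F x \<xi> \<partial>lborel) \<partial>lborel)"
        by (rule lborel_pair.Fubini_integral[OF F, symmetric])
      also have "\<dots> = (\<integral>\<xi>. A d \<xi> * h \<xi> \<partial>lborel)"
        by (simp only: Bochner_Integration.integral_mult_left_zero inner[OF d])
      also have "\<dots> = (\<integral>\<xi>. h \<xi> * A d \<xi> \<partial>lborel)"
        by (simp only: mult.commute)
      finally show ?thesis .
    qed
    ultimately show ?thesis unfolding has_bochner_integral_iff by (metis Re_complex_of_real)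
  qed
  define D where "D k = 1 / real (Suc k)" for k
  have D: "D k > 0" for k by (simp add: D_def)
  have D0: "D \<longlonglongrightarrow> 0" unfolding D_def by (rule LIMSEQ_Suc[OF lim_1_over_n])
  have e1: "(\<integral>v. e 1 v \<partial>lborel) = pi powr m" "integrable lborel (e 1)"
    unfolding e_def m_def using gaussian_integral_real[of 1, where 'n='n] by (auto simp: has_bochner_integral_iff)
  \<comment> \<open>One factor \<open>pi powr m\<close> comes from the Gaussian transform, the other
    from the total mass of \<open>e 1\<close>.\<close>
  have pm: "2 ^ CARD('n) * pi powr m * pi powr m = (2 * pi) ^ CARD('n)"
    by (simp add: m_def powr_add[symmetric] powr_realpow power_mult_distrib mult.assoc)
  have A_lim: "(\<lambda>k. A (D k) \<xi>) \<longlonglongrightarrow> of_real ((2 * pi) ^ CARD('n)) * cnj (h \<xi>)" for \<xi>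
  proof -
    have "(\<lambda>k. \<integral>v. cnj (h (\<xi> + (2 * D k) *\<^sub>R v)) * of_real (e 1 v) \<partial>lborel) \<longlonglongrightarrow> (\<integral>v. cnj (h \<xi>) * of_real (e 1 v) \<partial>lborel)"
    proof (rule integral_dominated_convergence)
      show "integrable lborel (\<lambda>v. B * e 1 v)" using e1 by simp
      show "AE v in lborel. (\<lambda>k. cnj (h (\<xi> + (2 * D k) *\<^sub>R v)) * of_real (e 1 v)) \<longlonglongrightarrow> cnj (h \<xi>) * of_real (e 1 v)"
      proof (intro AE_I2 tendsto_intros)
        fix v
        have "(\<lambda>k. \<xi> + (2 * D k) *\<^sub>R v) \<longlonglongrightarrow> \<xi> + (2 * 0) *\<^sub>R v"
          by (intro tendsto_intros D0)
        then show "(\<lambda>k. h (\<xi> + (2 * D k) *\<^sub>R v)) \<longlonglongrightarrow> h \<xi>"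
          using cont by (auto simp: continuous_on_eq_continuous_at intro: isCont_tendsto_compose)
      qed
      show "AE v in lborel. norm (cnj (h (\<xi> + (2 * D k) *\<^sub>R v)) * of_real (e 1 v)) \<le> B * e 1 v" for k
        by (intro AE_I2) (auto simp: norm_mult e_def intro!: mult_right_mono bdd)
    qed auto
    also have "(\<integral>v. cnj (h \<xi>) * of_real (e 1 v) \<partial>lborel) = cnj (h \<xi>) * of_real (pi powr m)"
      using e1 by simp
    finally have "(\<lambda>k. A (D k) \<xi>) \<longlonglongrightarrow> of_real (2 ^ CARD('n) * pi powr m) * (cnj (h \<xi>) * of_real (pi powr m))"
      unfolding A_def by (intro tendsto_intros)
    also have "of_real (2 ^ CARD('n) * pi powr m) * (cnj (h \<xi>) * of_real (pi powr m)) = of_real ((2 * pi) ^ CARD('n)) * cnj (h \<xi>)"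
      unfolding pm[symmetric] by (simp add: mult_ac)
    finally show ?thesis .
  qed
  have A_bound: "norm (A d \<xi>) \<le> 2 ^ CARD('n) * pi powr m * (B * pi powr m)" for d \<xi>
  proof -
    have "norm (\<integral>v. cnj (h (\<xi> + (2 * d) *\<^sub>R v)) * of_real (e 1 v) \<partial>lborel) \<le> (\<integral>v. norm (cnj (h (\<xi> + (2 * d) *\<^sub>R v)) * of_real (e 1 v)) \<partial>lborel)"
      by (rule integral_norm_bound)
    also have "\<dots> \<le> (\<integral>v. B * e 1 v \<partial>lborel)"
    proof (rule integral_mono')
      show "integrable lborel (\<lambda>v. B * e 1 v)" using e1 by simp
    qed (auto simp: norm_mult e_def B intro!: mult_right_mono bdd)
    also have "\<dots> = B * pi powr m" using e1 by simp
    finally show ?thesis unfolding A_def norm_mult by (intro mult_mono) (auto simp: norm_mult norm_power)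
  qed
  have "(\<lambda>k. \<integral>\<xi>. h \<xi> * A (D k) \<xi> \<partial>lborel) \<longlonglongrightarrow> (\<integral>\<xi>. h \<xi> * (of_real ((2 * pi) ^ CARD('n)) * cnj (h \<xi>)) \<partial>lborel)"
  proof (rule integral_dominated_convergence)
    show "integrable lborel (\<lambda>\<xi>. norm (h \<xi>) * (2 ^ CARD('n) * pi powr m * (B * pi powr m)))"
      using int by simp
    show "AE \<xi> in lborel. (\<lambda>k. h \<xi> * A (D k) \<xi>) \<longlonglongrightarrow> h \<xi> * (of_real ((2 * pi) ^ CARD('n)) * cnj (h \<xi>))"
      by (intro AE_I2 tendsto_mult tendsto_const A_lim)
    show "AE \<xi> in lborel. norm (h \<xi> * A (D k) \<xi>) \<le> norm (h \<xi>) * (2 ^ CARD('n) * pi powr m * (B * pi powr m))" for k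
      unfolding norm_mult by (intro AE_I2 mult_left_mono A_bound) auto
  qed auto
  also have "(\<integral>\<xi>. h \<xi> * (of_real ((2 * pi) ^ CARD('n)) * cnj (h \<xi>)) \<partial>lborel) =
      of_real ((2 * pi) ^ CARD('n) * (\<integral>\<xi>. (norm (h \<xi>))\<^sup>2 \<partial>lborel))"
  proof -
    have "h \<xi> * (of_real ((2 * pi) ^ CARD('n)) * cnj (h \<xi>)) = of_real ((2 * pi) ^ CARD('n) * (norm (h \<xi>))\<^sup>2)" for \<xi>
      using complex_norm_square[of "h \<xi>"] by (simp add: mult_ac)
    then show ?thesis by (simp only: integral_complex_of_real Bochner_Integration.integral_mult_right_zero)
  qed
  finally have "(\<lambda>k. \<integral>\<xi>. h \<xi> * A (D k) \<xi> \<partial>lborel) \<longlonglongrightarrow> of_real ((2 * pi) ^ CARD('n) * (\<integral>\<xi>. (norm (h \<xi>))\<^sup>2 \<partial>lborel))" .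
  from tendsto_ennrealI[OF tendsto_Re[OF this], unfolded Re_complex_of_real]
  have lim1: "(\<lambda>k. ennreal (Re (\<integral>\<xi>. h \<xi> * A (D k) \<xi> \<partial>lborel))) \<longlonglongrightarrow> ennreal ((2 * pi) ^ CARD('n) * (\<integral>\<xi>. (norm (h \<xi>))\<^sup>2 \<partial>lborel))"
    .
  \<comment> \<open>Monotone convergence, since \<open>D k\<close> decreases and the weights
    therefore increase.\<close>
  have "(\<lambda>k. \<integral>\<^sup>+x. ennreal (e (D k) x * (cmod (H x))\<^sup>2) \<partial>lborel) \<longlonglongrightarrow> (\<integral>\<^sup>+x. ennreal ((cmod (H x))\<^sup>2) \<partial>lborel)"
  proof (rule nn_integral_LIMSEQ)
    show "incseq (\<lambda>k x. ennreal (e (D k) x * (cmod (H x))\<^sup>2))"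
    proof (intro incseq_SucI le_funI ennreal_leI mult_right_mono)
      fix k x
      have "(D (Suc k))\<^sup>2 \<le> (D k)\<^sup>2"
        by (intro power_mono) (auto simp: D_def field_simps)
      then show "e (D k) x \<le> e (D (Suc k)) x"
        by (simp add: e_def mult_right_mono)
    qed auto
    show "(\<lambda>k. ennreal (e (D k) x * (cmod (H x))\<^sup>2)) \<longlonglongrightarrow> ennreal ((cmod (H x))\<^sup>2)" for x
    proof (rule tendsto_ennrealI)
      have "(\<lambda>k. e (D k) x * (cmod (H x))\<^sup>2) \<longlonglongrightarrow> exp (- 0\<^sup>2 * (norm x)\<^sup>2) * (cmod (H x))\<^sup>2"
        unfolding e_def by (intro tendsto_intros D0)
      then show "(\<lambda>k. e (D k) x * (cmod (H x))\<^sup>2) \<longlonglongrightarrow> (cmod (H x))\<^sup>2" by simp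
    qed
  qed measurable
  moreover have "(\<integral>\<^sup>+x. ennreal (e (D k) x * (cmod (H x))\<^sup>2) \<partial>lborel) = ennreal (Re (\<integral>\<xi>. h \<xi> * A (D k) \<xi> \<partial>lborel))" for k
    using reg[OF D[of k]] by (subst nn_integral_eq_integral) (auto simp: has_bochner_integral_iff e_def)
  ultimately have "(\<integral>\<^sup>+x. ennreal ((cmod (H x))\<^sup>2) \<partial>lborel) = ennreal ((2 * pi) ^ CARD('n) * (\<integral>\<xi>. (norm (h \<xi>))\<^sup>2 \<partial>lborel))"
    using lim1 LIMSEQ_unique by simp
  also have "\<dots> = ennreal ((2 * pi) ^ CARD('n)) * (\<integral>\<^sup>+\<xi>. ennreal ((cmod (h \<xi>))\<^sup>2) \<partial>lborel)"
    using ih2 by (simp add: nn_integral_eq_integral ennreal_mult')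
  finally show ?thesis unfolding H_def .
qed

section \<open>Slices of the Poisson transform\<close>

definition cvec :: "real^'n::finite \<Rightarrow> real^'n \<Rightarrow> complex^'n" where
  "cvec x y = (\<chi> j. Complex (x$j) (y$j))"

text \<open>Left without the factor \<open>(2 * pi) powr (- n / 2)\<close>, so that the Fubini
  exchanges carry no constants; the factor returns as \<open>r\<close> in
  \<open>poisson_slice_L2\<close>.\<close>

definition fourier_int :: "(real^'n::finite \<Rightarrow> complex) \<Rightarrow> real^'n \<Rightarrow> complex" where
  "fourier_int f \<xi> = (\<integral>u. f u * exp (- \<i> * of_real (u \<bullet> \<xi>)) \<partial>lborel)"

text \<open>The constant left between \<open>poisson_ext\<close> and the Fourier integral of
  \<open>subord\<close>: \<open>Gamma (lam + m)\<close> has cancelled, and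
  \<open>(4 * pi) powr m\<close> from \<open>subord_fourier\<close> has been divided out. Here m
  stands for n / 2.\<close>

definition poisson_const :: "complex \<Rightarrow> real \<Rightarrow> real \<Rightarrow> complex" where
  "poisson_const lam m a = of_real (pi powr (- m) * (4 * pi) powr (- m)) * of_real a powr (lam + of_real m) / Gamma (2 * lam)"

text \<open>Up to \<open>poisson_const\<close> this is the Fourier multiplier of the slice at height
  y: moving x to x + \<i> y multiplies the character of frequency \<xi> by
  \<open>exp (- (y \<bullet> \<xi>))\<close>.\<close>

definition damped_subord :: "complex \<Rightarrow> real \<Rightarrow> real^'n::finite \<Rightarrow> real^'n \<Rightarrow> complex" where
  "damped_subord lam a y \<xi> = of_real (exp (- (y \<bullet> \<xi>))) * subord lam a (norm \<xi>)"

lemma im_part_cvec [simp]: "im_part (cvec x y) = y"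
  by (simp add: im_part_def cvec_def)

lemma exp_cvec:
  "exp (\<i> * (\<Sum>j\<in>UNIV. ((cvec x y)$j - of_real (u$j)) * of_real (\<xi>$j))) =
     exp (\<i> * of_real ((x - u) \<bullet> \<xi>)) * of_real (exp (- (y \<bullet> \<xi>)))"
proof -
  have "\<i> * (\<Sum>j\<in>UNIV. ((cvec x y)$j - of_real (u$j)) * of_real (\<xi>$j)) =
     \<i> * of_real ((x - u) \<bullet> \<xi>) + of_real (- (y \<bullet> \<xi>))"
    by (simp add: complex_eq_iff cvec_def inner_vec_def)
  then show ?thesis by (simp only: exp_add exp_of_real)
qed

text \<open>Only the integrability half of \<open>subord_fourier\<close> is wanted, at x = u = 0,
  where the exponential reduces to \<open>exp (- (y \<bullet> \<xi>))\<close>.\<close>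

lemma damped_subord_integrable:
  fixes y :: "real^'n::finite"
  assumes lam: "Re lam > 0" and y: "norm y < a"
  shows "integrable lborel (damped_subord lam a y)"
proof -
  have a: "a > 0" using y norm_ge_zero[of y] by linarith
  have "(norm y)\<^sup>2 < a\<^sup>2" using y by (intro power_strict_mono) auto
  then have "(\<Sum>j\<in>UNIV. (Im ((cvec 0 y)$j - of_real ((0::real^'n)$j)))\<^sup>2) < a\<^sup>2"
    by (simp add: cvec_def norm_vec_def L2_set_def sum_nonneg)
  from subord_fourier[OF lam a this]
  have "integrable lborel (\<lambda>\<xi>::real^'n. exp (\<i> * (\<Sum>j\<in>UNIV. ((cvec 0 y)$j - of_real ((0::real^'n)$j)) * of_real (\<xi>$j))) * subord lam a (norm \<xi>))"
    by (simp only: has_bochner_integral_iff)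
  then show ?thesis unfolding exp_cvec damped_subord_def[abs_def] by simp
qed

lemma damped_subord_continuous:
  assumes lam: "Re lam > 0" and a: "a > 0"
  shows "continuous_on UNIV (damped_subord lam a y)"
proof -
  have "continuous_on UNIV (\<lambda>\<xi>. subord lam a (norm \<xi>))"
    by (rule continuous_on_compose2[OF continuous_subord[OF lam a]]) (auto intro!: continuous_intros)
  then show ?thesis unfolding damped_subord_def[abs_def] by (intro continuous_intros)
qed

lemma damped_subord_bound:
  assumes lam: "Re lam > 0" and y: "norm y < a"
  shows "norm (damped_subord lam a y \<xi>) \<le> Gamma (Re lam) * (a\<^sup>2 - (norm y)\<^sup>2) powr (- Re lam)"
proof -
  have "- (y \<bullet> \<xi>) \<le> norm y * norm \<xi>" using Cauchy_Schwarz_ineq2[of y \<xi>] by linarith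
  then have "norm (subord lam a (norm \<xi>)) * exp (- (y \<bullet> \<xi>)) \<le> norm (subord lam a (norm \<xi>)) * exp (norm y * norm \<xi>)"
    by (intro mult_left_mono) auto
  then have "norm (damped_subord lam a y \<xi>) \<le> norm (subord lam a (norm \<xi>)) * exp (norm y * norm \<xi>)"
    by (simp add: damped_subord_def norm_mult mult.commute)
  also have "\<dots> \<le> Gamma (Re lam) * (a\<^sup>2 - (norm y)\<^sup>2) powr (- Re lam)"
    by (rule norm_subord_exp_le[OF lam _ y]) auto
  finally show ?thesis .
qed

lemma poisson_ext_fourier:
  fixes x y u :: "real^'n::finite"
  assumes lam: "Re lam > 0" and y: "norm y < a"
  shows "poisson_ext lam (cvec x y) u a =
     poisson_const lam (real CARD('n) / 2) a * (\<integral>\<xi>. exp (\<i> * of_real ((x - u) \<bullet> \<xi>)) * damped_subord lam a y \<xi> \<partial>lborel)"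
proof -
  define m where "m = real CARD('n) / 2"
  have a: "a > 0" using y norm_ge_zero[of y] by linarith
  have m: "m \<ge> 0" by (simp add: m_def)
  have "(norm y)\<^sup>2 < a\<^sup>2" using y by (intro power_strict_mono) auto
  then have "(\<Sum>j\<in>UNIV. (Im ((cvec x y)$j - of_real (u$j)))\<^sup>2) < a\<^sup>2"
    by (simp add: cvec_def norm_vec_def L2_set_def sum_nonneg)
  from subord_fourier[OF lam a this]
  have "(\<integral>\<xi>. exp (\<i> * (\<Sum>j\<in>UNIV. ((cvec x y)$j - of_real (u$j)) * of_real (\<xi>$j))) * subord lam a (norm \<xi>) \<partial>lborel) =
     of_real ((4 * pi) powr m) * Gamma (lam + of_real m) * (of_real (a\<^sup>2) + csq (cvec x y) u) powr (- (lam + of_real m))"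
    by (simp only: has_bochner_integral_iff m_def csq_def)
  then have I: "(\<integral>\<xi>. exp (\<i> * of_real ((x - u) \<bullet> \<xi>)) * damped_subord lam a y \<xi> \<partial>lborel) =
     of_real ((4 * pi) powr m) * Gamma (lam + of_real m) * (of_real (a\<^sup>2) + csq (cvec x y) u) powr (- (lam + of_real m))"
    unfolding exp_cvec damped_subord_def[abs_def] by (simp only: mult.assoc)
  have "complex_of_real ((4 * pi) powr (- m)) * of_real ((4 * pi) powr m) = 1"
    by (simp add: powr_minus flip: of_real_mult)
  then show ?thesis
    unfolding m_def[symmetric] I poisson_ext_def Let_def poisson_const_def
    by (simp add: m_def[symmetric]) 
qed

lemma fourier_int_bound:
  assumes "integrable lborel f"
  shows "norm (fourier_int f \<xi>) \<le> (\<integral>u. norm (f u) \<partial>lborel)"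
  unfolding fourier_int_def by (rule order_trans[OF integral_norm_bound]) (simp add: norm_mult norm_exp_eq_Re)

lemma fourier_int_continuous:
  fixes f :: "real^'n::finite \<Rightarrow> complex"
  assumes f: "integrable lborel f"
  shows "continuous_on UNIV (fourier_int f)"
  unfolding continuous_on_sequentially o_def
proof safe
  have [measurable]: "f \<in> borel_measurable borel" using borel_measurable_integrable[OF f] by simp
  fix x :: "nat \<Rightarrow> real^'n" and l
  assume x: "x \<longlonglongrightarrow> l"
  show "(\<lambda>k. fourier_int f (x k)) \<longlonglongrightarrow> fourier_int f l"
    unfolding fourier_int_def
  proof (rule integral_dominated_convergence)
    show "integrable lborel (\<lambda>u. norm (f u))" using f by simp
    show "AE u in lborel. (\<lambda>k. f u * exp (- \<i> * of_real (u \<bullet> x k))) \<longlonglongrightarrow> f u * exp (- \<i> * of_real (u \<bullet> l))"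
      by (intro AE_I2 tendsto_intros x)
  qed (auto simp: norm_mult norm_exp_eq_Re)
qed

lemma poisson_transform_fourier:
  fixes f :: "real^'n::finite \<Rightarrow> complex"
  assumes lam: "Re lam > 0" and y: "norm y < a" and f: "integrable lborel f"
  shows "poisson_transform lam f (cvec x y) a =
     poisson_const lam (real CARD('n) / 2) a * (\<integral>\<xi>. exp (\<i> * of_real (x \<bullet> \<xi>)) * (damped_subord lam a y \<xi> * fourier_int f \<xi>) \<partial>lborel)"
proof -
  let ?c = "poisson_const lam (real CARD('n) / 2) a"
  have [measurable]: "f \<in> borel_measurable borel" using borel_measurable_integrable[OF f] by simp
  have dint: "integrable lborel (damped_subord lam a y)" by (rule damped_subord_integrable[OF lam y])
  have [measurable]: "damped_subord lam a y \<in> borel_measurable borel"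
    using borel_measurable_integrable[OF dint] by simp
  let ?F = "\<lambda>u \<xi>. f u * (exp (\<i> * of_real ((x - u) \<bullet> \<xi>)) * damped_subord lam a y \<xi>)"
  have F: "integrable (lborel \<Otimes>\<^sub>M lborel) (case_prod ?F)"
    by (rule Bochner_Integration.integrable_bound[OF integrable_pair_mult[OF integrable_norm[OF f] integrable_norm[OF dint]]])
      (auto simp: norm_mult)
  have eq: "f u * poisson_ext lam (cvec x y) u a = ?c * (\<integral>\<xi>. ?F u \<xi> \<partial>lborel)" for u
    unfolding poisson_ext_fourier[OF lam y] by simp
  have m: "(\<lambda>u. ?c * (\<integral>\<xi>. ?F u \<xi> \<partial>lborel)) \<in> borel_measurable lborel"
    by measurable
  have "poisson_transform lam f (cvec x y) a = (\<integral>u. ?c * (\<integral>\<xi>. ?F u \<xi> \<partial>lborel) \<partial>lborel)"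
    \<comment> \<open>The transform is taken over the completed measure; for a Borel integrand this
      agrees with the integral over \<open>lborel\<close>, where Fubini applies.\<close>
    unfolding poisson_transform_def eq by (rule integral_completion[OF m])
  also have "\<dots> = ?c * (\<integral>u. (\<integral>\<xi>. ?F u \<xi> \<partial>lborel) \<partial>lborel)"
    by (rule Bochner_Integration.integral_mult_right_zero)
  also have "(\<integral>u. (\<integral>\<xi>. ?F u \<xi> \<partial>lborel) \<partial>lborel) = (\<integral>\<xi>. (\<integral>u. ?F u \<xi> \<partial>lborel) \<partial>lborel)"
    by (rule lborel_pair.Fubini_integral[OF F, symmetric])
  also have "\<dots> = (\<integral>\<xi>. exp (\<i> * of_real (x \<bullet> \<xi>)) * (damped_subord lam a y \<xi> * fourier_int f \<xi>) \<partial>lborel)"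
  proof (rule Bochner_Integration.integral_cong[OF refl])
    fix \<xi> :: "real^'n"
    have "?F u \<xi> = (exp (\<i> * of_real (x \<bullet> \<xi>)) * damped_subord lam a y \<xi>) * (f u * exp (- \<i> * of_real (u \<bullet> \<xi>)))" for u
    proof -
      have "exp (\<i> * of_real ((x - u) \<bullet> \<xi>)) = exp (\<i> * of_real (x \<bullet> \<xi>)) * exp (- \<i> * of_real (u \<bullet> \<xi>))"
        unfolding exp_add[symmetric] by (simp add: inner_diff_left ring_distribs)
      then show ?thesis by (simp only: mult_ac)
    qed
    then show "(\<integral>u. ?F u \<xi> \<partial>lborel) = exp (\<i> * of_real (x \<bullet> \<xi>)) * (damped_subord lam a y \<xi> * fourier_int f \<xi>)"
      by (simp only: Bochner_Integration.integral_mult_right_zero fourier_int_def mult.assoc)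
  qed
  finally show ?thesis .
qed

text \<open>The function \<open>fourier_int f\<close> itself is in general only bounded and
  continuous; the multiplier in front of it supplies the integrability that
  \<open>fourier_plancherel\<close> asks for.\<close>

lemma poisson_slice_L1:
  fixes f :: "real^'n::finite \<Rightarrow> complex"
  assumes lam: "Re lam > 0" and y: "norm y < a" and f: "integrable lborel f"
  shows "(\<integral>\<^sup>+x. ennreal ((cmod (poisson_transform lam f (cvec x y) a))\<^sup>2) \<partial>lborel) =
     ennreal ((cmod (poisson_const lam (real CARD('n) / 2) a))\<^sup>2 * (2 * pi) ^ CARD('n)) *
       (\<integral>\<^sup>+\<xi>. ennreal ((cmod (damped_subord lam a y \<xi> * fourier_int f \<xi>))\<^sup>2) \<partial>lborel)"
proof -
  let ?c = "poisson_const lam (real CARD('n) / 2) a"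
  let ?h = "\<lambda>\<xi>. damped_subord lam a y \<xi> * fourier_int f \<xi>"
  define B where "B = (\<integral>u. norm (f u) \<partial>lborel)"
  have B: "B \<ge> 0" by (simp add: B_def)
  have a: "a > 0" using y norm_ge_zero[of y] by linarith
  have [measurable]: "f \<in> borel_measurable borel" using borel_measurable_integrable[OF f] by simp
  have dint: "integrable lborel (damped_subord lam a y)" by (rule damped_subord_integrable[OF lam y])
  have [measurable]: "damped_subord lam a y \<in> borel_measurable borel"
    using borel_measurable_integrable[OF dint] by simp
  have [measurable]: "fourier_int f \<in> borel_measurable borel"
    by (rule borel_measurable_continuous_onI[OF fourier_int_continuous[OF f]])
  have "integrable lborel ?h"
    by (rule Bochner_Integration.integrable_bound[OF integrable_mult_left[OF integrable_norm[OF dint], of B]])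
      (auto simp: norm_mult abs_mult B fourier_int_bound[OF f] B_def[symmetric] intro!: AE_I2 mult_left_mono order_trans[OF fourier_int_bound[OF f]])
  moreover have "continuous_on UNIV ?h"
    by (intro continuous_intros damped_subord_continuous fourier_int_continuous lam a f)
  moreover have "norm (?h \<xi>) \<le> Gamma (Re lam) * (a\<^sup>2 - (norm y)\<^sup>2) powr (- Re lam) * B" for \<xi>
    unfolding norm_mult B_def by (intro mult_mono damped_subord_bound lam y fourier_int_bound f) (use lam in auto)
  ultimately have P: "(\<integral>\<^sup>+x. ennreal ((cmod (\<integral>\<xi>. exp (\<i> * of_real (x \<bullet> \<xi>)) * ?h \<xi> \<partial>lborel))\<^sup>2) \<partial>lborel) =
    ennreal ((2 * pi) ^ CARD('n)) * (\<integral>\<^sup>+\<xi>. ennreal ((cmod (?h \<xi>))\<^sup>2) \<partial>lborel)"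
    by (rule fourier_plancherel)
  have "(\<integral>\<^sup>+x. ennreal ((cmod (poisson_transform lam f (cvec x y) a))\<^sup>2) \<partial>lborel) =
     (\<integral>\<^sup>+x. ennreal ((cmod ?c)\<^sup>2) * ennreal ((cmod (\<integral>\<xi>. exp (\<i> * of_real (x \<bullet> \<xi>)) * ?h \<xi> \<partial>lborel))\<^sup>2) \<partial>lborel)"
    unfolding poisson_transform_fourier[OF lam y f]
    by (simp add: norm_mult power_mult_distrib ennreal_mult)
  also have "\<dots> = ennreal ((cmod ?c)\<^sup>2) * (\<integral>\<^sup>+x. ennreal ((cmod (\<integral>\<xi>. exp (\<i> * of_real (x \<bullet> \<xi>)) * ?h \<xi> \<partial>lborel))\<^sup>2) \<partial>lborel)"
    by (rule nn_integral_cmult) measurable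
  finally show ?thesis unfolding P by (simp add: ennreal_mult mult.assoc)
qed

text \<open>The kernel is the Fourier integral of a bounded continuous integrable multiplier, so
  Plancherel gives its square integrability in u and spares any estimate of the complex power. This
  is what makes the Poisson integral of an L^2 function converge absolutely.\<close>

lemma poisson_ext_sq_integrable:
  fixes x y :: "real^'n::finite"
  assumes lam: "Re lam > 0" and y: "norm y < a"
  shows "integrable lborel (\<lambda>u. (cmod (poisson_ext lam (cvec x y) u a))\<^sup>2)"
    and "(\<lambda>u. poisson_ext lam (cvec x y) u a) \<in> borel_measurable borel"
proof -
  define H where "H v = (\<integral>\<xi>. exp (\<i> * of_real (v \<bullet> \<xi>)) * damped_subord lam a y \<xi> \<partial>lborel)" for v :: "real^'n"
  define B where "B = Gamma (Re lam) * (a\<^sup>2 - (norm y)\<^sup>2) powr (- Re lam)"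
  have B: "B \<ge> 0" using lam by (simp add: B_def)
  have a: "a > 0" using y norm_ge_zero[of y] by linarith
  have dint: "integrable lborel (damped_subord lam a y)" by (rule damped_subord_integrable[OF lam y])
  have [measurable]: "damped_subord lam a y \<in> borel_measurable borel"
    using borel_measurable_integrable[OF dint] by simp
  have [measurable]: "H \<in> borel_measurable borel" unfolding H_def by measurable
  have sq: "integrable lborel (\<lambda>\<xi>. (cmod (damped_subord lam a y \<xi>))\<^sup>2)"
    by (rule Bochner_Integration.integrable_bound[OF integrable_mult_right[OF integrable_norm[OF dint], of B]])
      (auto simp: power2_eq_square abs_mult B B_def[symmetric] intro!: AE_I2 mult_right_mono damped_subord_bound[OF lam y, folded B_def])
  have "(\<integral>\<^sup>+x. ennreal ((cmod (H x))\<^sup>2) \<partial>lborel) = ennreal ((2 * pi) ^ CARD('n)) * (\<integral>\<^sup>+\<xi>. ennreal ((cmod (damped_subord lam a y \<xi>))\<^sup>2) \<partial>lborel)"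
    unfolding H_def by (rule fourier_plancherel[OF dint damped_subord_continuous[OF lam a] damped_subord_bound[OF lam y]])
  also have "\<dots> < \<infinity>"
    using sq by (simp add: nn_integral_eq_integral ennreal_mult_less_top)
  finally have H2: "integrable lborel (\<lambda>v. (cmod (H v))\<^sup>2)"
    by (intro integrableI_bounded) auto
  then have "integrable lborel (\<lambda>u. (cmod (H (x + (-1) *\<^sub>R u)))\<^sup>2)"
    by (subst lborel_integrable_affine_iff[where f="\<lambda>v. (cmod (H v))\<^sup>2"]) auto
  then have "integrable lborel (\<lambda>u. (cmod (poisson_const lam (real CARD('n) / 2) a))\<^sup>2 * (cmod (H (x - u)))\<^sup>2)"
    by simp
  moreover have eq: "poisson_ext lam (cvec x y) u a = poisson_const lam (real CARD('n) / 2) a * H (x - u)" for u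
    unfolding poisson_ext_fourier[OF lam y] H_def ..
  ultimately show "integrable lborel (\<lambda>u. (cmod (poisson_ext lam (cvec x y) u a))\<^sup>2)"
    by (simp only: norm_mult power_mult_distrib)
  show "(\<lambda>u. poisson_ext lam (cvec x y) u a) \<in> borel_measurable borel"
    unfolding eq by measurable
qed

section \<open>Norm identities under L^2 limits\<close>

lemma norm_sq_le_eps:
  fixes x y :: complex
  assumes e: "e > 0"
  shows "(norm x)\<^sup>2 \<le> (1 + e) * (norm y)\<^sup>2 + (1 + 1 / e) * (norm (x - y))\<^sup>2"
proof -
  define p q where "p = norm y" and "q = norm (x - y)"
  have "norm x \<le> p + q" unfolding p_def q_def by (rule norm_triangle_sub)
  then have "(norm x)\<^sup>2 \<le> (p + q)\<^sup>2" by (intro power_mono) auto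
  also have "(p + q)\<^sup>2 = p\<^sup>2 + q\<^sup>2 + 2 * p * q" by (simp add: power2_eq_square algebra_simps)
  \<comment> \<open>Weighted so that the main term keeps the factor \<open>1 + e\<close>; with the
    fixed factor 2 an equality of norms would not survive the limit.\<close>
  also have "2 * p * q \<le> e * p\<^sup>2 + q\<^sup>2 / e"
  proof -
    have "0 \<le> (e * p - q)\<^sup>2 / e" using e by simp
    also have "\<dots> = e * p\<^sup>2 + q\<^sup>2 / e - 2 * p * q" using e by (simp add: field_simps power2_eq_square)
    finally show ?thesis by simp
  qed
  finally show ?thesis unfolding p_def q_def by (simp add: algebra_simps)
qed

lemma nn_integral_norm_sq_le_eps:
  fixes u v :: "'a \<Rightarrow> complex"
  assumes [measurable]: "u \<in> borel_measurable M" "v \<in> borel_measurable M" and e: "e > 0"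
  shows "(\<integral>\<^sup>+x. ennreal ((norm (u x))\<^sup>2) \<partial>M) \<le>
     ennreal (1 + e) * (\<integral>\<^sup>+x. ennreal ((norm (v x))\<^sup>2) \<partial>M) + ennreal (1 + 1 / e) * (\<integral>\<^sup>+x. ennreal ((norm (u x - v x))\<^sup>2) \<partial>M)"
proof -
  have "(\<integral>\<^sup>+x. ennreal ((norm (u x))\<^sup>2) \<partial>M) \<le> 
    (\<integral>\<^sup>+x. ennreal (1 + e) * ennreal ((norm (v x))\<^sup>2) + ennreal (1 + 1 / e) * ennreal ((norm (u x - v x))\<^sup>2) \<partial>M)"
  proof (rule nn_integral_mono)
    fix x
    have "ennreal ((norm (u x))\<^sup>2) \<le> ennreal ((1 + e) * (norm (v x))\<^sup>2 + (1 + 1 / e) * (norm (u x - v x))\<^sup>2)"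
      by (intro ennreal_leI norm_sq_le_eps e)
    then show "ennreal ((norm (u x))\<^sup>2) \<le> ennreal (1 + e) * ennreal ((norm (v x))\<^sup>2) + ennreal (1 + 1 / e) * ennreal ((norm (u x - v x))\<^sup>2)"
      using e by (simp add: ennreal_mult ennreal_plus)
  qed
  also have "\<dots> = ennreal (1 + e) * (\<integral>\<^sup>+x. ennreal ((norm (v x))\<^sup>2) \<partial>M) + ennreal (1 + 1 / e) * (\<integral>\<^sup>+x. ennreal ((norm (u x - v x))\<^sup>2) \<partial>M)"
    by (simp add: nn_integral_add nn_integral_cmult)
  finally show ?thesis .
qed

text \<open>Two uses of the weighted inequality, through \<open>uk\<close> and then through
  \<open>vk\<close>, give \<open>U \<le> (1 + e)^2 * V\<close> once k tends to infinity; then e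
  tends to 0. The argument takes place in [0, \<infinity>], so neither norm has to be finite, and
  exchanging the roles yields equality.\<close>

lemma nn_integral_norm_sq_limit_le:
  fixes u :: "'a \<Rightarrow> complex" and v :: "'b \<Rightarrow> complex"
  assumes [measurable]: "u \<in> borel_measurable M" "\<And>k. uk k \<in> borel_measurable M"
     "v \<in> borel_measurable N" "\<And>k. vk k \<in> borel_measurable N"
  assumes eq: "\<And>k::nat. (\<integral>\<^sup>+x. ennreal ((norm (uk k x))\<^sup>2) \<partial>M) = (\<integral>\<^sup>+x. ennreal ((norm (vk k x))\<^sup>2) \<partial>N)"
  assumes u: "(\<lambda>k. \<integral>\<^sup>+x. ennreal ((norm (u x - uk k x))\<^sup>2) \<partial>M) \<longlonglongrightarrow> 0"
  assumes v: "(\<lambda>k. \<integral>\<^sup>+x. ennreal ((norm (v x - vk k x))\<^sup>2) \<partial>N) \<longlonglongrightarrow> 0"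
  shows "(\<integral>\<^sup>+x. ennreal ((norm (u x))\<^sup>2) \<partial>M) \<le> (\<integral>\<^sup>+x. ennreal ((norm (v x))\<^sup>2) \<partial>N)"
proof -
  define U where "U = (\<integral>\<^sup>+x. ennreal ((norm (u x))\<^sup>2) \<partial>M)"
  define V where "V = (\<integral>\<^sup>+x. ennreal ((norm (v x))\<^sup>2) \<partial>N)"
  have le: "U \<le> ennreal ((1 + e)\<^sup>2) * V" if e: "e > 0" for e
  proof -
    have "U \<le> ennreal (1 + e) * (ennreal (1 + e) * V + ennreal (1 + 1 / e) * (\<integral>\<^sup>+x. ennreal ((norm (v x - vk k x))\<^sup>2) \<partial>N)) +
        ennreal (1 + 1 / e) * (\<integral>\<^sup>+x. ennreal ((norm (u x - uk k x))\<^sup>2) \<partial>M)" (is "U \<le> ?R k") for k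
    proof -
      have "U \<le> ennreal (1 + e) * (\<integral>\<^sup>+x. ennreal ((norm (uk k x))\<^sup>2) \<partial>M) + ennreal (1 + 1 / e) * (\<integral>\<^sup>+x. ennreal ((norm (u x - uk k x))\<^sup>2) \<partial>M)"
        unfolding U_def by (rule nn_integral_norm_sq_le_eps[OF _ _ e]) auto
      also have "(\<integral>\<^sup>+x. ennreal ((norm (uk k x))\<^sup>2) \<partial>M) \<le> ennreal (1 + e) * V + ennreal (1 + 1 / e) * (\<integral>\<^sup>+x. ennreal ((norm (vk k x - v x))\<^sup>2) \<partial>N)"
        unfolding V_def eq by (rule nn_integral_norm_sq_le_eps[OF _ _ e]) auto
      finally show ?thesis by (simp add: norm_minus_commute add_right_mono mult_left_mono)
    qed
    moreover have "?R \<longlonglongrightarrow> ennreal (1 + e) * (ennreal (1 + e) * V + ennreal (1 + 1 / e) * 0) + ennreal (1 + 1 / e) * 0"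
      by (intro tendsto_add tendsto_const ennreal_tendsto_cmult u v) auto
    ultimately have "U \<le> ennreal (1 + e) * (ennreal (1 + e) * V + ennreal (1 + 1 / e) * 0) + ennreal (1 + 1 / e) * 0"
      by (intro tendsto_lowerbound[OF _ always_eventually]) auto
    then show ?thesis using e by (simp add: mult.assoc[symmetric] power2_eq_square ennreal_mult)
  qed
  show ?thesis
  proof (cases "V = \<infinity>")
    case False
    then obtain r where r: "r \<ge> 0" "V = ennreal r" by (cases V) auto
    have "(\<lambda>k. ennreal ((1 + 1 / real (Suc k))\<^sup>2 * r)) \<longlonglongrightarrow> ennreal ((1 + 0)\<^sup>2 * r)"
      by (intro tendsto_intros LIMSEQ_Suc[OF lim_1_over_n])
    moreover have "U \<le> ennreal ((1 + 1 / real (Suc k))\<^sup>2 * r)" for k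
      using le[of "1 / real (Suc k)"] r by (simp add: ennreal_mult)
    ultimately have "U \<le> ennreal ((1 + 0)\<^sup>2 * r)"
      by (intro tendsto_lowerbound[OF _ always_eventually]) auto
    then show ?thesis using r by (simp add: U_def V_def)
  qed (simp add: V_def)
qed

lemma nn_integral_norm_sq_limit_eq:
  fixes u :: "'a \<Rightarrow> complex" and v :: "'b \<Rightarrow> complex"
  assumes "u \<in> borel_measurable M" "\<And>k. uk k \<in> borel_measurable M"
     "v \<in> borel_measurable N" "\<And>k. vk k \<in> borel_measurable N"
  assumes "\<And>k::nat. (\<integral>\<^sup>+x. ennreal ((norm (uk k x))\<^sup>2) \<partial>M) = (\<integral>\<^sup>+x. ennreal ((norm (vk k x))\<^sup>2) \<partial>N)"
  assumes "(\<lambda>k. \<integral>\<^sup>+x. ennreal ((norm (u x - uk k x))\<^sup>2) \<partial>M) \<longlonglongrightarrow> 0"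
  assumes "(\<lambda>k. \<integral>\<^sup>+x. ennreal ((norm (v x - vk k x))\<^sup>2) \<partial>N) \<longlonglongrightarrow> 0"
  shows "(\<integral>\<^sup>+x. ennreal ((norm (u x))\<^sup>2) \<partial>M) = (\<integral>\<^sup>+x. ennreal ((norm (v x))\<^sup>2) \<partial>N)"
  using nn_integral_norm_sq_limit_le[of u M uk v N vk] nn_integral_norm_sq_limit_le[of v N vk u M uk] assms
  by (intro antisym) auto

text \<open>The slice identity for integrable functions does not apply to \<open>f - fk k\<close>,
  which is merely square integrable. It does apply to \<open>fk l - fk k\<close>. Fatou's lemma in l
  then bounds the squared distance from \<open>P f\<close> to \<open>P (fk k)\<close> by that from
  \<open>g\<close> to \<open>gk k\<close>, up to a constant, because the multiplier is bounded at
  this fixed height.\<close>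

lemma poisson_slice_L2:
  fixes f g :: "real^'n::finite \<Rightarrow> complex"
  assumes lam: "Re lam > 0" and y: "norm y < a"
    and f [measurable]: "f \<in> borel_measurable borel" and f2: "integrable lborel (\<lambda>x. (cmod (f x))\<^sup>2)"
    and g [measurable]: "g \<in> borel_measurable borel"
    and lim: "(\<lambda>k. \<integral>\<^sup>+\<xi>. ennreal ((cmod (g \<xi> - of_real ((2 * pi) powr (- real CARD('n) / 2)) * fourier_int (\<lambda>x. indicator (cball 0 (real k)) x * f x) \<xi>))\<^sup>2) \<partial>lborel) \<longlonglongrightarrow> 0"
    and meas: "(\<lambda>x. poisson_transform lam f (cvec x y) a) \<in> borel_measurable borel"
  shows "(\<integral>\<^sup>+x. ennreal ((cmod (poisson_transform lam f (cvec x y) a))\<^sup>2) \<partial>lborel) =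
     ennreal ((cmod (poisson_const lam (real CARD('n) / 2) a))\<^sup>2 * (2 * pi) ^ (2 * CARD('n))) *
       (\<integral>\<^sup>+\<xi>. ennreal ((cmod (damped_subord lam a y \<xi>))\<^sup>2 * (cmod (g \<xi>))\<^sup>2) \<partial>lborel)"
proof -
  define fk where "fk k x = indicator (cball 0 (real k)) x * f x" for k x
  \<comment> \<open>In the square of \<open>c\<close>, one factor \<open>(2 * pi) ^ n\<close> is due
    to Plancherel and the other to the normalisation of the Fourier transform, see
    \<open>r2\<close>.\<close>
  define c where "c = cmod (poisson_const lam (real CARD('n) / 2) a) * (2 * pi) ^ CARD('n)"
  have c: "c \<ge> 0" by (simp add: c_def)
  define r where "r = (2 * pi) powr (- real CARD('n) / 2)"
  have r2: "r\<^sup>2 * (2 * pi) ^ CARD('n) = 1"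
  proof -
    have "r\<^sup>2 = (2 * pi) powr (- real CARD('n))"
      by (simp add: r_def power2_eq_square powr_add[symmetric])
    moreover have "(2 * pi) ^ CARD('n) = (2 * pi) powr (real CARD('n))"
      by (rule powr_realpow[symmetric]) simp
    ultimately show ?thesis by (simp only: powr_add[symmetric]) simp
  qed
  have r: "r > 0" by (simp add: r_def)
  define T where "T \<xi> = of_real c * damped_subord lam a y \<xi>" for \<xi>
  define B where "B = c * (Gamma (Re lam) * (a\<^sup>2 - (norm y)\<^sup>2) powr (- Re lam))"
  define P where "P h x = poisson_transform lam h (cvec x y) a" for h x
  have a: "a > 0" using y norm_ge_zero[of y] by linarith
  have [measurable]: "damped_subord lam a y \<in> borel_measurable borel"
    by (rule borel_measurable_continuous_onI[OF damped_subord_continuous[OF lam a]])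
  have [measurable]: "T \<in> borel_measurable borel" unfolding T_def by measurable
  have TB: "norm (T \<xi>) \<le> B" for \<xi>
    unfolding T_def B_def norm_mult using c damped_subord_bound[OF lam y, of \<xi>] by (simp add: mult_left_mono)
  have B: "B \<ge> 0" using TB[of 0] norm_ge_zero[of "T 0"] by linarith
  have [measurable]: "fk k \<in> borel_measurable borel" for k
    unfolding fk_def by (intro borel_measurable_times borel_measurable_indicator f) auto
  have fki: "integrable lborel (fk k)" for k
  proof (rule Bochner_Integration.integrable_bound)
    show "integrable lborel (\<lambda>x. (cmod (f x))\<^sup>2 + indicator (cball 0 (real k)) x)"
      using f2 emeasure_bounded_finite[OF bounded_cball, of "0::real^'n" "real k"]
      by (intro Bochner_Integration.integrable_add integrable_real_indicator) auto
    \<comment> \<open>A square integrable function is integrable on a ball, by this bound and the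
      finite volume of the ball.\<close>
    have "b \<le> b\<^sup>2 + 1" for b :: real
      using zero_le_power2[of "b - 1/2"] by (simp add: power2_eq_square algebra_simps)
    then show "AE x in lborel. norm (fk k x) \<le> norm ((cmod (f x))\<^sup>2 + indicator (cball 0 (real k)) x :: real)"
      by (intro AE_I2) (auto simp: fk_def indicator_def norm_mult)
  qed measurable
  have ftm [measurable]: "fourier_int (fk k) \<in> borel_measurable borel" for k
    by (rule borel_measurable_continuous_onI[OF fourier_int_continuous[OF fki]])
  define gk where "gk k \<xi> = of_real r * fourier_int (fk k) \<xi>" for k \<xi>
  have [measurable]: "gk k \<in> borel_measurable borel" for k unfolding gk_def by measurable
  define e where "e k = (\<integral>\<^sup>+\<xi>. ennreal ((cmod (g \<xi> - gk k \<xi>))\<^sup>2) \<partial>lborel)" for k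
  have e0: "e \<longlonglongrightarrow> 0" using lim unfolding e_def gk_def r_def fk_def by simp
  have slice: "(\<integral>\<^sup>+x. ennreal ((cmod (P h x))\<^sup>2) \<partial>lborel) = (\<integral>\<^sup>+\<xi>. ennreal ((cmod (T \<xi> * (of_real r * fourier_int h \<xi>)))\<^sup>2) \<partial>lborel)"
    if h: "integrable lborel h" for h
  proof -
    have [measurable]: "fourier_int h \<in> borel_measurable borel"
      by (rule borel_measurable_continuous_onI[OF fourier_int_continuous[OF h]])
    have "(cmod (T \<xi> * (of_real r * fourier_int h \<xi>)))\<^sup>2 = (cmod (poisson_const lam (real CARD('n) / 2) a))\<^sup>2 * (2 * pi) ^ CARD('n) * (cmod (damped_subord lam a y \<xi> * fourier_int h \<xi>))\<^sup>2" for \<xi>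
    proof -
      have "(cmod (T \<xi> * (of_real r * fourier_int h \<xi>)))\<^sup>2 = (cmod (poisson_const lam (real CARD('n) / 2) a))\<^sup>2 * (r\<^sup>2 * (2 * pi) ^ CARD('n)) * (2 * pi) ^ CARD('n) * (cmod (damped_subord lam a y \<xi> * fourier_int h \<xi>))\<^sup>2"
        by (simp add: T_def c_def norm_mult power_mult_distrib norm_power) (simp add: power2_eq_square mult_ac)
      then show ?thesis unfolding r2 by simp
    qed
    then show ?thesis
      unfolding P_def poisson_slice_L1[OF lam y h]
      by (simp add: ennreal_mult'' nn_integral_cmult)
  qed
  have Pm: "P h \<in> borel_measurable borel" if h: "integrable lborel h" for h
  proof -
    have [measurable]: "fourier_int h \<in> borel_measurable borel"
      by (rule borel_measurable_continuous_onI[OF fourier_int_continuous[OF h]])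
    show ?thesis unfolding P_def[abs_def] poisson_transform_fourier[OF lam y h] by measurable
  qed
  have [measurable]: "P (fk k) \<in> borel_measurable borel" for k by (rule Pm[OF fki])
  note p2 = poisson_ext_sq_integrable[OF lam y]
  \<comment> \<open>Both factors are square integrable in u, and a product is at most the sum of the
    squares.\<close>
  have Pint: "integrable lborel (\<lambda>u. f u * poisson_ext lam (cvec x y) u a)" for x
  proof (rule Bochner_Integration.integrable_bound)
    show "integrable lborel (\<lambda>u. (cmod (f u))\<^sup>2 + (cmod (poisson_ext lam (cvec x y) u a))\<^sup>2)"
      by (intro Bochner_Integration.integrable_add f2 p2)
    have "p * q \<le> p\<^sup>2 + q\<^sup>2" for p q :: real
    proof -
      have "0 \<le> p\<^sup>2 + q\<^sup>2" by simp
      then show ?thesis using sum_squares_bound[of p q] by linarith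
    qed
    then show "AE u in lborel. norm (f u * poisson_ext lam (cvec x y) u a) \<le> norm ((cmod (f u))\<^sup>2 + (cmod (poisson_ext lam (cvec x y) u a))\<^sup>2)"
      by (intro AE_I2) (auto simp: norm_mult)
  qed (use p2 f in measurable)
  have P_lborel: "P h x = (\<integral>u. h u * poisson_ext lam (cvec x y) u a \<partial>lborel)" if [measurable]: "h \<in> borel_measurable borel" for h x
    unfolding P_def poisson_transform_def using p2(2)[of x] by (intro integral_completion) measurable
  have Pfk_int: "integrable lborel (\<lambda>u. fk k u * poisson_ext lam (cvec x y) u a)" for k x
    using p2(2)[of x] by (intro Bochner_Integration.integrable_bound[OF Pint[of x]]) (auto simp: fk_def indicator_def norm_mult)
  have Pdiff: "P (\<lambda>x. fk k x - fk l x) x = P (fk k) x - P (fk l) x" for k l x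
    by (simp add: P_lborel Pfk_int left_diff_distrib)
  have ftdiff: "fourier_int (\<lambda>x. fk k x - fk l x) \<xi> = fourier_int (fk k) \<xi> - fourier_int (fk l) \<xi>" for k l \<xi>
  proof -
    have "integrable lborel (\<lambda>u. fk k u * exp (- \<i> * of_real (u \<bullet> \<xi>)))" for k
      by (rule Bochner_Integration.integrable_bound[OF fki[of k]]) (auto simp: norm_mult)
    then show ?thesis by (simp add: fourier_int_def left_diff_distrib)
  qed
  have Plim: "(\<lambda>k. P (fk k) x) \<longlonglongrightarrow> P f x" for x
    unfolding P_lborel[OF f] P_lborel[OF \<open>fk _ \<in> borel_measurable borel\<close>]
  proof (rule integral_dominated_convergence)
    show "integrable lborel (\<lambda>u. norm (f u * poisson_ext lam (cvec x y) u a))" using Pint by simp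
    show "AE u in lborel. (\<lambda>k. fk k u * poisson_ext lam (cvec x y) u a) \<longlonglongrightarrow> f u * poisson_ext lam (cvec x y) u a"
    proof (intro AE_I2 tendsto_eventually)
      fix u
      show "\<forall>\<^sub>F k in sequentially. fk k u * poisson_ext lam (cvec x y) u a = f u * poisson_ext lam (cvec x y) u a"
        using eventually_ge_at_top[of "nat \<lceil>norm u\<rceil>"]
        by eventually_elim (auto simp: fk_def indicator_def nat_ceiling_le_eq)
    qed
  qed (use p2(2)[of x] in \<open>auto simp: fk_def norm_mult indicator_def\<close>)
  have diff_le: "(\<integral>\<^sup>+x. ennreal ((cmod (P f x - P (fk k) x))\<^sup>2) \<partial>lborel) \<le> ennreal (2 * B\<^sup>2) * e k" for k
  proof -
    have "(\<integral>\<^sup>+x. ennreal ((cmod (P f x - P (fk k) x))\<^sup>2) \<partial>lborel) =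
       (\<integral>\<^sup>+x. liminf (\<lambda>l. ennreal ((cmod (P (fk l) x - P (fk k) x))\<^sup>2)) \<partial>lborel)"
      by (intro nn_integral_cong lim_imp_Liminf[symmetric] tendsto_intros Plim) auto
    also have "\<dots> \<le> liminf (\<lambda>l. \<integral>\<^sup>+x. ennreal ((cmod (P (fk l) x - P (fk k) x))\<^sup>2) \<partial>lborel)"
      by (intro nn_integral_liminf) measurable
    also have "\<dots> \<le> liminf (\<lambda>l. ennreal (2 * B\<^sup>2) * e l + ennreal (2 * B\<^sup>2) * e k)"
    proof (intro Liminf_mono always_eventually allI)
      fix l
      have "(\<integral>\<^sup>+x. ennreal ((cmod (P (fk l) x - P (fk k) x))\<^sup>2) \<partial>lborel) =
         (\<integral>\<^sup>+\<xi>. ennreal ((cmod (T \<xi> * (gk l \<xi> - gk k \<xi>)))\<^sup>2) \<partial>lborel)"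
        using slice[OF Bochner_Integration.integrable_diff[OF fki[of l] fki[of k]]]
        by (simp add: Pdiff ftdiff gk_def right_diff_distrib)
      also have "\<dots> \<le> (\<integral>\<^sup>+\<xi>. ennreal (2 * B\<^sup>2) * ennreal ((cmod (g \<xi> - gk l \<xi>))\<^sup>2) + ennreal (2 * B\<^sup>2) * ennreal ((cmod (g \<xi> - gk k \<xi>))\<^sup>2) \<partial>lborel)"
      proof (rule nn_integral_mono)
        fix \<xi>
        \<comment> \<open>The case \<open>e = 1\<close> of \<open>norm_sq_le_eps\<close>, passing
          through \<open>g\<close>; this is the origin of the factor \<open>2 * B^2\<close>.\<close>
        have "(cmod (gk l \<xi> - gk k \<xi>))\<^sup>2 \<le> 2 * (cmod (g \<xi> - gk l \<xi>))\<^sup>2 + 2 * (cmod (g \<xi> - gk k \<xi>))\<^sup>2"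
          using norm_sq_le_eps[of 1 "gk l \<xi> - gk k \<xi>" "gk l \<xi> - g \<xi>"] by (simp add: norm_minus_commute)
        moreover have "(cmod (T \<xi>))\<^sup>2 \<le> B\<^sup>2" by (intro power_mono TB) auto
        ultimately have "(cmod (T \<xi> * (gk l \<xi> - gk k \<xi>)))\<^sup>2 \<le> B\<^sup>2 * (2 * (cmod (g \<xi> - gk l \<xi>))\<^sup>2 + 2 * (cmod (g \<xi> - gk k \<xi>))\<^sup>2)"
          unfolding norm_mult power_mult_distrib by (intro mult_mono) auto
        also have "\<dots> = (2 * B\<^sup>2) * (cmod (g \<xi> - gk l \<xi>))\<^sup>2 + (2 * B\<^sup>2) * (cmod (g \<xi> - gk k \<xi>))\<^sup>2"
          by (simp add: algebra_simps)
        finally have "ennreal ((cmod (T \<xi> * (gk l \<xi> - gk k \<xi>)))\<^sup>2) \<le> ennreal ((2 * B\<^sup>2) * (cmod (g \<xi> - gk l \<xi>))\<^sup>2 + (2 * B\<^sup>2) * (cmod (g \<xi> - gk k \<xi>))\<^sup>2)"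
          by (rule ennreal_leI)
        then show "ennreal ((cmod (T \<xi> * (gk l \<xi> - gk k \<xi>)))\<^sup>2) \<le> ennreal (2 * B\<^sup>2) * ennreal ((cmod (g \<xi> - gk l \<xi>))\<^sup>2) + ennreal (2 * B\<^sup>2) * ennreal ((cmod (g \<xi> - gk k \<xi>))\<^sup>2)"
          by (simp only: ennreal_plus ennreal_mult zero_le_power2 mult_nonneg_nonneg zero_le_numeral)
      qed
      also have "\<dots> = ennreal (2 * B\<^sup>2) * e l + ennreal (2 * B\<^sup>2) * e k"
        unfolding e_def by (subst nn_integral_add) (auto simp: nn_integral_cmult)
      finally show "(\<integral>\<^sup>+x. ennreal ((cmod (P (fk l) x - P (fk k) x))\<^sup>2) \<partial>lborel) \<le> ennreal (2 * B\<^sup>2) * e l + ennreal (2 * B\<^sup>2) * e k" .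
    qed
    \<comment> \<open>The term in l vanishes in the limit while k stays fixed.\<close>
    also have "\<dots> = ennreal (2 * B\<^sup>2) * 0 + ennreal (2 * B\<^sup>2) * e k"
      by (intro lim_imp_Liminf tendsto_add tendsto_const ennreal_tendsto_cmult e0) auto
    finally show ?thesis by simp
  qed
  have lim1: "(\<lambda>k. \<integral>\<^sup>+x. ennreal ((cmod (P f x - P (fk k) x))\<^sup>2) \<partial>lborel) \<longlonglongrightarrow> 0"
  proof (rule tendsto_sandwich[OF always_eventually always_eventually tendsto_const])
    show "(\<lambda>k. ennreal (2 * B\<^sup>2) * e k) \<longlonglongrightarrow> 0"
      using ennreal_tendsto_cmult[OF _ e0, of "ennreal (2 * B\<^sup>2)"] by simp
  qed (use diff_le in auto)
  have lim2: "(\<lambda>k. \<integral>\<^sup>+\<xi>. ennreal ((cmod (T \<xi> * g \<xi> - T \<xi> * gk k \<xi>))\<^sup>2) \<partial>lborel) \<longlonglongrightarrow> 0"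
  proof (rule tendsto_sandwich[OF always_eventually always_eventually tendsto_const])
    show "(\<lambda>k. ennreal (B\<^sup>2) * e k) \<longlonglongrightarrow> 0"
      using ennreal_tendsto_cmult[OF _ e0, of "ennreal (B\<^sup>2)"] by simp
    show "\<forall>k. (\<integral>\<^sup>+\<xi>. ennreal ((cmod (T \<xi> * g \<xi> - T \<xi> * gk k \<xi>))\<^sup>2) \<partial>lborel) \<le> ennreal (B\<^sup>2) * e k"
    proof
      fix k
      have "(\<integral>\<^sup>+\<xi>. ennreal ((cmod (T \<xi> * g \<xi> - T \<xi> * gk k \<xi>))\<^sup>2) \<partial>lborel) \<le> (\<integral>\<^sup>+\<xi>. ennreal (B\<^sup>2) * ennreal ((cmod (g \<xi> - gk k \<xi>))\<^sup>2) \<partial>lborel)"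
        by (intro nn_integral_mono)
          (auto simp: right_diff_distrib[symmetric] norm_mult power_mult_distrib ennreal_mult[symmetric] intro!: mult_right_mono power_mono TB ennreal_leI)
      then show "(\<integral>\<^sup>+\<xi>. ennreal ((cmod (T \<xi> * g \<xi> - T \<xi> * gk k \<xi>))\<^sup>2) \<partial>lborel) \<le> ennreal (B\<^sup>2) * e k"
        unfolding e_def by (simp add: nn_integral_cmult)
    qed
  qed auto
  have "(\<integral>\<^sup>+x. ennreal ((cmod (P f x))\<^sup>2) \<partial>lborel) = (\<integral>\<^sup>+\<xi>. ennreal ((cmod (T \<xi> * g \<xi>))\<^sup>2) \<partial>lborel)"
  proof (rule nn_integral_norm_sq_limit_eq[OF _ _ _ _ _ lim1 lim2])
    show "P f \<in> borel_measurable lborel" using meas by (simp add: P_def[abs_def])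
    show "P (fk k) \<in> borel_measurable lborel" for k using Pm[OF fki] by simp
    show "(\<integral>\<^sup>+x. ennreal ((cmod (P (fk k) x))\<^sup>2) \<partial>lborel) = (\<integral>\<^sup>+\<xi>. ennreal ((cmod (T \<xi> * gk k \<xi>))\<^sup>2) \<partial>lborel)" for k
      using slice[OF fki] by (simp add: gk_def)
  qed measurable
  also have "\<dots> = (\<integral>\<^sup>+\<xi>. ennreal (c\<^sup>2) * ennreal ((cmod (damped_subord lam a y \<xi>))\<^sup>2 * (cmod (g \<xi>))\<^sup>2) \<partial>lborel)"
    by (intro nn_integral_cong) (simp add: T_def norm_mult power_mult_distrib ennreal_mult'[symmetric] mult.assoc)
  also have "\<dots> = ennreal (c\<^sup>2) * (\<integral>\<^sup>+\<xi>. ennreal ((cmod (damped_subord lam a y \<xi>))\<^sup>2 * (cmod (g \<xi>))\<^sup>2) \<partial>lborel)"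
    by (rule nn_integral_cmult) measurable
  finally show ?thesis
    unfolding P_def c_def power_mult_distrib by (simp add: power_mult power_even_eq mult.commute)
qed

section \<open>The function K\<close>

text \<open>Substitute \<open>t = r / (2 * a) * exp v\<close>.\<close>
lemma subord_besselK:
  assumes lam: "Re lam > 0" and a: "a > 0" and r: "r > 0"
  shows "subord lam a r = 2 * of_real (r / (2 * a)) powr lam * besselK lam (a * r)"
proof -
  define c where "c = r / (2 * a)"
  have c: "c > 0" using a r by (simp add: c_def)
  let ?f = "\<lambda>t. complex_of_real t powr (lam - 1) * of_real (exp (- (t * a\<^sup>2) - r\<^sup>2 / (4 * t)))"
  define F where "F v = exp (lam * of_real v) * of_real (exp (- (a * r) * cosh v))" for v
  have img: "(\<lambda>v. c * exp v) ` UNIV = {0<..}"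
  proof (intro equalityI subsetI)
    fix t :: real assume "t \<in> {0<..}"
    then have "t = c * exp (ln (t / c))" using c by simp
    then show "t \<in> (\<lambda>v. c * exp v) ` UNIV" by blast
  qed (use c in auto)
  have fint: "?f absolutely_integrable_on {0<..}" "integral {0<..} ?f = subord lam a r"
  proof -
    show *: "?f absolutely_integrable_on {0<..}"
      unfolding set_integrable_def using integrable_subord_integrand[OF lam a, of r]
      by (simp add: subord_integrand_def[abs_def] integrable_completion borel_measurable_integrable)
    have "set_lebesgue_integral lebesgue {0<..} ?f = subord lam a r"
      unfolding set_lebesgue_integral_def subord_def
      using borel_measurable_integrable[OF integrable_subord_integrand[OF lam a, of r]]
      by (simp add: subord_integrand_def[abs_def] integral_completion)
    then show "integral {0<..} ?f = subord lam a r"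
      using set_lebesgue_integral_eq_integral(2)[OF *] by simp
  qed
  have sub: "\<bar>c * exp v\<bar> *\<^sub>R ?f (c * exp v) = of_real c powr lam * F v" for v
  proof -
    have 1: "complex_of_real (c * exp v) powr (lam - 1) = of_real c powr lam * exp (lam * of_real v) / of_real (c * exp v)"
    proof -
      have "complex_of_real (c * exp v) powr (lam - 1) = exp ((lam - 1) * of_real (ln c + v))"
        using c by (simp add: powr_def Ln_of_real ln_mult flip: of_real_mult)
      also have "\<dots> = exp (lam * of_real (ln c)) * exp (lam * of_real v) / exp (of_real (ln (c * exp v)))"
        using c by (simp add: exp_add[symmetric] exp_diff[symmetric] ln_mult algebra_simps)
      also have "exp (complex_of_real (ln (c * exp v))) = of_real (c * exp v)"
        using c by (simp only: exp_of_real) simp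
      also have "exp (lam * of_real (ln c)) = complex_of_real c powr lam"
        using c by (simp add: powr_def Ln_of_real)
      finally show ?thesis .
    qed
    \<comment> \<open>With \<open>c = r / (2 * a)\<close> the two exponents \<open>t * a^2\<close>
      and \<open>r^2 / (4 * t)\<close> become \<open>(a * r / 2) * exp v\<close> and
      \<open>(a * r / 2) * exp (- v)\<close>, whose sum is \<open>a * r * cosh v\<close>.\<close>
    have 2: "- (c * exp v * a\<^sup>2) - r\<^sup>2 / (4 * (c * exp v)) = - (a * r) * cosh v"
      using a r by (simp add: c_def cosh_def exp_minus field_simps power2_eq_square)
    show ?thesis unfolding 1 2 F_def using c by (simp add: scaleR_conv_of_real)
  qed
  have "(\<lambda>v. \<bar>c * exp v\<bar> *\<^sub>R ?f (c * exp v)) absolutely_integrable_on UNIV \<and> integral UNIV (\<lambda>v. \<bar>c * exp v\<bar> *\<^sub>R ?f (c * exp v)) = subord lam a r"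
  proof (rule iffD2[OF has_absolute_integral_change_of_variables_real])
    show "((\<lambda>v. c * exp v) has_field_derivative c * exp v) (at v within UNIV)" for v
      by (auto intro!: derivative_eq_intros)
    show "inj_on (\<lambda>v. c * exp v) UNIV" using c by (auto simp: inj_on_def)
  qed (use fint in \<open>auto simp: img\<close>)
  then have ai: "(\<lambda>v. of_real c powr lam * F v) absolutely_integrable_on UNIV"
    and ieq: "integral UNIV (\<lambda>v. of_real c powr lam * F v) = subord lam a r"
    unfolding sub by auto
  have Fm [measurable]: "F \<in> borel_measurable borel"
    unfolding F_def by (intro borel_measurable_continuous_onI continuous_intros)
  have cp: "complex_of_real c powr lam \<noteq> 0" using c by simp
  have "integrable lborel (\<lambda>v. of_real c powr lam * F v)"
    using ai unfolding set_integrable_def by (simp add: integrable_completion)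
  from integrable_mult_right[OF this, of "inverse (of_real c powr lam)"] have Fint: "integrable lborel F"
    using cp by (simp add: mult.assoc[symmetric])
  have "subord lam a r = (\<integral>v. of_real c powr lam * F v \<partial>lebesgue)"
    using set_lebesgue_integral_eq_integral(2)[OF ai] ieq c by (simp add: set_lebesgue_integral_def)
  also have "\<dots> = of_real c powr lam * (\<integral>v. F v \<partial>lborel)"
    by (subst integral_completion) auto
  \<comment> \<open>\<open>besselK\<close> is an integral over v > 0. Folding the negative half line
    onto it adds \<open>exp (- lam * v)\<close> to \<open>exp (lam * v)\<close>, hence the factor 2
    and the \<open>cosh\<close>.\<close>
  also have "(\<integral>v. F v \<partial>lborel) = 2 * besselK lam (a * r)"
  proof -
    have i1: "integrable lborel (\<lambda>v. indicator {0<..} v *\<^sub>R F v)"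
      using Fint by (rule integrable_mult_indicator[rotated]) simp
    have i2: "integrable lborel (\<lambda>v. indicator {..<0} v *\<^sub>R F v)"
      using Fint by (rule integrable_mult_indicator[rotated]) simp
    have i3: "(\<integral>v. indicator {..<0} v *\<^sub>R F v \<partial>lborel) = (\<integral>v. indicator {0<..} v *\<^sub>R F (- v) \<partial>lborel)"
      by (subst lborel_integral_real_affine[where c="-1" and t=0]) (auto intro!: Bochner_Integration.integral_cong simp: indicator_def)
    have "integrable lborel (\<lambda>v. F (0 + (-1) * v))"
      by (rule lborel_integrable_real_affine[OF Fint]) simp
    then have i4: "integrable lborel (\<lambda>v. indicator {0<..} v *\<^sub>R F (- v))"
      by (intro integrable_mult_indicator) auto
    have "(\<integral>v. F v \<partial>lborel) = (\<integral>v. indicator {0<..} v *\<^sub>R F v + indicator {..<0} v *\<^sub>R F v \<partial>lborel)"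
    proof (rule integral_cong_AE)
      show "AE v in lborel. F v = indicator {0<..} v *\<^sub>R F v + indicator {..<0} v *\<^sub>R F v"
        using AE_lborel_singleton[of 0] by eventually_elim (auto simp: indicator_def)
    qed measurable
    also have "\<dots> = (\<integral>v. indicator {0<..} v *\<^sub>R F v + indicator {0<..} v *\<^sub>R F (- v) \<partial>lborel)"
      using i1 i2 i3 i4 by simp
    also have "\<dots> = (\<integral>v. 2 * (indicator {0<..} v *\<^sub>R (complex_of_real (exp (- (a * r) * cosh v)) * cosh (lam * of_real v))) \<partial>lborel)"
      by (intro Bochner_Integration.integral_cong)
        (auto simp: F_def indicator_def cosh_field_def[of "lam * _"] algebra_simps)
    also have "\<dots> = 2 * besselK lam (a * r)"
      unfolding besselK_def set_lebesgue_integral_def by (simp only: Bochner_Integration.integral_mult_right_zero)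
    finally show ?thesis .
  qed
  finally show ?thesis by (simp add: c_def)
qed

lemma norm_subord_sq:
  assumes lam: "Re lam > 0" and a: "a > 0" and r: "r > 0"
  shows "(cmod (subord lam a r))\<^sup>2 = 4 * (2 * a\<^sup>2) powr (- 2 * Re lam) * ((a * r) powr (2 * Re lam) * (cmod (besselK lam (a * r)))\<^sup>2)"
proof -
  have "cmod (of_real (r / (2 * a)) powr lam) = (r / (2 * a)) powr Re lam"
    using a r by (simp add: norm_powr_real_powr del: of_real_divide)
  then have "(cmod (of_real (r / (2 * a)) powr lam))\<^sup>2 = (r / (2 * a)) powr (2 * Re lam)"
    by (simp add: power2_eq_square powr_add[symmetric] del: of_real_divide)
  also have "(r / (2 * a)) powr (2 * Re lam) = (2 * a\<^sup>2) powr (- 2 * Re lam) * (a * r) powr (2 * Re lam)"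
  proof -
    \<comment> \<open>Splitting off \<open>2 * a^2\<close> leaves a power of \<open>a * r\<close>,
      the variable of the frequency weight.\<close>
    have *: "r / (2 * a)  = (a * r) / (2 * a\<^sup>2)" using a by (simp add: power2_eq_square)
    show ?thesis unfolding * powr_divide by (simp add: powr_minus_divide)
  qed
  finally show ?thesis
    unfolding subord_besselK[OF assms] norm_mult power_mult_distrib by (simp del: of_real_divide)
qed

section \<open>The function I\<close>

lemma lborel_nn_integral_affine:
  fixes f :: "'a::euclidean_space \<Rightarrow> ennreal"
  assumes c: "c \<noteq> 0" and [measurable]: "f \<in> borel_measurable borel"
  shows "(\<integral>\<^sup>+x. f x \<partial>lborel) = ennreal (\<bar>c\<bar> ^ DIM('a)) * (\<integral>\<^sup>+x. f (t + c *\<^sub>R x) \<partial>lborel)"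
proof -
  have "(\<integral>\<^sup>+x. f x \<partial>lborel) = (\<integral>\<^sup>+x. f x \<partial>density (distr lborel borel (\<lambda>x. t + c *\<^sub>R x)) (\<lambda>_. \<bar>c\<bar> ^ DIM('a)))"
    using lborel_affine[OF c, of t] by simp
  also have "\<dots> = (\<integral>\<^sup>+x. ennreal (\<bar>c\<bar> ^ DIM('a)) * f (t + c *\<^sub>R x) \<partial>lborel)"
    by (simp add: nn_integral_density nn_integral_distr nn_integral_cmult)
  finally show ?thesis by (simp add: nn_integral_cmult)
qed

text \<open>If a coefficient differed, the zero at 0 of the difference series would be isolated,
  whereas that series vanishes on the whole half line. The half line appears because x = t^2 in the
  application.\<close>

lemma powser_nonneg_unique:
  fixes a b :: "nat \<Rightarrow> real"
  assumes a: "\<And>x. x \<ge> 0 \<Longrightarrow> (\<lambda>k. a k * x ^ k) sums f x" and b: "\<And>x. x \<ge> 0 \<Longrightarrow> (\<lambda>k. b k * x ^ k) sums f x"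
  shows "a = b"
proof (rule ccontr)
  assume "a \<noteq> b"
  define c where "c k = a k - b k" for k
  have c0: "(\<lambda>k. c k * x ^ k) sums 0" if "x \<ge> 0" for x
    using sums_diff[OF a[OF that] b[OF that]] by (simp add: c_def left_diff_distrib)
  define F where "F x = (\<Sum>k. c k * x ^ k)" for x
  have F: "(\<lambda>k. c k * (x - 0) ^ k) sums F x" for x
  proof -
    \<comment> \<open>Convergence at the point \<open>\<bar>x\<bar> + 1\<close> of the half line
      gives convergence at x, also for negative x.\<close>
    have "summable (\<lambda>k. c k * x ^ k)"
      by (rule powser_inside[OF sums_summable[OF c0[of "\<bar>x\<bar> + 1"]]]) auto
    then show ?thesis by (simp add: F_def summable_sums)
  qed
  have Fz: "F x = 0" if "x \<ge> 0" for x using sums_unique2[OF F[of x]] c0[OF that] by simp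
  have "c 0 = 0"
    using Fz[of 0] by (simp add: F_def)
  moreover obtain m where "c m \<noteq> 0" using \<open>a \<noteq> b\<close> by (auto simp: c_def fun_eq_iff)
  ultimately have "m > 0" by (intro Nat.gr0I) auto
  obtain s where "s > 0" and s: "\<And>z. z \<in> cball 0 s - {0} \<Longrightarrow> F z \<noteq> 0"
    using powser_0_nonzero[OF zero_less_one F Fz[OF order_refl] \<open>c m \<noteq> 0\<close> \<open>m > 0\<close>] by blast
  from s[of s] Fz[of s] \<open>s > 0\<close> show False by auto
qed

lemma cosh_sums_even: "(\<lambda>k. y ^ (2 * k) / fact (2 * k)) sums cosh y" for y :: real
proof -
  have "(\<lambda>k. (\<lambda>n. if even n then y ^ n /\<^sub>R fact n else 0) (2 * k)) sums cosh y"
    by (subst sums_mono_reindex) (auto simp: strict_mono_def cosh_converges elim!: evenE)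
  then show ?thesis by (simp add: divide_inverse mult.commute)
qed

lemma gaussian_integral_exp:
  assumes c: "c > 0"
  shows "has_bochner_integral lborel (\<lambda>y::real^'n::finite. exp (y \<bullet> b - c * (norm y)\<^sup>2))
    ((pi / c) powr (real CARD('n) / 2) * exp ((norm b)\<^sup>2 / (4 * c)))"
proof -
  have 1: "exp ((\<Sum>i\<in>UNIV. of_real (b$i) * of_real (y$i)) - of_real (c * (norm y)\<^sup>2)) = complex_of_real (exp (y \<bullet> b - c * (norm y)\<^sup>2))" for y
    by (simp add: exp_of_real[symmetric] inner_vec_def mult.commute)
  have 2: "(\<Sum>i\<in>UNIV. (complex_of_real (b$i))\<^sup>2) = of_real ((norm b)\<^sup>2)"
    by (simp add: norm_vec_def L2_set_def sum_nonneg)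
  have 3: "of_real ((pi / c) powr (real CARD('n) / 2)) * exp (complex_of_real ((norm b)\<^sup>2) / of_real (4 * c)) =
     of_real ((pi / c) powr (real CARD('n) / 2) * exp ((norm b)\<^sup>2 / (4 * c)))"
    by (simp add: exp_of_real[symmetric])
  have "has_bochner_integral lborel (\<lambda>y. complex_of_real (exp (y \<bullet> b - c * (norm y)\<^sup>2)))
     (of_real ((pi / c) powr (real CARD('n) / 2) * exp ((norm b)\<^sup>2 / (4 * c))))"
    using gaussian_integral[OF c, of "\<lambda>i. of_real (b$i)"] unfolding 1 2 3 .
  then show ?thesis
    using has_bochner_integral_bounded_linear[OF bounded_linear_Re] by fastforce
qed

text \<open>Average over y and -y. With \<open>cosh\<close> in place of \<open>exp\<close> only even
  powers of the inner product occur, so all terms of the series are nonnegative and termwise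
  integration in [0, \<infinity>] raises no convergence question.\<close>

lemma nn_integral_even_cosh:
  fixes w :: "real^'n::finite \<Rightarrow> real"
  assumes [measurable]: "w \<in> borel_measurable borel" and w: "\<And>y. w y \<ge> 0" "\<And>y. w (- y) = w y"
  shows "(\<integral>\<^sup>+y. ennreal (exp (y \<bullet> b) * w y) \<partial>lborel) = (\<integral>\<^sup>+y. ennreal (cosh (y \<bullet> b) * w y) \<partial>lborel)"
proof -
  let ?A = "\<integral>\<^sup>+y. ennreal (exp (y \<bullet> b) * w y) \<partial>lborel"
  have r: "?A = (\<integral>\<^sup>+y. ennreal (exp (- (y \<bullet> b)) * w y) \<partial>lborel)"
    by (subst lborel_nn_integral_affine[where c="-1" and t=0]) (auto simp: w)
  have "2 * ?A = ?A + (\<integral>\<^sup>+y. ennreal (exp (- (y \<bullet> b)) * w y) \<partial>lborel)"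
    by (simp add: r[symmetric] mult_2)
  also have "\<dots> = (\<integral>\<^sup>+y. ennreal (exp (y \<bullet> b) * w y) + ennreal (exp (- (y \<bullet> b)) * w y) \<partial>lborel)"
    by (rule nn_integral_add[symmetric]) measurable
  also have "\<dots> = (\<integral>\<^sup>+y. 2 * ennreal (cosh (y \<bullet> b) * w y) \<partial>lborel)"
  proof (intro nn_integral_cong)
    fix y
    have "ennreal (exp (y \<bullet> b) * w y) + ennreal (exp (- (y \<bullet> b)) * w y) = ennreal (2 * (cosh (y \<bullet> b) * w y))"
      using w by (subst ennreal_plus[symmetric]) (auto simp: cosh_def algebra_simps)
    then show "ennreal (exp (y \<bullet> b) * w y) + ennreal (exp (- (y \<bullet> b)) * w y) = 2 * ennreal (cosh (y \<bullet> b) * w y)"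
      using w by (simp add: ennreal_mult)
  qed
  also have "\<dots> = 2 * (\<integral>\<^sup>+y. ennreal (cosh (y \<bullet> b) * w y) \<partial>lborel)"
    by (rule nn_integral_cmult) (unfold cosh_def, measurable)
  finally show ?thesis
    by (simp add: ennreal_mult_cancel_left)
qed

text \<open>The scalar c is kept apart from b so that the moments on the right do not depend on it:
  \<open>gaussian_moment\<close> takes \<open>c = 2 * t\<close> and compares powers of t,
  \<open>ball_laplace_besselI\<close> takes \<open>c = - 2\<close>.\<close>

lemma nn_integral_cosh_series:
  fixes w :: "real^'n::finite \<Rightarrow> real"
  assumes [measurable]: "w \<in> borel_measurable borel" and w: "\<And>y. w y \<ge> 0"
  shows "(\<integral>\<^sup>+y. ennreal (cosh (y \<bullet> (c *\<^sub>R b)) * w y) \<partial>lborel) =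
    (\<Sum>k. ennreal (c ^ (2 * k) / fact (2 * k)) * (\<integral>\<^sup>+y. ennreal ((y \<bullet> b) ^ (2 * k) * w y) \<partial>lborel))"
proof -
  have "(\<integral>\<^sup>+y. ennreal (cosh (y \<bullet> (c *\<^sub>R b)) * w y) \<partial>lborel) =
     (\<integral>\<^sup>+y. (\<Sum>k. ennreal (c ^ (2 * k) / fact (2 * k)) * ennreal ((y \<bullet> b) ^ (2 * k) * w y)) \<partial>lborel)"
  proof (intro nn_integral_cong)
    fix y
    have "(\<lambda>k. (y \<bullet> (c *\<^sub>R b)) ^ (2 * k) / fact (2 * k) * w y) sums (cosh (y \<bullet> (c *\<^sub>R b)) * w y)"
      by (intro sums_mult2 cosh_sums_even)
    then have "(\<lambda>k. ennreal ((y \<bullet> (c *\<^sub>R b)) ^ (2 * k) / fact (2 * k) * w y)) sums ennreal (cosh (y \<bullet> (c *\<^sub>R b)) * w y)"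
      by (subst sums_ennreal) (auto simp: w power_mult intro!: mult_nonneg_nonneg cosh_real_nonneg)
    moreover have "ennreal ((y \<bullet> (c *\<^sub>R b)) ^ (2 * k) / fact (2 * k) * w y) = ennreal (c ^ (2 * k) / fact (2 * k)) * ennreal ((y \<bullet> b) ^ (2 * k) * w y)" for k
      by (subst ennreal_mult[symmetric]) (auto simp: w power_mult power_mult_distrib)
    ultimately show "ennreal (cosh (y \<bullet> (c *\<^sub>R b)) * w y) = (\<Sum>k. ennreal (c ^ (2 * k) / fact (2 * k)) * ennreal ((y \<bullet> b) ^ (2 * k) * w y))"
      by (simp add: sums_iff)
  qed
  also have "\<dots> = (\<Sum>k. \<integral>\<^sup>+y. ennreal (c ^ (2 * k) / fact (2 * k)) * ennreal ((y \<bullet> b) ^ (2 * k) * w y) \<partial>lborel)"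
    by (rule nn_integral_suminf) measurable
  also have "\<dots> = (\<Sum>k. ennreal (c ^ (2 * k) / fact (2 * k)) * (\<integral>\<^sup>+y. ennreal ((y \<bullet> b) ^ (2 * k) * w y) \<partial>lborel))"
    by (intro suminf_cong nn_integral_cmult) measurable
  finally show ?thesis .
qed

text \<open>The moments are the coefficients of a generating function: integrating
  \<open>exp (2 * t * (y \<bullet> b) - |y|^2)\<close> gives
  \<open>pi powr (n / 2) * exp (t^2 * |b|^2)\<close>, and both sides are power series in
  t^2.\<close>

lemma gaussian_moment:
  fixes b :: "real^'n::finite"
  shows "(\<integral>\<^sup>+y. ennreal ((y \<bullet> b) ^ (2 * k) * exp (- (norm y)\<^sup>2)) \<partial>lborel) =
    ennreal (pi powr (real CARD('n) / 2) * (norm b) ^ (2 * k) * fact (2 * k) / (4 ^ k * fact k))"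
proof -
  define m where "m = real CARD('n) / 2"
  define G where "G k = (\<integral>\<^sup>+y. ennreal ((y \<bullet> b) ^ (2 * k) * exp (- (norm y)\<^sup>2)) \<partial>lborel)" for k
  have s: "(\<Sum>k. ennreal ((2 * t) ^ (2 * k) / fact (2 * k)) * G k) = ennreal (pi powr m * exp (t\<^sup>2 * (norm b)\<^sup>2))" for t
  proof -
    have "(\<Sum>k. ennreal ((2 * t) ^ (2 * k) / fact (2 * k)) * G k) = (\<integral>\<^sup>+y. ennreal (cosh (y \<bullet> ((2 * t) *\<^sub>R b)) * exp (- (norm y)\<^sup>2)) \<partial>lborel)"
      unfolding G_def by (rule nn_integral_cosh_series[symmetric]) auto
    also have "\<dots> = (\<integral>\<^sup>+y. ennreal (exp (y \<bullet> ((2 * t) *\<^sub>R b)) * exp (- (norm y)\<^sup>2)) \<partial>lborel)"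
      by (rule nn_integral_even_cosh[symmetric]) auto
    also have "\<dots> = (\<integral>\<^sup>+y. ennreal (exp (y \<bullet> ((2 * t) *\<^sub>R b) - 1 * (norm y)\<^sup>2)) \<partial>lborel)"
      unfolding exp_add[symmetric] by simp
    also have "\<dots> = ennreal ((pi / 1) powr m * exp ((norm ((2 * t) *\<^sub>R b))\<^sup>2 / (4 * 1)))"
      using gaussian_integral_exp[of 1 "(2 * t) *\<^sub>R b"] unfolding m_def
      by (subst nn_integral_eq_integral) (auto simp: has_bochner_integral_iff)
    finally show ?thesis by (simp add: power_mult_distrib)
  qed
  \<comment> \<open>At t = 1/2 every summand has a positive coefficient and the sum is finite, so
    each moment is finite.\<close>
  have "G k \<noteq> \<infinity>" for k
  proof
    assume "G k = \<infinity>"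
    then have "ennreal ((2 * (1/2)) ^ (2 * k) / fact (2 * k)) * G k = \<infinity>"
      by (simp add: ennreal_mult_eq_top_iff)
    moreover have "ennreal ((2 * (1/2)) ^ (2 * k) / fact (2 * k)) * G k \<le> (\<Sum>k. ennreal ((2 * (1/2)) ^ (2 * k) / fact (2 * k)) * G k)"
      using sum_le_suminf[of "\<lambda>k. ennreal ((2 * (1/2)) ^ (2 * k) / fact (2 * k)) * G k" "{k}"] by simp
    ultimately show False unfolding s by (simp add: top_unique)
  qed
  then have "\<exists>g. g \<ge> 0 \<and> G k = ennreal g" for k
    by (cases "G k") auto
  then obtain g where g: "\<And>k. g k \<ge> 0" "\<And>k. G k = ennreal (g k)" by metis
  have "(\<lambda>k. 4 ^ k / fact (2 * k) * g k) = (\<lambda>k. pi powr m * (norm b) ^ (2 * k) / fact k)"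
  proof (rule powser_nonneg_unique)
    fix x :: real assume x: "x \<ge> 0"
    have "(\<lambda>k. ennreal ((2 * sqrt x) ^ (2 * k) / fact (2 * k)) * G k) sums ennreal (pi powr m * exp (x * (norm b)\<^sup>2))"
      using s[of "sqrt x"] x by (simp add: sums_iff)
    moreover have "ennreal ((2 * sqrt x) ^ (2 * k) / fact (2 * k)) * G k = ennreal (4 ^ k / fact (2 * k) * g k * x ^ k)" for k
      using x g(1)[of k] by (simp add: g(2) ennreal_mult[symmetric] power_mult power_mult_distrib)
    ultimately show "(\<lambda>k. 4 ^ k / fact (2 * k) * g k * x ^ k) sums (pi powr m * exp (x * (norm b)\<^sup>2))"
      using g(1) x by (simp add: sums_ennreal)
    have "(\<lambda>k. pi powr m * ((x * (norm b)\<^sup>2) ^ k /\<^sub>R fact k)) sums (pi powr m * exp (x * (norm b)\<^sup>2))"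
      by (intro sums_mult exp_converges)
    then show "(\<lambda>k. pi powr m * (norm b) ^ (2 * k) / fact k * x ^ k) sums (pi powr m * exp (x * (norm b)\<^sup>2))"
      unfolding power_mult[of "norm b" 2] by (simp add: power_mult_distrib divide_inverse mult_ac)
  qed
  from fun_cong[OF this, of k] have "g k = pi powr m * (norm b) ^ (2 * k) * fact (2 * k) / (4 ^ k * fact k)"
    by (simp add: field_simps)
  then show ?thesis using g(2)[of k] unfolding G_def m_def by simp
qed

text \<open>Cut off at 0, so that \<open>cut_powr al (R - |y|^2)\<close> carries the ball of radius
  \<open>sqrt R\<close> in itself and integrals run over the whole space. Under positive scaling it
  is homogeneous of degree \<open>al - 1\<close>.\<close>

definition cut_powr :: "real \<Rightarrow> real \<Rightarrow> real" where
  "cut_powr al x = indicator {0<..} x * x powr (al - 1)"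

lemma cut_powr_measurable [measurable]: "cut_powr al \<in> borel_measurable borel"
  unfolding cut_powr_def by measurable

lemma cut_powr_nonneg: "cut_powr al x \<ge> 0"
  by (simp add: cut_powr_def)

lemma nn_integral_cut_powr:
  assumes "al > 0"
  shows "(\<integral>\<^sup>+x. ennreal (cut_powr al x * exp (- x)) \<partial>lborel) = ennreal (Gamma al)"
proof -
  have "(\<integral>\<^sup>+x. ennreal (cut_powr al x * exp (- x)) \<partial>lborel) = (\<integral>\<^sup>+x. ennreal (indicator {0<..} x *\<^sub>R (x powr (al - 1) * exp (- x))) \<partial>lborel)"
    by (simp add: cut_powr_def mult.assoc)
  also have "\<dots> = ennreal (Gamma al)"
    using Gamma_has_bochner_integral_real[OF assms] by (subst nn_integral_eq_integral) (auto simp: has_bochner_integral_iff)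
  finally show ?thesis .
qed

text \<open>By homogeneity the integral over the ball of radius \<open>sqrt R\<close> is a power of \<open>R\<close>; taking its
  Laplace transform at \<open>1\<close> in two ways turns the ball weight into a Gaussian.\<close>
lemma ball_moment:
  fixes b :: "real^'n::finite"
  assumes al: "al > 0"
  shows "(\<integral>\<^sup>+y. ennreal ((y \<bullet> b) ^ (2 * k) * cut_powr al (1 - (norm y)\<^sup>2)) \<partial>lborel) =
    ennreal (Gamma al / Gamma (al + real CARD('n) / 2 + k) *
      (pi powr (real CARD('n) / 2) * (norm b) ^ (2 * k) * fact (2 * k) / (4 ^ k * fact k)))"
proof -
  define m where "m = real CARD('n) / 2"
  define z where "z = al + m + k"
  have z: "z > 0" using al by (simp add: z_def m_def add_pos_nonneg)
  define h where "h R = (\<integral>\<^sup>+y. ennreal ((y \<bullet> b) ^ (2 * k) * cut_powr al (R - (norm y)\<^sup>2)) \<partial>lborel)" for R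
  \<comment> \<open>Rescaling y by \<open>sqrt R\<close> contributes \<open>R powr (n / 2)\<close>
    from the volume, \<open>R ^ k\<close> from the moment and \<open>R powr (al - 1)\<close> from
    the weight; together this is \<open>R powr (z - 1)\<close>.\<close>
  have hR: "h R = ennreal (cut_powr z R) * h 1" for R
  proof (cases "R > 0")
    case True
    let ?f = "\<lambda>y::real^'n. ennreal ((y \<bullet> b) ^ (2 * k) * cut_powr al (R - (norm y)\<^sup>2))"
    have "h R = ennreal (\<bar>sqrt R\<bar> ^ DIM(real^'n)) * (\<integral>\<^sup>+y. ?f (0 + sqrt R *\<^sub>R y) \<partial>lborel)"
      unfolding h_def by (rule lborel_nn_integral_affine) (use True in auto)
    also have "(\<integral>\<^sup>+y. ?f (0 + sqrt R *\<^sub>R y) \<partial>lborel) = (\<integral>\<^sup>+y. ennreal (R ^ k * R powr (al - 1)) * ennreal ((y \<bullet> b) ^ (2 * k) * cut_powr al (1 - (norm y)\<^sup>2)) \<partial>lborel)"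
    proof (intro nn_integral_cong)
      fix y :: "real^'n"
      have "R - (norm (sqrt R *\<^sub>R y))\<^sup>2 = R * (1 - (norm y)\<^sup>2)"
        using True by (simp add: power_mult_distrib algebra_simps)
      moreover have "cut_powr al (R * x) = R powr (al - 1) * cut_powr al x" for x
        using True by (auto simp: cut_powr_def indicator_def powr_mult zero_less_mult_iff)
      moreover have "((sqrt R *\<^sub>R y) \<bullet> b) ^ (2 * k) = R ^ k * (y \<bullet> b) ^ (2 * k)"
        using True by (simp add: power_mult_distrib power_mult)
      ultimately have "((0 + sqrt R *\<^sub>R y) \<bullet> b) ^ (2 * k) * cut_powr al (R - (norm (0 + sqrt R *\<^sub>R y))\<^sup>2) =
         (R ^ k * R powr (al - 1)) * ((y \<bullet> b) ^ (2 * k) * cut_powr al (1 - (norm y)\<^sup>2))"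
        by simp
      then show "?f (0 + sqrt R *\<^sub>R y) = ennreal (R ^ k * R powr (al - 1)) * ennreal ((y \<bullet> b) ^ (2 * k) * cut_powr al (1 - (norm y)\<^sup>2))"
      proof -
        assume eq: "((0 + sqrt R *\<^sub>R y) \<bullet> b) ^ (2 * k) * cut_powr al (R - (norm (0 + sqrt R *\<^sub>R y))\<^sup>2) =
          (R ^ k * R powr (al - 1)) * ((y \<bullet> b) ^ (2 * k) * cut_powr al (1 - (norm y)\<^sup>2))"
        have "0 \<le> (y \<bullet> b) ^ (2 * k) * cut_powr al (1 - (norm y)\<^sup>2)"
          by (intro mult_nonneg_nonneg cut_powr_nonneg) (simp add: power_mult)
        then show ?thesis unfolding eq using True by (intro ennreal_mult) auto
      qed
    qed
    also have "\<dots> = ennreal (R ^ k * R powr (al - 1)) * h 1"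
      unfolding h_def by (rule nn_integral_cmult) measurable
    also have "ennreal (\<bar>sqrt R\<bar> ^ DIM(real^'n)) * (ennreal (R ^ k * R powr (al - 1)) * h 1) = ennreal (cut_powr z R) * h 1"
    proof -
      have "\<bar>sqrt R\<bar> ^ DIM(real^'n) * (R ^ k * R powr (al - 1)) = cut_powr z R"
      proof -
        have "\<bar>sqrt R\<bar> ^ DIM(real^'n) = R powr m"
        proof -
          have "\<bar>sqrt R\<bar> ^ DIM(real^'n) = sqrt R ^ CARD('n)" using True by simp
          also have "\<dots> = (R powr (1/2)) powr real CARD('n)" using True by (simp add: powr_half_sqrt powr_realpow)
          also have "\<dots> = R powr m" by (simp add: powr_powr m_def)
          finally show ?thesis .
        qed
        moreover have "R ^ k = R powr real k" using True by (simp add: powr_realpow)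
        ultimately show ?thesis using True
          by (simp only: powr_add[symmetric] cut_powr_def z_def) (simp add: algebra_simps)
      qed
      then show ?thesis using True by (simp add: ennreal_mult[symmetric] mult.assoc[symmetric])
    qed
    finally show ?thesis .
  next
    case False
    have "R - (norm y)\<^sup>2 \<le> 0" for y :: "real^'n" using False zero_le_power2[of "norm y"] by linarith
    then have "cut_powr al (R - (norm y)\<^sup>2) = 0" for y :: "real^'n" by (auto simp: cut_powr_def indicator_def not_less)
    moreover have "cut_powr z R = 0" using False by (simp add: cut_powr_def)
    ultimately show ?thesis by (simp add: h_def)
  qed
  \<comment> \<open>The integral of \<open>exp (- R) * h R\<close> over R is evaluated twice: by
    homogeneity it is \<open>h 1 * Gamma z\<close>, and with R integrated first it is
    \<open>Gamma al\<close> times a Gaussian moment.\<close>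
  have "h 1 * ennreal (Gamma z) = (\<integral>\<^sup>+R. h 1 * ennreal (cut_powr z R * exp (- R)) \<partial>lborel)"
    unfolding nn_integral_cut_powr[OF z, symmetric] by (rule nn_integral_cmult[symmetric]) measurable
  also have "\<dots> = (\<integral>\<^sup>+R. ennreal (exp (- R)) * h R \<partial>lborel)"
    by (intro nn_integral_cong) (subst (2) hR, simp add: ennreal_mult cut_powr_nonneg mult_ac)
  also have "\<dots> = (\<integral>\<^sup>+R. (\<integral>\<^sup>+y. ennreal (exp (- R)) * ennreal ((y \<bullet> b) ^ (2 * k) * cut_powr al (R - (norm y)\<^sup>2)) \<partial>lborel) \<partial>lborel)"
    unfolding h_def by (intro nn_integral_cong nn_integral_cmult[symmetric]) measurable
  also have "\<dots> = (\<integral>\<^sup>+y. (\<integral>\<^sup>+R. ennreal (exp (- R)) * ennreal ((y \<bullet> b) ^ (2 * k) * cut_powr al (R - (norm y)\<^sup>2)) \<partial>lborel) \<partial>lborel)"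
    by (rule lborel_pair.Fubini') measurable
  also have "\<dots> = (\<integral>\<^sup>+y. ennreal (Gamma al) * ennreal ((y \<bullet> b) ^ (2 * k) * exp (- (norm y)\<^sup>2)) \<partial>lborel)"
  proof (intro nn_integral_cong)
    fix y :: "real^'n"
    \<comment> \<open>Shifting R by |y|^2 splits off the factor \<open>exp (- |y|^2)\<close> and
      leaves a Gamma integral in R.\<close>
    have "(\<integral>\<^sup>+R. ennreal (exp (- R)) * ennreal ((y \<bullet> b) ^ (2 * k) * cut_powr al (R - (norm y)\<^sup>2)) \<partial>lborel) =
       (\<integral>\<^sup>+R. ennreal (exp (- ((norm y)\<^sup>2 + 1 * R))) * ennreal ((y \<bullet> b) ^ (2 * k) * cut_powr al ((norm y)\<^sup>2 + 1 * R - (norm y)\<^sup>2)) \<partial>lborel)"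
      by (subst nn_integral_real_affine[where c=1 and t="(norm y)\<^sup>2"]) auto
    also have "\<dots> = (\<integral>\<^sup>+R. ennreal ((y \<bullet> b) ^ (2 * k) * exp (- (norm y)\<^sup>2)) * ennreal (cut_powr al R * exp (- R)) \<partial>lborel)"
    proof (intro nn_integral_cong)
      fix R :: real
      have "0 \<le> (y \<bullet> b) ^ (2 * k)" by (simp add: power_mult)
      moreover have "exp (- ((norm y)\<^sup>2 + 1 * R)) = exp (- (norm y)\<^sup>2) * exp (- R)"
        by (simp add: exp_add[symmetric])
      ultimately show "ennreal (exp (- ((norm y)\<^sup>2 + 1 * R))) * ennreal ((y \<bullet> b) ^ (2 * k) * cut_powr al ((norm y)\<^sup>2 + 1 * R - (norm y)\<^sup>2)) =
        ennreal ((y \<bullet> b) ^ (2 * k) * exp (- (norm y)\<^sup>2)) * ennreal (cut_powr al R * exp (- R))"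
        by (subst (1 2) ennreal_mult'[symmetric]) (simp_all add: mult_ac)
    qed
    also have "\<dots> = ennreal ((y \<bullet> b) ^ (2 * k) * exp (- (norm y)\<^sup>2)) * ennreal (Gamma al)"
      unfolding nn_integral_cut_powr[OF al, symmetric] by (rule nn_integral_cmult) measurable
    finally show "(\<integral>\<^sup>+R. ennreal (exp (- R)) * ennreal ((y \<bullet> b) ^ (2 * k) * cut_powr al (R - (norm y)\<^sup>2)) \<partial>lborel) =
      ennreal (Gamma al) * ennreal ((y \<bullet> b) ^ (2 * k) * exp (- (norm y)\<^sup>2))"
      by (simp add: mult.commute)
  qed
  also have "\<dots> = ennreal (Gamma al) * (\<integral>\<^sup>+y. ennreal ((y \<bullet> b) ^ (2 * k) * exp (- (norm y)\<^sup>2)) \<partial>lborel)"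
    by (rule nn_integral_cmult) measurable
  also have "\<dots> = ennreal (Gamma al * (pi powr m * (norm b) ^ (2 * k) * fact (2 * k) / (4 ^ k * fact k)))"
    unfolding gaussian_moment m_def using Gamma_real_pos[OF al] by (intro ennreal_mult'[symmetric]) simp
  finally have *: "h 1 * ennreal (Gamma z) = ennreal (Gamma al * (pi powr m * (norm b) ^ (2 * k) * fact (2 * k) / (4 ^ k * fact k)))" .
  have Gz: "Gamma z > 0" using z by simp
  have "h 1 = (h 1 * ennreal (Gamma z)) * ennreal (1 / Gamma z)"
    using Gz by (simp add: mult.assoc ennreal_mult[symmetric])
  also have "\<dots> = ennreal (Gamma al / Gamma z * (pi powr m * (norm b) ^ (2 * k) * fact (2 * k) / (4 ^ k * fact k)))"
    unfolding * using Gz al by (simp add: ennreal_mult[symmetric])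
  finally show ?thesis unfolding h_def z_def m_def .
qed

text \<open>After \<open>ball_moment\<close> the factor \<open>4 ^ k / fact (2 * k)\<close> of the
  \<open>cosh\<close> series cancels against \<open>fact (2 * k) / 4 ^ k\<close>. What remains,
  \<open>|b| ^ (2 * k) / (fact k * Gamma (k + beta + 1))\<close>, is the term of the series of
  \<open>besselI beta\<close> at \<open>2 * |b|\<close>, divided by
  \<open>|b| powr beta\<close>.\<close>

lemma ball_laplace_besselI:
  fixes b :: "real^'n::finite"
  assumes al: "al > 0" and b: "b \<noteq> 0"
  defines "beta \<equiv> al + real CARD('n) / 2 - 1"
  shows "(\<integral>\<^sup>+y. ennreal (exp (- 2 * (y \<bullet> b)) * cut_powr al (1 - (norm y)\<^sup>2)) \<partial>lborel) =
    ennreal (pi powr (real CARD('n) / 2) * Gamma al * 2 powr beta * (besselI beta (2 * norm b) / (2 * norm b) powr beta))"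
proof -
  define m where "m = real CARD('n) / 2"
  define a where "a k = pi powr m * Gamma al * ((norm b) ^ (2 * k) / (fact k * Gamma (real k + beta + 1)))" for k
  let ?w = "\<lambda>y::real^'n. cut_powr al (1 - (norm y)\<^sup>2)"
  let ?J = "\<integral>\<^sup>+y. ennreal (exp (- 2 * (y \<bullet> b)) * ?w y) \<partial>lborel"
  have bk: "real k + beta + 1 = al + m + k" for k by (simp add: beta_def m_def)
  have Gp: "Gamma (real k + beta + 1) > 0" for k
    unfolding bk using al by (intro Gamma_real_pos add_pos_nonneg) (auto simp: m_def)
  have a0: "a k \<ge> 0" for k
    unfolding a_def using al Gp[of k] by (intro mult_nonneg_nonneg divide_nonneg_nonneg) auto
  have J: "?J = (\<Sum>k. ennreal (a k))"
  proof -
    have "?J = (\<integral>\<^sup>+y. ennreal (exp (y \<bullet> ((- 2) *\<^sub>R b)) * ?w y) \<partial>lborel)"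
      by simp
    also have "\<dots> = (\<integral>\<^sup>+y. ennreal (cosh (y \<bullet> ((- 2) *\<^sub>R b)) * ?w y) \<partial>lborel)"
      by (rule nn_integral_even_cosh) (auto simp: cut_powr_nonneg)
    also have "\<dots> = (\<Sum>k. ennreal ((- 2) ^ (2 * k) / fact (2 * k)) * (\<integral>\<^sup>+y. ennreal ((y \<bullet> b) ^ (2 * k) * ?w y) \<partial>lborel))"
      by (rule nn_integral_cosh_series) (auto simp: cut_powr_nonneg)
    also have "\<dots> = (\<Sum>k. ennreal (a k))"
    proof (intro suminf_cong)
      fix k
      have Gp': "Gamma (al + real CARD('n) / 2 + real k) > 0" using Gp[of k] unfolding bk m_def .
      have "(- 2) ^ (2 * k) / fact (2 * k) * (Gamma al / Gamma (al + real CARD('n) / 2 + k) *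
          (pi powr (real CARD('n) / 2) * (norm b) ^ (2 * k) * fact (2 * k) / (4 ^ k * fact k))) = a k"
      proof -
        have "(- 2) ^ (2 * k) = (4 :: real) ^ k" by (simp add: power_mult)
        then show ?thesis unfolding a_def bk m_def by (simp add: mult_ac)
      qed
      then show "ennreal ((- 2) ^ (2 * k) / fact (2 * k)) * (\<integral>\<^sup>+y. ennreal ((y \<bullet> b) ^ (2 * k) * ?w y) \<partial>lborel) = ennreal (a k)"
        unfolding ball_moment[OF al] using Gp' al by (subst ennreal_mult[symmetric]) (auto simp: power_mult)
    qed
    finally show ?thesis .
  qed
  \<comment> \<open>Finiteness allows the extended sum to be read as the real sum in
    \<open>besselI\<close>. The exponential is bounded on the unit ball, and the moment with k = 0
    is the finite mass of the weight.\<close>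
  have "?J \<noteq> \<infinity>"
  proof -
    have "?J \<le> (\<integral>\<^sup>+y. ennreal (exp (2 * norm b)) * ennreal ((y \<bullet> b) ^ (2 * 0) * ?w y) \<partial>lborel)"
    proof (intro nn_integral_mono)
      fix y
      show "ennreal (exp (- 2 * (y \<bullet> b)) * ?w y) \<le> ennreal (exp (2 * norm b)) * ennreal ((y \<bullet> b) ^ (2 * 0) * ?w y)"
      proof (cases "norm y < 1")
        case True
        have "- (y \<bullet> b) \<le> norm y * norm b" using Cauchy_Schwarz_ineq2[of y b] by linarith
        also have "\<dots> \<le> norm b" using True by (simp add: mult_left_le_one_le)
        finally show ?thesis
          by (subst ennreal_mult[symmetric]) (auto simp: cut_powr_nonneg intro!: ennreal_leI mult_right_mono)
      next
        case False
        then have "1 - (norm y)\<^sup>2 \<le> 0" using one_le_power[of "norm y" 2] by simp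
        then show ?thesis by (simp add: cut_powr_def)
      qed
    qed
    also have "\<dots> = ennreal (exp (2 * norm b)) * (\<integral>\<^sup>+y. ennreal ((y \<bullet> b) ^ (2 * 0) * ?w y) \<partial>lborel)"
      by (rule nn_integral_cmult) measurable
    also have "\<dots> < \<infinity>" unfolding ball_moment[OF al] by (simp add: ennreal_mult_less_top)
    finally show ?thesis by simp
  qed
  then have sm: "summable a" unfolding J by (intro summable_suminf_not_top a0) auto
  have "?J = ennreal (\<Sum>k. a k)"
    unfolding J by (rule suminf_ennreal2[OF a0 sm])
  also have "(\<Sum>k. a k) = pi powr m * Gamma al * 2 powr beta * (besselI beta (2 * norm b) / (2 * norm b) powr beta)"
  proof -
    define C where "C = pi powr m * Gamma al / norm b powr beta"
    have nb: "norm b > 0" using b by simp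
    have "Gamma al \<noteq> 0" using Gamma_real_pos[OF al] by (metis less_irrefl)
    then have C: "C \<noteq> 0" using nb by (simp add: C_def)
    have ak: "a k = C * ((2 * norm b / 2) powr (2 * real k + beta) / (fact k * Gamma (real k + beta + 1)))" for k
    proof -
      have "norm b powr (2 * real k + beta) = norm b ^ (2 * k) * norm b powr beta"
        using nb by (simp add: powr_add powr_realpow[symmetric])
      then show ?thesis using nb by (simp add: a_def C_def)
    qed
    have "summable (\<lambda>k. (2 * norm b / 2) powr (2 * real k + beta) / (fact k * Gamma (real k + beta + 1)))"
    proof -
      have "summable (\<lambda>k. a k)" using sm .
      then show ?thesis using C unfolding ak summable_cmult_iff by blast
    qed
    then have "(\<Sum>k. a k) = C * besselI beta (2 * norm b)"
      unfolding ak besselI_def by (rule suminf_mult)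
    also have "\<dots> = pi powr m * Gamma al * 2 powr beta * (besselI beta (2 * norm b) / (2 * norm b) powr beta)"
      using nb by (simp add: C_def powr_mult)
    finally show ?thesis .
  qed
  finally show ?thesis unfolding m_def .
qed

section \<open>Integration over the tube\<close>

lemma cvec_measurable [measurable]: "(\<lambda>p. cvec (fst p) (snd p)) \<in> borel_measurable borel"
proof (rule borel_measurable_continuous_onI)
  have "continuous_on UNIV (\<lambda>p. \<chi> j. of_real (fst p $ j) + \<i> * of_real (snd p $ j) :: complex^'a)"
    by (intro continuous_intros)
  then show "continuous_on UNIV (\<lambda>p::(real^'a) \<times> (real^'a). cvec (fst p) (snd p))"
    by (simp add: cvec_def Complex_eq)
qed

text \<open>It suffices to compare volumes of boxes. As a real space \<open>complex^'n\<close> has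
  the basis vectors \<open>axis j 1\<close> and \<open>axis j \<i>\<close>, so a box is the product
  of a box in x and a box in y.\<close>

lemma lborel_cvec:
  "lborel = distr (lborel \<Otimes>\<^sub>M lborel) borel (\<lambda>p. cvec (fst p) (snd p) :: complex^'n::finite)"
proof (rule lborel_eqI)
  have meas: "(\<lambda>p. cvec (fst p) (snd p) :: complex^'n) \<in> measurable (lborel \<Otimes>\<^sub>M lborel) borel"
    using cvec_measurable by (simp add: borel_prod measurable_cong_sets[OF sets_pair_measure_cong[OF sets_lborel sets_lborel] refl])
  fix l u :: "complex^'n"
  assume le: "\<And>b. b \<in> Basis \<Longrightarrow> l \<bullet> b \<le> u \<bullet> b"
  define re where "re z = (\<chi> j. Re (z$j))" for z :: "complex^'n"
  define im where "im z = (\<chi> j. Im (z$j))" for z :: "complex^'n"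
  have B: "(Basis :: (complex^'n) set) = (\<lambda>j. axis j 1) ` UNIV \<union> (\<lambda>j. axis j \<i>) ` UNIV"
    by (auto simp: Basis_vec_def Basis_complex_def)
  have BR: "(Basis :: (real^'n) set) = (\<lambda>j. axis j 1) ` UNIV"
    by (auto simp: Basis_vec_def)
  have ine: "z \<bullet> axis j 1 = Re (z$j)" "z \<bullet> axis j \<i> = Im (z$j)" for z :: "complex^'n" and j
    by (simp_all add: inner_axis inner_complex_def)
  have iner: "x \<bullet> axis j 1 = x$j" for x :: "real^'n" and j
    by (simp add: inner_axis)
  have pre: "(\<lambda>p. cvec (fst p) (snd p)) -` box l u = box (re l) (re u) \<times> box (im l) (im u)"
    by (auto simp: mem_box B BR ine iner re_def im_def cvec_def ball_Un)
  have "emeasure (distr (lborel \<Otimes>\<^sub>M lborel) borel (\<lambda>p. cvec (fst p) (snd p))) (box l u) =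
      emeasure (lborel \<Otimes>\<^sub>M lborel) (box (re l) (re u) \<times> box (im l) (im u))"
    by (subst emeasure_distr[OF meas]) (auto simp: pre space_pair_measure)
  also have "\<dots> = emeasure lborel (box (re l) (re u)) * emeasure lborel (box (im l) (im u))"
    by (rule lborel.emeasure_pair_measure_Times) auto
  also have "\<dots> = ennreal (\<Prod>b\<in>Basis. (re u - re l) \<bullet> b) * ennreal (\<Prod>b\<in>Basis. (im u - im l) \<bullet> b)"
  proof -
    have "\<And>b. b \<in> Basis \<Longrightarrow> re l \<bullet> b \<le> re u \<bullet> b" "\<And>b. b \<in> Basis \<Longrightarrow> im l \<bullet> b \<le> im u \<bullet> b"
      using le by (auto simp: B BR ine iner re_def im_def ball_Un)
        (metis UnI1 UnI2 ine range_eqI)+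
    then show ?thesis by (simp add: emeasure_lborel_box)
  qed
  also have "\<dots> = ennreal ((\<Prod>b\<in>Basis. (re u - re l) \<bullet> b) * (\<Prod>b\<in>Basis. (im u - im l) \<bullet> b))"
  proof (rule ennreal_mult[symmetric])
    have "Re (l$j) \<le> Re (u$j)" "Im (l$j) \<le> Im (u$j)" for j
      using le[of "axis j 1"] le[of "axis j \<i>"] by (auto simp: B ine)
    then show "(\<Prod>b\<in>Basis. (re u - re l) \<bullet> b) \<ge> 0" "(\<Prod>b\<in>Basis. (im u - im l) \<bullet> b) \<ge> 0"
      by (auto intro!: prod_nonneg simp: BR iner re_def im_def)
  qed
  also have "(\<Prod>b\<in>Basis. (re u - re l) \<bullet> b) * (\<Prod>b\<in>Basis. (im u - im l) \<bullet> b) = (\<Prod>b\<in>Basis. (u - l) \<bullet> b)"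
  proof -
    have i1: "inj (\<lambda>j::'n. axis j (1::complex))" "inj (\<lambda>j::'n. axis j \<i>)" "inj (\<lambda>j::'n. axis j (1::real))"
      by (auto simp: inj_def axis_eq_axis)
    have d: "(\<lambda>j::'n. axis j (1::complex)) ` UNIV \<inter> (\<lambda>j. axis j \<i>) ` UNIV = {}"
      by (auto simp: axis_eq_axis)
    show ?thesis
      unfolding B BR using d by (subst prod.union_disjoint) (auto simp: prod.reindex i1 ine iner re_def im_def)
  qed
  finally show "emeasure (distr (lborel \<Otimes>\<^sub>M lborel) borel (\<lambda>p. cvec (fst p) (snd p))) (box l u) = (\<Prod>b\<in>Basis. (u - l) \<bullet> b)" .
qed simp

lemma nn_integral_lborel_cvec:
  fixes F :: "complex^'n::finite \<Rightarrow> ennreal"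
  assumes [measurable]: "F \<in> borel_measurable borel"
  shows "(\<integral>\<^sup>+z. F z \<partial>lborel) = (\<integral>\<^sup>+y. (\<integral>\<^sup>+x. F (cvec x y) \<partial>lborel) \<partial>lborel)"
proof -
  have meas [measurable]: "(\<lambda>p. cvec (fst p) (snd p) :: complex^'n) \<in> measurable (lborel \<Otimes>\<^sub>M lborel) borel"
    using cvec_measurable by (simp add: borel_prod measurable_cong_sets[OF sets_pair_measure_cong[OF sets_lborel sets_lborel] refl])
  have "(\<integral>\<^sup>+z. F z \<partial>lborel) = (\<integral>\<^sup>+p. F (cvec (fst p) (snd p)) \<partial>(lborel \<Otimes>\<^sub>M lborel))"
    by (subst lborel_cvec) (simp add: nn_integral_distr)
  also have "\<dots> = (\<integral>\<^sup>+x. (\<integral>\<^sup>+y. F (cvec (fst (x, y)) (snd (x, y))) \<partial>lborel) \<partial>lborel)"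
    by (rule lborel.nn_integral_fst[symmetric]) measurable
  also have "\<dots> = (\<integral>\<^sup>+y. (\<integral>\<^sup>+x. F (cvec (fst (x, y)) (snd (x, y))) \<partial>lborel) \<partial>lborel)"
    by (rule lborel_pair.Fubini') measurable
  finally show ?thesis by simp
qed

section \<open>Borel measurability of the kernel and of the transform\<close>

lemma borel_measurable_complex_Ln [measurable]: "Ln \<in> borel_measurable borel"
proof -
  have 1: "(\<lambda>z. indicator (- \<real>\<^sub>\<le>\<^sub>0) z *\<^sub>R Ln z) \<in> borel_measurable borel"
    by (intro borel_measurable_continuous_on_indicator continuous_intros) auto
  \<comment> \<open>On the branch cut continuity fails, but there \<open>Ln z\<close> equals
    \<open>ln |z| + \<i> * pi\<close>; the point 0 is treated separately.\<close>
  have 2: "(\<lambda>z. indicator \<real>\<^sub>\<le>\<^sub>0 z *\<^sub>R (if z = 0 then Ln 0 else of_real (ln (cmod z)) + \<i> * of_real pi)) \<in> borel_measurable borel"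
    by measurable
  have "Ln = (\<lambda>z. indicator (- \<real>\<^sub>\<le>\<^sub>0) z *\<^sub>R Ln z + indicator \<real>\<^sub>\<le>\<^sub>0 z *\<^sub>R (if z = 0 then Ln 0 else of_real (ln (cmod z)) + \<i> * of_real pi))"
  proof
    fix z :: complex
    show "Ln z = indicator (- \<real>\<^sub>\<le>\<^sub>0) z *\<^sub>R Ln z + indicator \<real>\<^sub>\<le>\<^sub>0 z *\<^sub>R (if z = 0 then Ln 0 else of_real (ln (cmod z)) + \<i> * of_real pi)"
    proof (cases "z \<in> \<real>\<^sub>\<le>\<^sub>0 \<and> z \<noteq> 0")
      case True
      then obtain r where r: "z = of_real r" "r < 0"
        by (auto elim!: nonpos_Reals_cases)
      then show ?thesis by (simp add: Ln_of_real' )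
    qed auto
  qed
  then show ?thesis by (rule ssubst) (rule borel_measurable_add[OF 1 2])
qed

lemma poisson_ext_measurable:
  "(\<lambda>p. poisson_ext lam (fst p) (snd p) a) \<in> borel_measurable (borel :: ((complex^'n::finite) \<times> (real^'n)) measure)"
proof -
  have "continuous_on UNIV (\<lambda>p::((complex^'n) \<times> (real^'n)). csq (fst p) (snd p))"
    unfolding csq_def by (intro continuous_intros)
  then have [measurable]: "(\<lambda>p::((complex^'n) \<times> (real^'n)). csq (fst p) (snd p)) \<in> borel_measurable borel"
    by (rule borel_measurable_continuous_onI)
  show ?thesis unfolding poisson_ext_def Let_def powr_def by measurable
qed

lemma poisson_transform_measurable:
  fixes f :: "real^'n::finite \<Rightarrow> complex"
  assumes f [measurable]: "f \<in> borel_measurable borel"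
  shows "(\<lambda>z. poisson_transform lam f z a) \<in> borel_measurable borel"
proof -
  have m [measurable]: "(\<lambda>p. poisson_ext lam (fst p) (snd p) a) \<in> borel_measurable (borel \<Otimes>\<^sub>M (borel :: (real^'n) measure))"
    using poisson_ext_measurable by (simp add: borel_prod)
  have "(\<lambda>u. poisson_ext lam z u a) \<in> borel_measurable borel" for z :: "complex^'n"
    using measurable_compose_Pair1[OF _ m, of z] by simp
  then have eq: "poisson_transform lam f z a = (\<integral>u. f u * poisson_ext lam z u a \<partial>lborel)" for z
    unfolding poisson_transform_def by (intro integral_completion) auto
  have "(\<lambda>(z, u). f u * poisson_ext lam z u a) \<in> borel_measurable (borel \<Otimes>\<^sub>M lborel)"
    using m by (simp add: split_beta' measurable_cong_sets[OF sets_pair_measure_cong[OF refl sets_lborel] refl])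
  then show ?thesis unfolding eq by (rule lborel.borel_measurable_lebesgue_integral)
qed

lemma completion_ex_borel_measurable_complex:
  fixes g :: "'a \<Rightarrow> complex"
  assumes g: "g \<in> borel_measurable (completion M)"
  shows "\<exists>g'\<in>borel_measurable M. (AE x in M. g x = g' x)"
proof -
  have "(\<lambda>x. Re (g x)) \<in> borel_measurable (completion M)" "(\<lambda>x. Im (g x)) \<in> borel_measurable (completion M)"
    using g by measurable
  from this[THEN completion_ex_borel_measurable_real]
  obtain r i where [measurable]: "r \<in> borel_measurable M" "i \<in> borel_measurable M"
    and ae: "AE x in M. Re (g x) = r x" "AE x in M. Im (g x) = i x" by blast
  have "(\<lambda>x. of_real (r x) + \<i> * of_real (i x)) \<in> borel_measurable M" by measurable
  moreover have "AE x in M. g x = of_real (r x) + \<i> * of_real (i x)"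
    using ae by eventually_elim (simp add: complex_eq_iff)
  ultimately show ?thesis by (intro bexI)
qed

text \<open>Scaling y by a gives \<open>a ^ n\<close> and moves the factor a to the frequency. The
  constants \<open>(2 * pi) powr (- n / 2) / Gamma al\<close> and
  \<open>pi powr (n / 2) * Gamma al\<close> leave \<open>2 powr (- n / 2)\<close>, which joins the
  factor \<open>2 powr beta\<close>.\<close>

lemma nn_integral_tube_weight:
  fixes \<xi> :: "real^'n::finite"
  assumes al: "al > 0" and a: "a > 0" and xi: "\<xi> \<noteq> 0"
  defines "beta \<equiv> al + real CARD('n) / 2 - 1"
  shows "(\<integral>\<^sup>+y. ennreal (exp (- 2 * (y \<bullet> \<xi>)) * ((2 * pi) powr (- real CARD('n) / 2) / Gamma al * cut_powr al (1 - (norm y)\<^sup>2 / a\<^sup>2))) \<partial>lborel) =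
    ennreal (2 powr (beta - real CARD('n) / 2) * a ^ CARD('n) * (besselI beta (2 * norm (a *\<^sub>R \<xi>)) / (2 * norm (a *\<^sub>R \<xi>)) powr beta))"
proof -
  define m where "m = real CARD('n) / 2"
  define k where "k = (2 * pi) powr (- m) / Gamma al"
  have G: "Gamma al > 0" using al by (rule Gamma_real_pos)
  have k: "k \<ge> 0" using G by (simp add: k_def)
  let ?f = "\<lambda>y::real^'n. ennreal (exp (- 2 * (y \<bullet> \<xi>)) * (k * cut_powr al (1 - (norm y)\<^sup>2 / a\<^sup>2)))"
  let ?I = "besselI beta (2 * norm (a *\<^sub>R \<xi>)) / (2 * norm (a *\<^sub>R \<xi>)) powr beta"
  have "(\<integral>\<^sup>+y. ?f y \<partial>lborel) = ennreal (\<bar>a\<bar> ^ DIM(real^'n)) * (\<integral>\<^sup>+y. ?f (0 + a *\<^sub>R y) \<partial>lborel)"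
    by (rule lborel_nn_integral_affine) (use a in auto)
  also have "(\<integral>\<^sup>+y. ?f (0 + a *\<^sub>R y) \<partial>lborel) = (\<integral>\<^sup>+y. ennreal k * ennreal (exp (- 2 * (y \<bullet> (a *\<^sub>R \<xi>))) * cut_powr al (1 - (norm y)\<^sup>2)) \<partial>lborel)"
    by (intro nn_integral_cong, subst ennreal_mult'[symmetric, OF k]) (use a in \<open>simp add: power_mult_distrib mult_ac\<close>)
  also have "\<dots> = ennreal k * (\<integral>\<^sup>+y. ennreal (exp (- 2 * (y \<bullet> (a *\<^sub>R \<xi>))) * cut_powr al (1 - (norm y)\<^sup>2)) \<partial>lborel)"
    by (rule nn_integral_cmult) measurable
  also have "(\<integral>\<^sup>+y. ennreal (exp (- 2 * (y \<bullet> (a *\<^sub>R \<xi>))) * cut_powr al (1 - (norm y)\<^sup>2)) \<partial>lborel) =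
      ennreal (pi powr m * Gamma al * 2 powr beta * ?I)"
    unfolding m_def beta_def by (rule ball_laplace_besselI[OF al]) (use a xi in simp)
  also have "ennreal (\<bar>a\<bar> ^ DIM(real^'n)) * (ennreal k * ennreal (pi powr m * Gamma al * 2 powr beta * ?I)) =
     ennreal (a ^ CARD('n) * (k * (pi powr m * Gamma al * 2 powr beta * ?I)))"
  proof -
    have "ennreal (a ^ CARD('n)) * (ennreal k * ennreal Q) = ennreal (a ^ CARD('n) * (k * Q))" for Q
      using a k by (simp add: ennreal_mult')
    moreover have "\<bar>a\<bar> ^ DIM(real^'n) = a ^ CARD('n)" using a by simp
    ultimately show ?thesis by (simp only:)
  qed
  also have "a ^ CARD('n) * (k * (pi powr m * Gamma al * 2 powr beta * ?I)) = 2 powr (beta - m) * a ^ CARD('n) * ?I"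
  proof -
    have "k * (pi powr m * Gamma al) = 2 powr (- m)"
      using G by (simp add: k_def powr_mult powr_minus field_simps)
    moreover have "2 powr (beta - m) = 2 powr (- m) * 2 powr beta"
      by (simp add: powr_add[symmetric])
    moreover have "a ^ CARD('n) * (k * (pi powr m * Gamma al * 2 powr beta * ?I)) = k * (pi powr m * Gamma al) * 2 powr beta * a ^ CARD('n) * ?I"
      by (simp only: mult_ac)
    ultimately show ?thesis by (simp only:)
  qed
  finally show ?thesis unfolding k_def m_def by simp
qed

section \<open>Collecting the constants and the identity over the tube\<close>

lemma norm_damped_subord_sq:
  "(cmod (damped_subord lam a y \<xi>))\<^sup>2 = exp (- 2 * (y \<bullet> \<xi>)) * (cmod (subord lam a (norm \<xi>)))\<^sup>2"
  by (simp add: damped_subord_def norm_mult power_mult_distrib exp_double[symmetric])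

text \<open>The constant in the slice identity times the one produced by the \<open>y\<close>-integration.\<close>
lemma tube_constant:
  assumes lam: "Re lam > 0" and a: "a > 0" and n: "m = real n / 2"
  shows "(cmod (poisson_const lam m a))\<^sup>2 * (2 * pi) ^ (2 * n) * (4 * (2 * a\<^sup>2) powr (- 2 * Re lam) * (2 powr b * a ^ n)) =
    ((pi powr (- m) * (4 * pi) powr (- m))\<^sup>2 / (cmod (Gamma (2 * lam)))\<^sup>2 * (2 * pi) ^ (2 * n) * 4 * 2 powr (- 2 * Re lam) * 2 powr b) *
      a powr (- 2 * Re lam + 2 * real n)"
proof -
  have "(cmod (poisson_const lam m a))\<^sup>2 = (pi powr (- m) * (4 * pi) powr (- m))\<^sup>2 / (cmod (Gamma (2 * lam)))\<^sup>2 * a powr (2 * Re lam + real n)"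
  proof -
    have "(a powr (Re lam + m))\<^sup>2 = a powr (2 * Re lam + real n)"
      by (simp add: power2_eq_square powr_add[symmetric] n)
    then show ?thesis
      using a by (simp add: poisson_const_def norm_mult norm_divide norm_powr_real_powr power_mult_distrib power_divide)
  qed
  moreover have "(2 * a\<^sup>2) powr (- 2 * Re lam) = 2 powr (- 2 * Re lam) * a powr (- 4 * Re lam)"
  proof -
    have "(a\<^sup>2) powr (- 2 * Re lam) = (a powr 2) powr (- 2 * Re lam)" using a by simp
    also have "\<dots> = a powr (- 4 * Re lam)" by (simp only: powr_powr) simp
    finally show ?thesis by (simp add: powr_mult)
  qed
  moreover have "a ^ n = a powr real n" using a by (simp add: powr_realpow)
  \<comment> \<open>The exponents add up as
    \<open>(2 * Re lam + n) - 4 * Re lam + n\<close>.\<close>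
  moreover have "a powr (- 2 * Re lam + 2 * real n) = a powr (2 * Re lam + real n) * a powr (- 4 * Re lam) * a powr real n"
    by (simp add: powr_add[symmetric])
  ultimately show ?thesis by (simp only: mult_ac times_divide_eq_left times_divide_eq_right)
qed

lemma poisson_tube_identity:
  fixes f g :: "real^'n::finite \<Rightarrow> complex"
  assumes al: "al > 0" and lam: "Re lam > 0" and a: "a > 0"
    and f [measurable]: "f \<in> borel_measurable borel" and f2: "integrable lborel (\<lambda>x. (cmod (f x))\<^sup>2)"
    and g [measurable]: "g \<in> borel_measurable borel"
    and lim: "(\<lambda>k. \<integral>\<^sup>+\<xi>. ennreal ((cmod (g \<xi> - of_real ((2 * pi) powr (- real CARD('n) / 2)) * fourier_int (\<lambda>x. indicator (cball 0 (real k)) x * f x) \<xi>))\<^sup>2) \<partial>lborel) \<longlonglongrightarrow> 0"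
  shows "(\<integral>\<^sup>+ z \<in> (tube a :: (complex^'n) set). ennreal ((cmod (poisson_transform lam f z a))\<^sup>2 * tube_weight al a z) \<partial>lborel) =
    ennreal ((cmod (poisson_const lam (real CARD('n) / 2) a))\<^sup>2 * (2 * pi) ^ (2 * CARD('n)) *
      (4 * (2 * a\<^sup>2) powr (- 2 * Re lam) * (2 powr (al - 1) * a ^ CARD('n)))) *
      (\<integral>\<^sup>+\<xi>. ennreal ((cmod (g \<xi>))\<^sup>2 * freq_weight al lam (a *\<^sub>R \<xi>)) \<partial>lborel)"
proof -
  define m where "m = real CARD('n) / 2"
  define K where "K = (cmod (poisson_const lam (real CARD('n) / 2) a))\<^sup>2 * (2 * pi) ^ (2 * CARD('n))"
  define k where "k = 4 * (2 * a\<^sup>2) powr (- 2 * Re lam) * (2 powr (al - 1) * a ^ CARD('n))"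
  have K: "K \<ge> 0" by (simp add: K_def)
  have k: "k > 0" using a by (simp add: k_def)
  define wt where "wt y = (2 * pi) powr (- real CARD('n) / 2) / Gamma al * cut_powr al (1 - (norm y)\<^sup>2 / a\<^sup>2)" for y :: "real^'n"
  have wt_meas [measurable]: "wt \<in> borel_measurable borel" unfolding wt_def by measurable
  have wt: "wt y \<ge> 0" for y using Gamma_real_pos[OF al] by (simp add: wt_def cut_powr_nonneg)
  have wt0: "wt y = 0" if "\<not> norm y < a" for y
  proof -
    have "a\<^sup>2 \<le> (norm y)\<^sup>2" using that a by (intro power_mono) auto
    then have "1 - (norm y)\<^sup>2 / a\<^sup>2 \<le> 0" using a by simp
    then show ?thesis by (simp add: wt_def cut_powr_def)
  qed
  define q where "q \<xi> = (cmod (subord lam a (norm \<xi>)))\<^sup>2 * (cmod (g \<xi>))\<^sup>2" for \<xi> :: "real^'n"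
  have q_meas [measurable]: "q \<in> borel_measurable borel"
    unfolding q_def using subord_measurable[OF lam a, of norm borel] by measurable
  have [measurable]: "(\<lambda>z. poisson_transform lam f z a) \<in> borel_measurable borel"
    by (rule poisson_transform_measurable[OF f])
  have [measurable]: "im_part \<in> borel_measurable (borel :: (complex^'n) measure)"
    unfolding im_part_def[abs_def] by (intro borel_measurable_continuous_onI continuous_intros)
  \<comment> \<open>\<open>wt\<close> vanishes for |y| \<ge> a, so the restriction to the tube is
    absorbed by the weight and Tonelli can be applied on the whole space.\<close>
  have tw: "ennreal ((cmod (poisson_transform lam f z a))\<^sup>2 * tube_weight al a z) * indicator (tube a) z =
      ennreal ((cmod (poisson_transform lam f z a))\<^sup>2) * ennreal (wt (im_part z))" for z
  proof (cases "z \<in> tube a")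
    case True
    then have "norm (im_part z) < a" by (simp add: tube_def)
    then have "(norm (im_part z))\<^sup>2 < a\<^sup>2" by (intro power_strict_mono) auto
    then have "1 - (norm (im_part z))\<^sup>2 / a\<^sup>2 > 0" using a by simp
    then have "tube_weight al a z = wt (im_part z)" by (simp add: tube_weight_def wt_def cut_powr_def)
    then show ?thesis using True by (simp add: ennreal_mult')
  next
    case False
    then show ?thesis using wt0[of "im_part z"] by (simp add: tube_def)
  qed
  have [measurable]: "(\<lambda>x. cvec x y) \<in> borel_measurable borel" for y :: "real^'n"
  proof -
    have "(\<lambda>x. (x, y)) \<in> measurable borel (borel :: ((real^'n) \<times> (real^'n)) measure)"
      by (intro borel_measurable_continuous_onI continuous_intros)
    from measurable_compose[OF this cvec_measurable] show ?thesis by simp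
  qed
  have meas_x: "(\<lambda>x. poisson_transform lam f (cvec x y) a) \<in> borel_measurable borel" for y
    by measurable
  define M where "M \<xi> = (\<integral>\<^sup>+y. ennreal (q \<xi>) * ennreal (exp (- 2 * (y \<bullet> \<xi>)) * wt y) \<partial>lborel)" for \<xi>
  have [measurable]: "M \<in> borel_measurable borel" unfolding M_def by measurable
  have "(\<integral>\<^sup>+ z \<in> (tube a :: (complex^'n) set). ennreal ((cmod (poisson_transform lam f z a))\<^sup>2 * tube_weight al a z) \<partial>lborel) =
     (\<integral>\<^sup>+y. (\<integral>\<^sup>+x. ennreal ((cmod (poisson_transform lam f (cvec x y) a))\<^sup>2) * ennreal (wt y) \<partial>lborel) \<partial>lborel)"
    unfolding tw by (subst nn_integral_lborel_cvec) auto
  also have "\<dots> = (\<integral>\<^sup>+y. (\<integral>\<^sup>+\<xi>. ennreal K * (ennreal (q \<xi>) * ennreal (exp (- 2 * (y \<bullet> \<xi>)) * wt y)) \<partial>lborel) \<partial>lborel)"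
  proof (rule nn_integral_cong)
    fix y :: "real^'n"
    show "(\<integral>\<^sup>+x. ennreal ((cmod (poisson_transform lam f (cvec x y) a))\<^sup>2) * ennreal (wt y) \<partial>lborel) =
       (\<integral>\<^sup>+\<xi>. ennreal K * (ennreal (q \<xi>) * ennreal (exp (- 2 * (y \<bullet> \<xi>)) * wt y)) \<partial>lborel)"
    proof (cases "norm y < a")
      case True
      have [measurable]: "damped_subord lam a y \<in> borel_measurable borel"
        by (rule borel_measurable_continuous_onI[OF damped_subord_continuous[OF lam a]])
      have "(\<integral>\<^sup>+x. ennreal ((cmod (poisson_transform lam f (cvec x y) a))\<^sup>2) * ennreal (wt y) \<partial>lborel) =
         (\<integral>\<^sup>+x. ennreal ((cmod (poisson_transform lam f (cvec x y) a))\<^sup>2) \<partial>lborel) * ennreal (wt y)"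
        by (rule nn_integral_multc) measurable
      also have "\<dots> = ennreal K * (\<integral>\<^sup>+\<xi>. ennreal ((cmod (damped_subord lam a y \<xi>))\<^sup>2 * (cmod (g \<xi>))\<^sup>2) \<partial>lborel) * ennreal (wt y)"
        unfolding poisson_slice_L2[OF lam True f f2 g lim meas_x] K_def ..
      also have "\<dots> = (\<integral>\<^sup>+\<xi>. ennreal K * ennreal ((cmod (damped_subord lam a y \<xi>))\<^sup>2 * (cmod (g \<xi>))\<^sup>2) * ennreal (wt y) \<partial>lborel)"
      proof -
        have "(\<integral>\<^sup>+\<xi>. ennreal K * ennreal ((cmod (damped_subord lam a y \<xi>))\<^sup>2 * (cmod (g \<xi>))\<^sup>2) * ennreal (wt y) \<partial>lborel) =
            (\<integral>\<^sup>+\<xi>. ennreal K * ennreal ((cmod (damped_subord lam a y \<xi>))\<^sup>2 * (cmod (g \<xi>))\<^sup>2) \<partial>lborel) * ennreal (wt y)"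
          by (rule nn_integral_multc) measurable
        also have "(\<integral>\<^sup>+\<xi>. ennreal K * ennreal ((cmod (damped_subord lam a y \<xi>))\<^sup>2 * (cmod (g \<xi>))\<^sup>2) \<partial>lborel) =
            ennreal K * (\<integral>\<^sup>+\<xi>. ennreal ((cmod (damped_subord lam a y \<xi>))\<^sup>2 * (cmod (g \<xi>))\<^sup>2) \<partial>lborel)"
          by (rule nn_integral_cmult) measurable
        finally show ?thesis ..
      qed
      also have "\<dots> = (\<integral>\<^sup>+\<xi>. ennreal K * (ennreal (q \<xi>) * ennreal (exp (- 2 * (y \<bullet> \<xi>)) * wt y)) \<partial>lborel)"
        by (intro nn_integral_cong) (simp add: norm_damped_subord_sq q_def ennreal_mult wt mult_ac)
      finally show ?thesis .
    qed (simp add: wt0)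
  qed
  also have "\<dots> = (\<integral>\<^sup>+\<xi>. (\<integral>\<^sup>+y. ennreal K * (ennreal (q \<xi>) * ennreal (exp (- 2 * (y \<bullet> \<xi>)) * wt y)) \<partial>lborel) \<partial>lborel)"
    by (rule lborel_pair.Fubini') measurable
  also have "\<dots> = (\<integral>\<^sup>+\<xi>. ennreal K * M \<xi> \<partial>lborel)"
    unfolding M_def by (intro nn_integral_cong nn_integral_cmult) measurable
  also have "\<dots> = ennreal K * (\<integral>\<^sup>+\<xi>. M \<xi> \<partial>lborel)"
    by (rule nn_integral_cmult) measurable
  also have "(\<integral>\<^sup>+\<xi>. M \<xi> \<partial>lborel) = ennreal k * (\<integral>\<^sup>+\<xi>. ennreal ((cmod (g \<xi>))\<^sup>2 * freq_weight al lam (a *\<^sub>R \<xi>)) \<partial>lborel)"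
  proof -
    \<comment> \<open>The formulas in terms of K and I are applied off the origin; the omitted point
      is a null set.\<close>
    have Mk: "M \<xi> = ennreal k * ennreal ((cmod (g \<xi>))\<^sup>2 * freq_weight al lam (a *\<^sub>R \<xi>))" if xi: "\<xi> \<noteq> 0" for \<xi>
    proof -
      define beta where "beta = al + real CARD('n) / 2 - 1"
      define I where "I = besselI beta (2 * norm (a *\<^sub>R \<xi>)) / (2 * norm (a *\<^sub>R \<xi>)) powr beta"
      define S where "S = (a * norm \<xi>) powr (2 * Re lam) * (cmod (besselK lam (a * norm \<xi>)))\<^sup>2"
      have bm: "beta - real CARD('n) / 2 = al - 1" by (simp add: beta_def)
      have fw: "freq_weight al lam (a *\<^sub>R \<xi>) = S * I"
        using a by (simp add: freq_weight_def Let_def S_def I_def beta_def)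
      have qS: "q \<xi> = 4 * (2 * a\<^sup>2) powr (- 2 * Re lam) * S * (cmod (g \<xi>))\<^sup>2"
        unfolding q_def S_def using norm_subord_sq[OF lam a, of "norm \<xi>"] xi by simp
      have "M \<xi> = ennreal (q \<xi>) * (\<integral>\<^sup>+y. ennreal (exp (- 2 * (y \<bullet> \<xi>)) * wt y) \<partial>lborel)"
        unfolding M_def by (rule nn_integral_cmult) measurable
      also have "(\<integral>\<^sup>+y. ennreal (exp (- 2 * (y \<bullet> \<xi>)) * wt y) \<partial>lborel) = ennreal (2 powr (al - 1) * a ^ CARD('n) * I)"
        using nn_integral_tube_weight[OF al a xi] unfolding wt_def beta_def[symmetric] bm I_def .
      also have "ennreal (q \<xi>) * \<dots> = ennreal (q \<xi> * (2 powr (al - 1) * a ^ CARD('n) * I))"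
        by (rule ennreal_mult'[symmetric]) (simp add: q_def)
      also have "q \<xi> * (2 powr (al - 1) * a ^ CARD('n) * I) = k * ((cmod (g \<xi>))\<^sup>2 * freq_weight al lam (a *\<^sub>R \<xi>))"
        unfolding fw qS k_def by (simp only: mult_ac)
      finally show ?thesis using k by (simp add: ennreal_mult')
    qed
    \<comment> \<open>Solved for the frequency integrand, the relation shows that it agrees almost
      everywhere with a multiple of the Borel function \<open>M\<close>, from whose integral the
      constant \<open>1 / k\<close> can be pulled out.\<close>
    have fM: "ennreal ((cmod (g \<xi>))\<^sup>2 * freq_weight al lam (a *\<^sub>R \<xi>)) = ennreal (1 / k) * M \<xi>" if "\<xi> \<noteq> 0" for \<xi>
      unfolding Mk[OF that] mult.assoc[symmetric] using k by (simp add: ennreal_mult[symmetric])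
    have "(\<integral>\<^sup>+\<xi>. ennreal ((cmod (g \<xi>))\<^sup>2 * freq_weight al lam (a *\<^sub>R \<xi>)) \<partial>lborel) = (\<integral>\<^sup>+\<xi>. ennreal (1 / k) * M \<xi> \<partial>lborel)"
    proof (rule nn_integral_cong_AE)
      show "AE \<xi> in lborel. ennreal ((cmod (g \<xi>))\<^sup>2 * freq_weight al lam (a *\<^sub>R \<xi>)) = ennreal (1 / k) * M \<xi>"
        using AE_lborel_singleton[of 0] by eventually_elim (rule fM)
    qed
    also have "\<dots> = ennreal (1 / k) * (\<integral>\<^sup>+\<xi>. M \<xi> \<partial>lborel)"
      by (rule nn_integral_cmult) measurable
    finally show ?thesis using k by (simp add: mult.assoc[symmetric] ennreal_mult[symmetric])
  qed
  also have "ennreal K * (ennreal k * (\<integral>\<^sup>+\<xi>. ennreal ((cmod (g \<xi>))\<^sup>2 * freq_weight al lam (a *\<^sub>R \<xi>)) \<partial>lborel)) =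
     ennreal (K * k) * (\<integral>\<^sup>+\<xi>. ennreal ((cmod (g \<xi>))\<^sup>2 * freq_weight al lam (a *\<^sub>R \<xi>)) \<partial>lborel)"
    using K k by (simp add: ennreal_mult mult.assoc)
  finally show ?thesis unfolding K_def k_def .
qed

theorem mainTheorem12:
  fixes alpha :: real and lam :: complex
  assumes "alpha > 0" and "Re lam > 0"
  shows "\<exists>c>0. \<forall>(f :: real^'n::finite \<Rightarrow> complex) g a.
     L2 f \<longrightarrow> fourier_L2 f g \<longrightarrow> a > 0 \<longrightarrow>
     (\<integral>\<^sup>+ z \<in> (tube a :: (complex^'n) set).
         ennreal ((cmod (poisson_transform lam f z a))\<^sup>2 * tube_weight alpha a z) \<partial>lborel)
     = ennreal c * ennreal (a powr (- 2 * Re lam + 2 * real CARD('n))) *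
       (\<integral>\<^sup>+ \<xi>. ennreal ((cmod (g \<xi>))\<^sup>2 * freq_weight alpha lam (a *\<^sub>R \<xi>)) \<partial>lebesgue)"
proof -
  define m where "m = real CARD('n) / 2"
  \<comment> \<open>The factor free of a in \<open>tube_constant\<close>, with
    \<open>b = alpha - 1\<close>.\<close>
  define c where "c = (pi powr (- m) * (4 * pi) powr (- m))\<^sup>2 / (cmod (Gamma (2 * lam)))\<^sup>2 * (2 * pi) ^ (2 * CARD('n)) * 4 * 2 powr (- 2 * Re lam) * 2 powr (alpha - 1)"
  \<comment> \<open>\<open>Gamma\<close> takes the value 0 exactly at its poles, and these have
    nonpositive real part.\<close>
  have "Gamma (2 * lam) \<noteq> 0"
    using assms by (auto simp: Gamma_eq_zero_iff elim!: nonpos_Ints_cases dest: arg_cong[where f=Re])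
  then have c: "c > 0" by (simp add: c_def)
  have "(\<integral>\<^sup>+ z \<in> (tube a :: (complex^'n) set).
         ennreal ((cmod (poisson_transform lam f z a))\<^sup>2 * tube_weight alpha a z) \<partial>lborel)
     = ennreal c * ennreal (a powr (- 2 * Re lam + 2 * real CARD('n))) *
       (\<integral>\<^sup>+ \<xi>. ennreal ((cmod (g \<xi>))\<^sup>2 * freq_weight alpha lam (a *\<^sub>R \<xi>)) \<partial>lebesgue)"
    if f: "L2 f" and g: "fourier_L2 f g" and a: "a > 0" for f g :: "real^'n \<Rightarrow> complex" and a
  proof -
    \<comment> \<open>f and g are measurable for the completed measure only. The Tonelli exchanges
      are done with Borel functions, so both are replaced by Borel representatives.\<close>
    obtain f' where f' [measurable]: "f' \<in> borel_measurable borel" and ff': "AE x in lborel. f x = f' x"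
      using f completion_ex_borel_measurable_complex[of f lborel] by (auto simp: L2_def)
    obtain g' where g' [measurable]: "g' \<in> borel_measurable borel" and gg': "AE x in lborel. g x = g' x"
      using g completion_ex_borel_measurable_complex[of g lborel] by (auto simp: fourier_L2_def)
    note fL [measurable] = f[unfolded L2_def, THEN conjunct1]
    have f'L [measurable]: "f' \<in> borel_measurable lebesgue" by (rule measurable_completion) simp
    have ffL: "AE x in lebesgue. f x = f' x" using ff' by (rule AE_completion)
    have ggL: "AE x in lebesgue. g x = g' x" using gg' by (rule AE_completion)
    have f2: "integrable lborel (\<lambda>x. (cmod (f' x))\<^sup>2)"
    proof -
      have "integrable lebesgue (\<lambda>x. (cmod (f' x))\<^sup>2)"
        by (rule integrable_cong_AE_imp[OF f[unfolded L2_def, THEN conjunct2]]) (use ffL in auto)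
      then show ?thesis by (subst (asm) integrable_completion) auto
    qed
    have int_eq: "(LINT x|lebesgue. f x * h x) = (LINT x|lborel. f' x * h x)" if [measurable]: "h \<in> borel_measurable borel" for h
    proof -
      have [measurable]: "h \<in> borel_measurable lebesgue" by (rule measurable_completion) simp
      have "(LINT x|lebesgue. f x * h x) = (LINT x|lebesgue. f' x * h x)"
        by (rule integral_cong_AE) (use ffL in auto)
      also have "\<dots> = (LINT x|lborel. f' x * h x)" by (rule integral_completion) measurable
      finally show ?thesis .
    qed
    have trunc: "fourier_trunc R f \<xi> = of_real ((2 * pi) powr (- real CARD('n) / 2)) * fourier_int (\<lambda>x. indicator (cball 0 R) x * f' x) \<xi>" for R \<xi>
    proof -
      have "(LINT x : cball 0 R | lebesgue. f x * exp (- \<i> * complex_of_real (x \<bullet> \<xi>))) =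
         (LINT x|lebesgue. f x * (indicator (cball 0 R) x * exp (- \<i> * complex_of_real (x \<bullet> \<xi>))))"
        unfolding set_lebesgue_integral_def by (intro Bochner_Integration.integral_cong) (auto simp: indicator_def)
      also have "\<dots> = (LINT x|lborel. f' x * (indicator (cball 0 R) x * exp (- \<i> * complex_of_real (x \<bullet> \<xi>))))"
        by (rule int_eq, intro borel_measurable_times borel_measurable_indicator) auto
      also have "\<dots> = fourier_int (\<lambda>x. indicator (cball 0 R) x * f' x) \<xi>"
        unfolding fourier_int_def by (simp only: mult_ac)
      finally show ?thesis unfolding fourier_trunc_def by simp
    qed
    \<comment> \<open>This holds at every z, not only almost everywhere: changing f on a null set
      does not affect the integral.\<close>
    have pt: "poisson_transform lam f z a = poisson_transform lam f' z a" for z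
    proof -
      have pm: "(\<lambda>u. poisson_ext lam z u a) \<in> borel_measurable borel"
      proof -
        have "(\<lambda>u. (z, u)) \<in> measurable borel (borel :: ((complex^'n) \<times> (real^'n)) measure)"
          by (intro borel_measurable_continuous_onI continuous_intros)
        from measurable_compose[OF this poisson_ext_measurable] show ?thesis by simp
      qed
      then have "(LINT x|lebesgue. f' x * poisson_ext lam z x a) = (LINT x|lborel. f' x * poisson_ext lam z x a)"
        by (intro integral_completion) measurable
      with int_eq[OF pm] show ?thesis unfolding poisson_transform_def by simp
    qed
    have lim: "(\<lambda>k. \<integral>\<^sup>+\<xi>. ennreal ((cmod (g' \<xi> - of_real ((2 * pi) powr (- real CARD('n) / 2)) * fourier_int (\<lambda>x. indicator (cball 0 (real k)) x * f' x) \<xi>))\<^sup>2) \<partial>lborel) \<longlonglongrightarrow> 0"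
    proof -
      have "((\<lambda>R. \<integral>\<^sup>+ \<xi>. ennreal ((cmod (g \<xi> - fourier_trunc R f \<xi>))\<^sup>2) \<partial>lebesgue) \<longlongrightarrow> 0) at_top"
        using g by (simp add: fourier_L2_def)
      \<comment> \<open>The truncation argument runs along integer radii.\<close>
      from filterlim_compose[OF this filterlim_real_sequentially]
      have "(\<lambda>k. \<integral>\<^sup>+ \<xi>. ennreal ((cmod (g \<xi> - fourier_trunc (real k) f \<xi>))\<^sup>2) \<partial>lebesgue) \<longlonglongrightarrow> 0" .
      moreover have "(\<integral>\<^sup>+ \<xi>. ennreal ((cmod (g \<xi> - fourier_trunc (real k) f \<xi>))\<^sup>2) \<partial>lebesgue) =
          (\<integral>\<^sup>+\<xi>. ennreal ((cmod (g' \<xi> - of_real ((2 * pi) powr (- real CARD('n) / 2)) * fourier_int (\<lambda>x. indicator (cball 0 (real k)) x * f' x) \<xi>))\<^sup>2) \<partial>lborel)" for k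
        unfolding trunc nn_integral_completion
        by (rule nn_integral_cong_AE, rule AE_mp[OF gg']) simp
      ultimately show ?thesis by simp
    qed
    have r: "(\<integral>\<^sup>+ \<xi>. ennreal ((cmod (g \<xi>))\<^sup>2 * freq_weight alpha lam (a *\<^sub>R \<xi>)) \<partial>lebesgue) =
       (\<integral>\<^sup>+ \<xi>. ennreal ((cmod (g' \<xi>))\<^sup>2 * freq_weight alpha lam (a *\<^sub>R \<xi>)) \<partial>lborel)"
      unfolding nn_integral_completion by (rule nn_integral_cong_AE, rule AE_mp[OF gg']) simp
    have "(cmod (poisson_const lam m a))\<^sup>2 * (2 * pi) ^ (2 * CARD('n)) * (4 * (2 * a\<^sup>2) powr (- 2 * Re lam) * (2 powr (alpha - 1) * a ^ CARD('n))) =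
       c * a powr (- 2 * Re lam + 2 * real CARD('n))"
      unfolding c_def by (rule tube_constant[OF assms(2) a]) (simp add: m_def)
    with poisson_tube_identity[OF assms a f' f2 g' lim] c show ?thesis
      unfolding pt r m_def by (simp add: ennreal_mult)
  qed
  with c show ?thesis by blast
qed

end
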